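(* Let $\mu$ be a dominant weight. Regard the category of $k$-vector spaces as a strict right $\mathcal K$-module category via the polynomial functor $\mathcal P$. Then there is a unique strict morphism of $\mathcal K$-modules $\widetilde{\mathcal P}:\mathcal O_\mu\to \mathrm{Vect}_k$ (sending the empty word to $k$) such that for every $i\in Q_0$ $$\widetilde{\mathcal P}(\rho_i): k[Y_1]\to k[Y_1],\qquad f(Y_1)\mapsto(-Y_1)^{\mu_i}f(-Y_1).$$
   Context: $k$ is an algebraically closed field. $Q=(Q_0,Q_1,s,t)$ is a loop-free quiver with at most one arrow (both directions counted) between two distinct vertices; $\tau$ is an involution of $Q_0$ and $Q_1$ with $s(\tau h)=\tau(t(h))$, $t(\tau h)=\tau(s(h))$, with $\tau(s(h))=t(h)$ iff $\tau(h)=h$, and without fixed vertices. $i\to j$ means there is an arrow from $i$ to $j$. A dominant weight is $\theta=\sum_i\theta_i\varpi_i$ with $\theta_i\in\mathbb N$ ($\varpi_i$ fundamental weights). $X_{ij}(u,v)=u-v$ if $j\to i$, and $1$ otherwise; $f_{ij}(u,v)=X_{ij}(u,v)X_{ji}(v,u)$. **KLRW category $\mathcal K$:** the strict $k$-linear monoidal category with generating objects $i\in Q_0$ (black strands) and dominant weights $\theta$ (red strands), generating morphisms $x_i:i\to i$ (dot), $\sigma_{ij}:i\otimes j\to j\otimes i$, $\sigma_{i\theta}:i\otimes\theta\to\theta\otimes i$, $\sigma_{\theta i}:\theta\otimes i\to i\otimes\theta$, and relations ($y_r$ = dot on the $r$-th black strand): $(x_j\otimes1)\sigma_{ij}=\sigma_{ij}(1\otimes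 x_j)+\delta_{ij}$, $\sigma_{ij}(x_i\otimes1)=(1\otimes x_i)\sigma_{ij}+\delta_{ij}$; $\sigma_{ii}^2=0$, $\sigma_{ji}\sigma_{ij}=f_{ij}(y_1,y_2)$ for $i\ne j$; $(\sigma_{jk}\otimes1)(1\otimes\sigma_{ik})(\sigma_{ij}\otimes1)-(1\otimes\sigma_{ij})(\sigma_{ik}\otimes1)(1\otimes\sigma_{jk})=\delta_{i=k\neq j}\frac{f_{ij}(y_3,y_2)-f_{ij}(y_1,y_2)}{y_3-y_1}$; $(\sigma_{\theta j}\otimes1)(1\otimes\sigma_{ij})(\sigma_{i\theta}\otimes1)-(1\otimes\sigma_{i\theta})(\sigma_{ij}\otimes1)(1\otimes\sigma_{\theta j})=\delta_{ij}\sum_{a+b+1=\theta_i}x_i^a\otimes1\otimes x_j^b$; $(\sigma_{j\theta}\otimes1)(1\otimes\sigma_{i\theta})(\sigma_{ij}\otimes1)=(1\otimes\sigma_{ij})(\sigma_{i\theta}\otimes1)(1\otimes\sigma_{j\theta})$, $(\sigma_{ji}\otimes1)(1\otimes\sigma_{\theta i})(\sigma_{\theta j}\otimes1)=(1\otimes\sigma_{\theta j})(\sigma_{\theta i}\otimes1)(1\otimes\sigma_{ji})$; $(x_i\otimes1)\sigma_{\theta i}=\sigma_{\theta i}(1\otimes x_i)$, $\sigma_{i\theta}(x_i\otimes1)=(1\otimes x_i)\sigma_{i\theta}$; $\sigma_{i\theta}\sigma_{\theta i}=1\otimes x_i^{\theta_i}$, $\sigma_{\theta i}\sigma_{i\theta}=x_i^{\theta_i}\otimes1$.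 **oKLRW category $\mathcal O_\mu$:** the right $\mathcal K$-module category (with $\mathcal K$ acting by tensoring on the right) with the same objects as $\mathcal K$ (words), whose morphisms are linear combinations of composites of morphisms of $\mathcal K$ and morphisms $\rho_i\otimes\mathrm{id}_Z$ where $\rho_i:i\to\tau i$, $i\in Q_0$ (reflection of the leftmost strand in a mirror at the left edge), modulo the consequences (closed under composition and $-\otimes\mathrm{id}_Z$) of the relations of $\mathcal K$ and, with $f^\mu_i(u)=(-u)^{\mu_i}u^{\mu_{\tau i}}$, $\rho_{\tau i}\rho_i=f^\mu_i(-x_i)$, $\rho_ix_i=-x_{\tau i}\rho_i$, and $\sigma_{\tau j,\tau i}(\rho_j\otimes1)\sigma_{\tau i,j}(\rho_i\otimes1)-(\rho_i\otimes1)\sigma_{\tau j,i}(\rho_j\otimes1)\sigma_{ij}=\delta_{\tau i,j}\frac{f^\mu_i(y_1)-f^\mu_j(y_2)}{y_1+y_2}\sigma_{ij}$. **Polynomial functor $\mathcal P:\mathcal K\to\mathrm{Vect}_k$:** the strict monoidal functor (with $k[Y_1,\dots,Y_a]\otimes k[Y_1,\dots,Y_b]$ identified with $k[Y_1,\dots,Y_{a+b}]$) sending a word with $n$ black letters to $k[Y_1,\dots,Y_n]$, with $\mathcal P(x_i)=Y_1\cdot$, $\mathcal P(\sigma_{\theta i})=Y_1^{\theta_i}\cdot$, $\mathcal P(\sigma_{i\theta})=\mathrm{id}$, $\mathcal P(\sigma_{ij})f=X_{ij}(Y_2,Y_1)f(Y_2,Y_1)$ if $i\ne j$, and $\mathcal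 P(\sigma_{ii})f=\frac{f(Y_2,Y_1)-f(Y_1,Y_2)}{Y_2-Y_1}$. The $\mathcal K$-module structure on $\mathrm{Vect}_k$ is $V\otimes C:=V\otimes\mathcal P(C)$. A strict morphism of right $\mathcal K$-modules is a $k$-linear functor $H$ with $H(M\otimes C)=H(M)\otimes C$ on objects and morphisms. *)

theory Defs
  imports
    "HOL-Library.Poly_Mapping"
    "HOL-Library.FuncSet"
    "HOL-Computational_Algebra.Polynomial"
    "Graph_Theory.Digraph"
begin

section \<open>Strict linear categories, monoidal categories and modules\<close>

record ('o, 'm, 'k) lin_cat =
  Obj :: "'o set"
  Arr :: "'m set"
  Src :: "'m \<Rightarrow> 'o"
  Tgt :: "'m \<Rightarrow> 'o"
  Ide :: "'o \<Rightarrow> 'm"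
  Comp :: "'m \<Rightarrow> 'm \<Rightarrow> 'm"
  Nul :: "'o \<Rightarrow> 'o \<Rightarrow> 'm"
  Plus :: "'m \<Rightarrow> 'm \<Rightarrow> 'm"
  Scale :: "'k \<Rightarrow> 'm \<Rightarrow> 'm"

record ('o, 'm, 'k) monoidal_cat = "('o, 'm, 'k) lin_cat" +
  Unit :: 'o
  TensO :: "'o \<Rightarrow> 'o \<Rightarrow> 'o"
  TensA :: "'m \<Rightarrow> 'm \<Rightarrow> 'm"

record ('o, 'm, 'k, 'p, 'n) module_cat = "('o, 'm, 'k) lin_cat" +
  ActO :: "'o \<Rightarrow> 'p \<Rightarrow> 'o"
  ActA :: "'m \<Rightarrow> 'n \<Rightarrow> 'm"

record ('o, 'm, 'p, 'n) cat_map =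
  onObj :: "'o \<Rightarrow> 'p"
  onArr :: "'m \<Rightarrow> 'n"

definition homset :: "('o, 'm, 'k, 'z) lin_cat_scheme \<Rightarrow> 'o \<Rightarrow> 'o \<Rightarrow> 'm set" where
  "homset C a b = {f \<in> Arr C. Src C f = a \<and> Tgt C f = b}"

locale linear_category =
  fixes C :: "('o, 'm, 'k::field, 'z) lin_cat_scheme"
  assumes Src_Obj: "f \<in> Arr C \<Longrightarrow> Src C f \<in> Obj C"
    and Tgt_Obj: "f \<in> Arr C \<Longrightarrow> Tgt C f \<in> Obj C"
    and Ide_hom: "a \<in> Obj C \<Longrightarrow> Ide C a \<in> homset C a a"
    and Comp_hom: "f \<in> homset C a b \<Longrightarrow> g \<in> homset C b c \<Longrightarrow> Comp C g f \<in> homset C a c"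
    and Comp_assoc: "f \<in> homset C a b \<Longrightarrow> g \<in> homset C b c \<Longrightarrow> h \<in> homset C c d
          \<Longrightarrow> Comp C h (Comp C g f) = Comp C (Comp C h g) f"
    and Ide_left: "f \<in> homset C a b \<Longrightarrow> Comp C (Ide C b) f = f"
    and Ide_right: "f \<in> homset C a b \<Longrightarrow> Comp C f (Ide C a) = f"
    and Nul_hom: "a \<in> Obj C \<Longrightarrow> b \<in> Obj C \<Longrightarrow> Nul C a b \<in> homset C a b"
    and Plus_hom: "f \<in> homset C a b \<Longrightarrow> g \<in> homset C a b \<Longrightarrow> Plus C f g \<in> homset C a b"
    and Scale_hom: "f \<in> homset C a b \<Longrightarrow> Scale C x f \<in> homset C a b"
    and Plus_assoc: "f \<in> homset C a b \<Longrightarrow> g \<in> homset C a b \<Longrightarrow> h \<in> homset C a b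
          \<Longrightarrow> Plus C (Plus C f g) h = Plus C f (Plus C g h)"
    and Plus_comm: "f \<in> homset C a b \<Longrightarrow> g \<in> homset C a b \<Longrightarrow> Plus C f g = Plus C g f"
    and Plus_Nul: "f \<in> homset C a b \<Longrightarrow> Plus C f (Nul C a b) = f"
    and Plus_inverse: "f \<in> homset C a b \<Longrightarrow> Plus C f (Scale C (-1) f) = Nul C a b"
    and Scale_Plus: "f \<in> homset C a b \<Longrightarrow> g \<in> homset C a b
          \<Longrightarrow> Scale C x (Plus C f g) = Plus C (Scale C x f) (Scale C x g)"
    and Scale_add: "f \<in> homset C a b \<Longrightarrow> Scale C (x + y) f = Plus C (Scale C x f) (Scale C y f)"
    and Scale_mult: "f \<in> homset C a b \<Longrightarrow> Scale C (x * y) f = Scale C x (Scale C y f)"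
    and Scale_one: "f \<in> homset C a b \<Longrightarrow> Scale C 1 f = f"
    and Comp_Plus_left: "f \<in> homset C a b \<Longrightarrow> g \<in> homset C b c \<Longrightarrow> g' \<in> homset C b c
          \<Longrightarrow> Comp C (Plus C g g') f = Plus C (Comp C g f) (Comp C g' f)"
    and Comp_Plus_right: "f \<in> homset C a b \<Longrightarrow> f' \<in> homset C a b \<Longrightarrow> g \<in> homset C b c
          \<Longrightarrow> Comp C g (Plus C f f') = Plus C (Comp C g f) (Comp C g f')"
    and Comp_Scale_left: "f \<in> homset C a b \<Longrightarrow> g \<in> homset C b c
          \<Longrightarrow> Comp C (Scale C x g) f = Scale C x (Comp C g f)"
    and Comp_Scale_right: "f \<in> homset C a b \<Longrightarrow> g \<in> homset C b c
          \<Longrightarrow> Comp C g (Scale C x f) = Scale C x (Comp C g f)"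

locale strict_monoidal_category = linear_category K
  for K :: "('o, 'm, 'k::field, 'z) monoidal_cat_scheme" +
  assumes Unit_Obj: "Unit K \<in> Obj K"
    and TensO_Obj: "a \<in> Obj K \<Longrightarrow> b \<in> Obj K \<Longrightarrow> TensO K a b \<in> Obj K"
    and TensO_assoc: "a \<in> Obj K \<Longrightarrow> b \<in> Obj K \<Longrightarrow> c \<in> Obj K
          \<Longrightarrow> TensO K (TensO K a b) c = TensO K a (TensO K b c)"
    and TensO_Unit: "a \<in> Obj K \<Longrightarrow> TensO K a (Unit K) = a"
    and Unit_TensO: "a \<in> Obj K \<Longrightarrow> TensO K (Unit K) a = a"
    and TensA_hom: "f \<in> homset K a b \<Longrightarrow> g \<in> homset K c d
          \<Longrightarrow> TensA K f g \<in> homset K (TensO K a c) (TensO K b d)"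
    and TensA_assoc: "f \<in> Arr K \<Longrightarrow> g \<in> Arr K \<Longrightarrow> h \<in> Arr K
          \<Longrightarrow> TensA K (TensA K f g) h = TensA K f (TensA K g h)"
    and TensA_Unit: "f \<in> Arr K \<Longrightarrow> TensA K f (Ide K (Unit K)) = f"
    and Unit_TensA: "f \<in> Arr K \<Longrightarrow> TensA K (Ide K (Unit K)) f = f"
    and TensA_Ide: "a \<in> Obj K \<Longrightarrow> b \<in> Obj K \<Longrightarrow> TensA K (Ide K a) (Ide K b) = Ide K (TensO K a b)"
    and TensA_Comp: "f \<in> homset K a b \<Longrightarrow> f' \<in> homset K b c \<Longrightarrow> g \<in> homset K p q \<Longrightarrow> g' \<in> homset K q r
          \<Longrightarrow> TensA K (Comp K f' f) (Comp K g' g) = Comp K (TensA K f' g') (TensA K f g)"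
    and TensA_Plus_left: "f \<in> homset K a b \<Longrightarrow> f' \<in> homset K a b \<Longrightarrow> g \<in> Arr K
          \<Longrightarrow> TensA K (Plus K f f') g = Plus K (TensA K f g) (TensA K f' g)"
    and TensA_Plus_right: "f \<in> Arr K \<Longrightarrow> g \<in> homset K a b \<Longrightarrow> g' \<in> homset K a b
          \<Longrightarrow> TensA K f (Plus K g g') = Plus K (TensA K f g) (TensA K f g')"
    and TensA_Scale_left: "f \<in> Arr K \<Longrightarrow> g \<in> Arr K
          \<Longrightarrow> TensA K (Scale K x f) g = Scale K x (TensA K f g)"
    and TensA_Scale_right: "f \<in> Arr K \<Longrightarrow> g \<in> Arr K
          \<Longrightarrow> TensA K f (Scale K x g) = Scale K x (TensA K f g)"

locale strict_right_module = K: strict_monoidal_category K + M: linear_category M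
  for K :: "('p, 'n, 'k::field, 'y) monoidal_cat_scheme"
    and M :: "('o, 'm, 'k, 'p, 'n, 'z) module_cat_scheme" +
  assumes ActO_Obj: "a \<in> Obj M \<Longrightarrow> c \<in> Obj K \<Longrightarrow> ActO M a c \<in> Obj M"
    and ActO_assoc: "a \<in> Obj M \<Longrightarrow> c \<in> Obj K \<Longrightarrow> d \<in> Obj K
          \<Longrightarrow> ActO M (ActO M a c) d = ActO M a (TensO K c d)"
    and ActO_Unit: "a \<in> Obj M \<Longrightarrow> ActO M a (Unit K) = a"
    and ActA_hom: "f \<in> homset M a b \<Longrightarrow> g \<in> homset K c d
          \<Longrightarrow> ActA M f g \<in> homset M (ActO M a c) (ActO M b d)"
    and ActA_assoc: "f \<in> Arr M \<Longrightarrow> g \<in> Arr K \<Longrightarrow> h \<in> Arr K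
          \<Longrightarrow> ActA M (ActA M f g) h = ActA M f (TensA K g h)"
    and ActA_Unit: "f \<in> Arr M \<Longrightarrow> ActA M f (Ide K (Unit K)) = f"
    and ActA_Ide: "a \<in> Obj M \<Longrightarrow> c \<in> Obj K \<Longrightarrow> ActA M (Ide M a) (Ide K c) = Ide M (ActO M a c)"
    and ActA_Comp: "f \<in> homset M a b \<Longrightarrow> f' \<in> homset M b b' \<Longrightarrow> g \<in> homset K p q \<Longrightarrow> g' \<in> homset K q r
          \<Longrightarrow> ActA M (Comp M f' f) (Comp K g' g) = Comp M (ActA M f' g') (ActA M f g)"
    and ActA_Plus_left: "f \<in> homset M a b \<Longrightarrow> f' \<in> homset M a b \<Longrightarrow> g \<in> Arr K
          \<Longrightarrow> ActA M (Plus M f f') g = Plus M (ActA M f g) (ActA M f' g)"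
    and ActA_Plus_right: "f \<in> Arr M \<Longrightarrow> g \<in> homset K c d \<Longrightarrow> g' \<in> homset K c d
          \<Longrightarrow> ActA M f (Plus K g g') = Plus M (ActA M f g) (ActA M f g')"
    and ActA_Scale_left: "f \<in> Arr M \<Longrightarrow> g \<in> Arr K
          \<Longrightarrow> ActA M (Scale M x f) g = Scale M x (ActA M f g)"
    and ActA_Scale_right: "f \<in> Arr M \<Longrightarrow> g \<in> Arr K
          \<Longrightarrow> ActA M f (Scale K x g) = Scale M x (ActA M f g)"

text \<open>Both components are extensional, i.e. fixed to \<open>undefined\<close> outside objects and arrows, so that
  equality of \<^typ>\<open>('o, 'm, 'p, 'n) cat_map\<close> is equality of functors.\<close>

locale strict_module_morphism = source: strict_right_module K M + target: strict_right_module K N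
  for K :: "('p, 'n, 'k::field, 'y) monoidal_cat_scheme"
    and M :: "('o, 'm, 'k, 'p, 'n, 'z) module_cat_scheme"
    and N :: "('s, 't, 'k, 'p, 'n, 'w) module_cat_scheme" +
  fixes H :: "('o, 'm, 's, 't) cat_map"
  assumes onObj_extensional: "onObj H \<in> extensional (Obj M)"
    and onArr_extensional: "onArr H \<in> extensional (Arr M)"
    and onObj_Obj: "a \<in> Obj M \<Longrightarrow> onObj H a \<in> Obj N"
    and onArr_hom: "f \<in> homset M a b \<Longrightarrow> onArr H f \<in> homset N (onObj H a) (onObj H b)"
    and onArr_Ide: "a \<in> Obj M \<Longrightarrow> onArr H (Ide M a) = Ide N (onObj H a)"
    and onArr_Comp: "f \<in> homset M a b \<Longrightarrow> f' \<in> homset M b b'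
          \<Longrightarrow> onArr H (Comp M f' f) = Comp N (onArr H f') (onArr H f)"
    and onArr_Plus: "f \<in> homset M a b \<Longrightarrow> f' \<in> homset M a b
          \<Longrightarrow> onArr H (Plus M f f') = Plus N (onArr H f) (onArr H f')"
    and onArr_Scale: "f \<in> Arr M \<Longrightarrow> onArr H (Scale M x f) = Scale N x (onArr H f)"
    and onObj_ActO: "a \<in> Obj M \<Longrightarrow> c \<in> Obj K \<Longrightarrow> onObj H (ActO M a c) = ActO N (onObj H a) c"
    and onArr_ActA: "f \<in> Arr M \<Longrightarrow> g \<in> Arr K \<Longrightarrow> onArr H (ActA M f g) = ActA N (onArr H f) g"


section \<open>Quivers with involution and weights\<close>

text \<open>Vertices \<open>Q\<^sub>0 = verts Q\<close>, arrows \<open>Q\<^sub>1 = arcs Q\<close>, \<open>s = tail Q\<close>, \<open>t = head Q\<close>;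
  \<open>\<tau>\<close> acts by \<open>\<tau>0\<close> on vertices and by \<open>\<tau>1\<close> on arrows.\<close>

locale involutive_quiver = loopfree_digraph Q
  for Q :: "('v, 'a) pre_digraph" +
  fixes \<tau>0 :: "'v \<Rightarrow> 'v" and \<tau>1 :: "'a \<Rightarrow> 'a"
  assumes at_most_one_arrow: "g \<in> arcs Q \<Longrightarrow> h \<in> arcs Q
          \<Longrightarrow> {tail Q g, head Q g} = {tail Q h, head Q h} \<Longrightarrow> g = h"
    and \<tau>0_verts: "i \<in> verts Q \<Longrightarrow> \<tau>0 i \<in> verts Q"
    and \<tau>0_involution: "i \<in> verts Q \<Longrightarrow> \<tau>0 (\<tau>0 i) = i"
    and \<tau>1_arcs: "h \<in> arcs Q \<Longrightarrow> \<tau>1 h \<in> arcs Q"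
    and \<tau>1_involution: "h \<in> arcs Q \<Longrightarrow> \<tau>1 (\<tau>1 h) = h"
    and tail_\<tau>1: "h \<in> arcs Q \<Longrightarrow> tail Q (\<tau>1 h) = \<tau>0 (head Q h)"
    and head_\<tau>1: "h \<in> arcs Q \<Longrightarrow> head Q (\<tau>1 h) = \<tau>0 (tail Q h)"
    and \<tau>1_fixed_iff: "h \<in> arcs Q \<Longrightarrow> \<tau>0 (tail Q h) = head Q h \<longleftrightarrow> \<tau>1 h = h"
    and \<tau>0_no_fixed_vertex: "i \<in> verts Q \<Longrightarrow> \<tau>0 i \<noteq> i"

text \<open>The dominant weight \<open>\<Sum>\<^sub>i \<theta>\<^sub>i \<varpi>\<^sub>i\<close> is the finitely supported function \<open>i \<mapsto> \<theta>\<^sub>i\<close>.\<close>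

definition dominant_weight :: "('v, 'a) pre_digraph \<Rightarrow> ('v \<Rightarrow>\<^sub>0 nat) \<Rightarrow> bool" where
  "dominant_weight Q \<theta> \<longleftrightarrow> Poly_Mapping.keys \<theta> \<subseteq> verts Q"

datatype 'v letter = Black 'v | Red "'v \<Rightarrow>\<^sub>0 nat"

type_synonym 'v word = "'v letter list"

definition letters :: "('v, 'a) pre_digraph \<Rightarrow> 'v letter set" where
  "letters Q = Black ` verts Q \<union> Red ` {\<theta>. dominant_weight Q \<theta>}"

fun is_black :: "'v letter \<Rightarrow> bool" where
  "is_black (Black i) = True"
| "is_black (Red \<theta>) = False"

definition nblack :: "'v word \<Rightarrow> nat" where
  "nblack w = length (filter is_black w)"


section \<open>Polynomials\<close>

definition pvar :: "'x \<Rightarrow> ('x \<Rightarrow>\<^sub>0 nat) \<Rightarrow>\<^sub>0 'k::comm_ring_1" where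
  "pvar x = Poly_Mapping.single (Poly_Mapping.single x 1) 1"

definition poly_subst ::
    "('x \<Rightarrow> ('y \<Rightarrow>\<^sub>0 nat) \<Rightarrow>\<^sub>0 'k::comm_ring_1) \<Rightarrow> (('x \<Rightarrow>\<^sub>0 nat) \<Rightarrow>\<^sub>0 'k) \<Rightarrow> (('y \<Rightarrow>\<^sub>0 nat) \<Rightarrow>\<^sub>0 'k)" where
  "poly_subst s p =
     (\<Sum>m\<in>Poly_Mapping.keys p. Poly_Mapping.single 0 (Poly_Mapping.lookup p m) *
        (\<Prod>x\<in>Poly_Mapping.keys m. s x ^ Poly_Mapping.lookup m x))"

text \<open>The quotient \<open>p / q\<close> in a ring where \<open>q\<close> divides \<open>p\<close> and is not a zero divisor.\<close>

definition exact_quotient :: "'r::comm_ring_1 \<Rightarrow> 'r \<Rightarrow> 'r" where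
  "exact_quotient p q = (THE h. h * q = p)"

definition X :: "('v, 'a) pre_digraph \<Rightarrow> 'v \<Rightarrow> 'v \<Rightarrow> 'r::comm_ring_1 \<Rightarrow> 'r \<Rightarrow> 'r" where
  "X Q i j u v = (if j \<rightarrow>\<^bsub>Q\<^esub> i then u - v else 1)"

definition f_arrow :: "('v, 'a) pre_digraph \<Rightarrow> 'v \<Rightarrow> 'v \<Rightarrow> 'r::comm_ring_1 \<Rightarrow> 'r \<Rightarrow> 'r" where
  "f_arrow Q i j u v = X Q i j u v * X Q j i v u"

definition f_weight :: "('v \<Rightarrow> 'v) \<Rightarrow> ('v \<Rightarrow>\<^sub>0 nat) \<Rightarrow> 'v \<Rightarrow> 'r::comm_ring_1 \<Rightarrow> 'r" where
  "f_weight \<tau> \<mu> i u = (- u) ^ Poly_Mapping.lookup \<mu> i * u ^ Poly_Mapping.lookup \<mu> (\<tau> i)"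


section \<open>The KLRW category\<close>

text \<open>Formal expressions for morphisms. \<open>KCross l m : l \<otimes> m \<rightarrow> m \<otimes> l\<close> is the crossing \<open>\<sigma>\<close>; only
  crossings with at least one black strand are well-typed. \<open>KZero a b\<close> is the zero morphism
  \<open>a \<rightarrow> b\<close>, i.e. the empty linear combination.\<close>

datatype ('v, 'k) kterm =
    KId "'v word"
  | KDot 'v
  | KCross "'v letter" "'v letter"
  | KComp "('v, 'k) kterm" "('v, 'k) kterm"  (infixr \<open>\<circ>\<^sub>K\<close> 70)
  | KTens "('v, 'k) kterm" "('v, 'k) kterm"  (infixr \<open>\<otimes>\<^sub>K\<close> 75)
  | KZero "'v word" "'v word"
  | KAdd "('v, 'k) kterm" "('v, 'k) kterm"  (infixl \<open>+\<^sub>K\<close> 65)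
  | KScale 'k "('v, 'k) kterm"

primrec ksrc :: "('v, 'k) kterm \<Rightarrow> 'v word" where
  "ksrc (KId w) = w"
| "ksrc (KDot i) = [Black i]"
| "ksrc (KCross l m) = [l, m]"
| "ksrc (g \<circ>\<^sub>K f) = ksrc f"
| "ksrc (f \<otimes>\<^sub>K g) = ksrc f @ ksrc g"
| "ksrc (KZero a b) = a"
| "ksrc (f +\<^sub>K g) = ksrc f"
| "ksrc (KScale c f) = ksrc f"

primrec ktgt :: "('v, 'k) kterm \<Rightarrow> 'v word" where
  "ktgt (KId w) = w"
| "ktgt (KDot i) = [Black i]"
| "ktgt (KCross l m) = [m, l]"
| "ktgt (g \<circ>\<^sub>K f) = ktgt g"
| "ktgt (f \<otimes>\<^sub>K g) = ktgt f @ ktgt g"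
| "ktgt (KZero a b) = b"
| "ktgt (f +\<^sub>K g) = ktgt f"
| "ktgt (KScale c f) = ktgt f"

inductive karr :: "('v, 'a) pre_digraph \<Rightarrow> ('v, 'k) kterm \<Rightarrow> 'v word \<Rightarrow> 'v word \<Rightarrow> bool"
  for Q :: "('v, 'a) pre_digraph" where
  karr_Id: "w \<in> lists (letters Q) \<Longrightarrow> karr Q (KId w) w w"
| karr_Dot: "i \<in> verts Q \<Longrightarrow> karr Q (KDot i) [Black i] [Black i]"
| karr_Cross: "l \<in> letters Q \<Longrightarrow> m \<in> letters Q \<Longrightarrow> is_black l \<or> is_black m
    \<Longrightarrow> karr Q (KCross l m) [l, m] [m, l]"
| karr_Comp: "karr Q f a b \<Longrightarrow> karr Q g b c \<Longrightarrow> karr Q (g \<circ>\<^sub>K f) a c"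
| karr_Tens: "karr Q f a b \<Longrightarrow> karr Q g c d \<Longrightarrow> karr Q (f \<otimes>\<^sub>K g) (a @ c) (b @ d)"
| karr_Zero: "a \<in> lists (letters Q) \<Longrightarrow> b \<in> lists (letters Q) \<Longrightarrow> karr Q (KZero a b) a b"
| karr_Add: "karr Q f a b \<Longrightarrow> karr Q g a b \<Longrightarrow> karr Q (f +\<^sub>K g) a b"
| karr_Scale: "karr Q f a b \<Longrightarrow> karr Q (KScale c f) a b"

definition kminus :: "('v, 'k::field) kterm \<Rightarrow> ('v, 'k) kterm \<Rightarrow> ('v, 'k) kterm"  (infixl \<open>-\<^sub>K\<close> 65)
  where "s -\<^sub>K t = s +\<^sub>K KScale (-1) t"

definition kpow :: "'v word \<Rightarrow> ('v, 'k) kterm \<Rightarrow> nat \<Rightarrow> ('v, 'k) kterm" where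
  "kpow w t n = ((\<lambda>s. t \<circ>\<^sub>K s) ^^ n) (KId w)"

abbreviation K1 :: "'v letter \<Rightarrow> ('v, 'k) kterm" where
  "K1 l \<equiv> KId [l]"

text \<open>\<open>ydot is r\<close> is the dot \<open>y\<^sub>r\<close> on the \<open>r\<close>-th strand (counted from \<open>1\<close>) of the all-black word \<open>is\<close>,
  and \<open>dots is p\<close> is \<open>p(y\<^sub>1, y\<^sub>2, \<dots>)\<close>, for a polynomial \<open>p\<close> in variables indexed by \<open>1, 2, \<dots>\<close>.\<close>

definition ydot :: "'v list \<Rightarrow> nat \<Rightarrow> ('v, 'k) kterm" where
  "ydot is r = KId (map Black (take (r - 1) is)) \<otimes>\<^sub>K KDot (is ! (r - 1))
                 \<otimes>\<^sub>K KId (map Black (drop r is))"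

definition dots_monomial :: "'v list \<Rightarrow> (nat \<Rightarrow>\<^sub>0 nat) \<Rightarrow> ('v, 'k) kterm" where
  "dots_monomial is m =
     foldr (\<lambda>r t. kpow (map Black is) (ydot is r) (Poly_Mapping.lookup m r) \<circ>\<^sub>K t)
       [1..<Suc (length is)] (KId (map Black is))"

definition dots :: "'v list \<Rightarrow> ((nat \<Rightarrow>\<^sub>0 nat) \<Rightarrow>\<^sub>0 'k::field) \<Rightarrow> ('v, 'k) kterm" where
  "dots is p =
     foldr (\<lambda>m t. KScale (Poly_Mapping.lookup p m) (dots_monomial is m) +\<^sub>K t)
       (sorted_list_of_set (Poly_Mapping.keys p)) (KZero (map Black is) (map Black is))"

abbreviation yvar :: "nat \<Rightarrow> (nat \<Rightarrow>\<^sub>0 nat) \<Rightarrow>\<^sub>0 'k::field" where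
  "yvar \<equiv> pvar"

abbreviation xbb :: "'v \<Rightarrow> 'v \<Rightarrow> ('v, 'k) kterm" where
  "xbb i j \<equiv> KCross (Black i) (Black j)"
abbreviation xbr :: "'v \<Rightarrow> ('v \<Rightarrow>\<^sub>0 nat) \<Rightarrow> ('v, 'k) kterm" where
  "xbr i \<theta> \<equiv> KCross (Black i) (Red \<theta>)"
abbreviation xrb :: "('v \<Rightarrow>\<^sub>0 nat) \<Rightarrow> 'v \<Rightarrow> ('v, 'k) kterm" where
  "xrb \<theta> i \<equiv> KCross (Red \<theta>) (Black i)"

inductive krel :: "('v, 'a) pre_digraph \<Rightarrow> ('v, 'k::field) kterm \<Rightarrow> ('v, 'k) kterm \<Rightarrow> bool"
  for Q :: "('v, 'a) pre_digraph" where
  krel_dot_left: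
    "i \<in> verts Q \<Longrightarrow> j \<in> verts Q \<Longrightarrow>
     krel Q ((KDot j \<otimes>\<^sub>K K1 (Black i)) \<circ>\<^sub>K xbb i j)
       (xbb i j \<circ>\<^sub>K (K1 (Black i) \<otimes>\<^sub>K KDot j)
         +\<^sub>K (if i = j then KId [Black i, Black j] else KZero [Black i, Black j] [Black j, Black i]))"
| krel_dot_right:
    "i \<in> verts Q \<Longrightarrow> j \<in> verts Q \<Longrightarrow>
     krel Q (xbb i j \<circ>\<^sub>K (KDot i \<otimes>\<^sub>K K1 (Black j)))
       ((K1 (Black j) \<otimes>\<^sub>K KDot i) \<circ>\<^sub>K xbb i j
         +\<^sub>K (if i = j then KId [Black i, Black j] else KZero [Black i, Black j] [Black j, Black i]))"
| krel_square_same: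
    "i \<in> verts Q \<Longrightarrow> krel Q (xbb i i \<circ>\<^sub>K xbb i i) (KZero [Black i, Black i] [Black i, Black i])"
| krel_square_diff:
    "i \<in> verts Q \<Longrightarrow> j \<in> verts Q \<Longrightarrow> i \<noteq> j \<Longrightarrow>
     krel Q (xbb j i \<circ>\<^sub>K xbb i j) (dots [i, j] (f_arrow Q i j (yvar 1) (yvar 2)))"
| krel_braid:
    "i \<in> verts Q \<Longrightarrow> j \<in> verts Q \<Longrightarrow> k \<in> verts Q \<Longrightarrow>
     krel Q
       ((xbb j k \<otimes>\<^sub>K K1 (Black i)) \<circ>\<^sub>K (K1 (Black j) \<otimes>\<^sub>K xbb i k) \<circ>\<^sub>K (xbb i j \<otimes>\<^sub>K K1 (Black k))
        -\<^sub>K (K1 (Black k) \<otimes>\<^sub>K xbb i j) \<circ>\<^sub>K (xbb i k \<otimes>\<^sub>K K1 (Black j)) \<circ>\<^sub>K (K1 (Black i) \<otimes>\<^sub>K xbb j k))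
       (if i = k \<and> k \<noteq> j
        then dots [i, j, k]
               (exact_quotient (f_arrow Q i j (yvar 3) (yvar 2) - f_arrow Q i j (yvar 1) (yvar 2))
                 (yvar 3 - yvar 1))
        else KZero [Black i, Black j, Black k] [Black k, Black j, Black i])"
| krel_red_middle:
    "i \<in> verts Q \<Longrightarrow> j \<in> verts Q \<Longrightarrow> dominant_weight Q \<theta> \<Longrightarrow>
     krel Q
       ((xrb \<theta> j \<otimes>\<^sub>K K1 (Black i)) \<circ>\<^sub>K (K1 (Red \<theta>) \<otimes>\<^sub>K xbb i j) \<circ>\<^sub>K (xbr i \<theta> \<otimes>\<^sub>K K1 (Black j))
        -\<^sub>K (K1 (Black j) \<otimes>\<^sub>K xbr i \<theta>) \<circ>\<^sub>K (xbb i j \<otimes>\<^sub>K K1 (Red \<theta>)) \<circ>\<^sub>K (K1 (Black i) \<otimes>\<^sub>K xrb \<theta> j))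
       (if i = j
        then foldr (+\<^sub>K)
               [kpow [Black i] (KDot i) a \<otimes>\<^sub>K K1 (Red \<theta>) \<otimes>\<^sub>K kpow [Black j] (KDot j) b.
                  a \<leftarrow> [0..<Poly_Mapping.lookup \<theta> i], b \<leftarrow> [0..<Poly_Mapping.lookup \<theta> i],
                  a + b + 1 = Poly_Mapping.lookup \<theta> i]
               (KZero [Black i, Red \<theta>, Black j] [Black j, Red \<theta>, Black i])
        else KZero [Black i, Red \<theta>, Black j] [Black j, Red \<theta>, Black i])"
| krel_red_right:
    "i \<in> verts Q \<Longrightarrow> j \<in> verts Q \<Longrightarrow> dominant_weight Q \<theta> \<Longrightarrow>
     krel Q
       ((xbr j \<theta> \<otimes>\<^sub>K K1 (Black i)) \<circ>\<^sub>K (K1 (Black j) \<otimes>\<^sub>K xbr i \<theta>) \<circ>\<^sub>K (xbb i j \<otimes>\<^sub>K K1 (Red \<theta>)))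
       ((K1 (Red \<theta>) \<otimes>\<^sub>K xbb i j) \<circ>\<^sub>K (xbr i \<theta> \<otimes>\<^sub>K K1 (Black j)) \<circ>\<^sub>K (K1 (Black i) \<otimes>\<^sub>K xbr j \<theta>))"
| krel_red_left:
    "i \<in> verts Q \<Longrightarrow> j \<in> verts Q \<Longrightarrow> dominant_weight Q \<theta> \<Longrightarrow>
     krel Q
       ((xbb j i \<otimes>\<^sub>K K1 (Red \<theta>)) \<circ>\<^sub>K (K1 (Black j) \<otimes>\<^sub>K xrb \<theta> i) \<circ>\<^sub>K (xrb \<theta> j \<otimes>\<^sub>K K1 (Black i)))
       ((K1 (Black i) \<otimes>\<^sub>K xrb \<theta> j) \<circ>\<^sub>K (xrb \<theta> i \<otimes>\<^sub>K K1 (Black j)) \<circ>\<^sub>K (K1 (Red \<theta>) \<otimes>\<^sub>K xbb j i))"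
| krel_dot_red_left:
    "i \<in> verts Q \<Longrightarrow> dominant_weight Q \<theta> \<Longrightarrow>
     krel Q ((KDot i \<otimes>\<^sub>K K1 (Red \<theta>)) \<circ>\<^sub>K xrb \<theta> i) (xrb \<theta> i \<circ>\<^sub>K (K1 (Red \<theta>) \<otimes>\<^sub>K KDot i))"
| krel_dot_red_right:
    "i \<in> verts Q \<Longrightarrow> dominant_weight Q \<theta> \<Longrightarrow>
     krel Q (xbr i \<theta> \<circ>\<^sub>K (KDot i \<otimes>\<^sub>K K1 (Red \<theta>))) ((K1 (Red \<theta>) \<otimes>\<^sub>K KDot i) \<circ>\<^sub>K xbr i \<theta>)"
| krel_square_red_black:
    "i \<in> verts Q \<Longrightarrow> dominant_weight Q \<theta> \<Longrightarrow>
     krel Q (xbr i \<theta> \<circ>\<^sub>K xrb \<theta> i) (K1 (Red \<theta>) \<otimes>\<^sub>K kpow [Black i] (KDot i) (Poly_Mapping.lookup \<theta> i))"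
| krel_square_black_red:
    "i \<in> verts Q \<Longrightarrow> dominant_weight Q \<theta> \<Longrightarrow>
     krel Q (xrb \<theta> i \<circ>\<^sub>K xbr i \<theta>) (kpow [Black i] (KDot i) (Poly_Mapping.lookup \<theta> i) \<otimes>\<^sub>K K1 (Red \<theta>))"

text \<open>Equality of morphisms: the least congruence that contains the defining relations and makes
  the terms into a strict linear monoidal category.\<close>

inductive keq :: "('v, 'a) pre_digraph \<Rightarrow> ('v, 'k::field) kterm \<Rightarrow> ('v, 'k) kterm \<Rightarrow> bool"
  for Q :: "('v, 'a) pre_digraph" where
  keq_refl: "karr Q f a b \<Longrightarrow> keq Q f f"
| keq_sym: "keq Q f g \<Longrightarrow> keq Q g f"
| keq_trans: "keq Q f g \<Longrightarrow> keq Q g h \<Longrightarrow> keq Q f h"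
| keq_Comp: "karr Q f a b \<Longrightarrow> karr Q g b c \<Longrightarrow> keq Q f f' \<Longrightarrow> keq Q g g' \<Longrightarrow> keq Q (g \<circ>\<^sub>K f) (g' \<circ>\<^sub>K f')"
| keq_Tens: "keq Q f f' \<Longrightarrow> keq Q g g' \<Longrightarrow> keq Q (f \<otimes>\<^sub>K g) (f' \<otimes>\<^sub>K g')"
| keq_Add: "karr Q f a b \<Longrightarrow> karr Q g a b \<Longrightarrow> keq Q f f' \<Longrightarrow> keq Q g g' \<Longrightarrow> keq Q (f +\<^sub>K g) (f' +\<^sub>K g')"
| keq_Scale: "keq Q f f' \<Longrightarrow> keq Q (KScale x f) (KScale x f')"
| keq_rel: "krel Q f g \<Longrightarrow> keq Q f g"
| keq_Comp_assoc: "karr Q f a b \<Longrightarrow> karr Q g b c \<Longrightarrow> karr Q h c d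
    \<Longrightarrow> keq Q (h \<circ>\<^sub>K (g \<circ>\<^sub>K f)) ((h \<circ>\<^sub>K g) \<circ>\<^sub>K f)"
| keq_Id_left: "karr Q f a b \<Longrightarrow> keq Q (KId b \<circ>\<^sub>K f) f"
| keq_Id_right: "karr Q f a b \<Longrightarrow> keq Q (f \<circ>\<^sub>K KId a) f"
| keq_Add_assoc: "karr Q f a b \<Longrightarrow> karr Q g a b \<Longrightarrow> karr Q h a b
    \<Longrightarrow> keq Q ((f +\<^sub>K g) +\<^sub>K h) (f +\<^sub>K (g +\<^sub>K h))"
| keq_Add_comm: "karr Q f a b \<Longrightarrow> karr Q g a b \<Longrightarrow> keq Q (f +\<^sub>K g) (g +\<^sub>K f)"
| keq_Add_Zero: "karr Q f a b \<Longrightarrow> keq Q (f +\<^sub>K KZero a b) f"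
| keq_Add_inverse: "karr Q f a b \<Longrightarrow> keq Q (f +\<^sub>K KScale (-1) f) (KZero a b)"
| keq_Scale_Add: "karr Q f a b \<Longrightarrow> karr Q g a b
    \<Longrightarrow> keq Q (KScale x (f +\<^sub>K g)) (KScale x f +\<^sub>K KScale x g)"
| keq_Scale_add: "karr Q f a b \<Longrightarrow> keq Q (KScale (x + x') f) (KScale x f +\<^sub>K KScale x' f)"
| keq_Scale_mult: "karr Q f a b \<Longrightarrow> keq Q (KScale (x * x') f) (KScale x (KScale x' f))"
| keq_Scale_one: "karr Q f a b \<Longrightarrow> keq Q (KScale 1 f) f"
| keq_Comp_Add_left: "karr Q f a b \<Longrightarrow> karr Q g b c \<Longrightarrow> karr Q g' b c
    \<Longrightarrow> keq Q ((g +\<^sub>K g') \<circ>\<^sub>K f) (g \<circ>\<^sub>K f +\<^sub>K g' \<circ>\<^sub>K f)"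
| keq_Comp_Add_right: "karr Q f a b \<Longrightarrow> karr Q f' a b \<Longrightarrow> karr Q g b c
    \<Longrightarrow> keq Q (g \<circ>\<^sub>K (f +\<^sub>K f')) (g \<circ>\<^sub>K f +\<^sub>K g \<circ>\<^sub>K f')"
| keq_Comp_Scale_left: "karr Q f a b \<Longrightarrow> karr Q g b c
    \<Longrightarrow> keq Q (KScale x g \<circ>\<^sub>K f) (KScale x (g \<circ>\<^sub>K f))"
| keq_Comp_Scale_right: "karr Q f a b \<Longrightarrow> karr Q g b c
    \<Longrightarrow> keq Q (g \<circ>\<^sub>K KScale x f) (KScale x (g \<circ>\<^sub>K f))"
| keq_Tens_assoc: "karr Q f a b \<Longrightarrow> karr Q g c d \<Longrightarrow> karr Q h p q
    \<Longrightarrow> keq Q ((f \<otimes>\<^sub>K g) \<otimes>\<^sub>K h) (f \<otimes>\<^sub>K (g \<otimes>\<^sub>K h))"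
| keq_Tens_Unit: "karr Q f a b \<Longrightarrow> keq Q (f \<otimes>\<^sub>K KId []) f"
| keq_Unit_Tens: "karr Q f a b \<Longrightarrow> keq Q (KId [] \<otimes>\<^sub>K f) f"
| keq_Tens_Id: "a \<in> lists (letters Q) \<Longrightarrow> b \<in> lists (letters Q)
    \<Longrightarrow> keq Q (KId a \<otimes>\<^sub>K KId b) (KId (a @ b))"
| keq_Tens_Comp: "karr Q f a b \<Longrightarrow> karr Q f' b c \<Longrightarrow> karr Q g p q \<Longrightarrow> karr Q g' q r
    \<Longrightarrow> keq Q ((f' \<circ>\<^sub>K f) \<otimes>\<^sub>K (g' \<circ>\<^sub>K g)) ((f' \<otimes>\<^sub>K g') \<circ>\<^sub>K (f \<otimes>\<^sub>K g))"
| keq_Tens_Add_left: "karr Q f a b \<Longrightarrow> karr Q f' a b \<Longrightarrow> karr Q g c d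
    \<Longrightarrow> keq Q ((f +\<^sub>K f') \<otimes>\<^sub>K g) (f \<otimes>\<^sub>K g +\<^sub>K f' \<otimes>\<^sub>K g)"
| keq_Tens_Add_right: "karr Q f a b \<Longrightarrow> karr Q g c d \<Longrightarrow> karr Q g' c d
    \<Longrightarrow> keq Q (f \<otimes>\<^sub>K (g +\<^sub>K g')) (f \<otimes>\<^sub>K g +\<^sub>K f \<otimes>\<^sub>K g')"
| keq_Tens_Scale_left: "karr Q f a b \<Longrightarrow> karr Q g c d
    \<Longrightarrow> keq Q (KScale x f \<otimes>\<^sub>K g) (KScale x (f \<otimes>\<^sub>K g))"
| keq_Tens_Scale_right: "karr Q f a b \<Longrightarrow> karr Q g c d
    \<Longrightarrow> keq Q (f \<otimes>\<^sub>K KScale x g) (KScale x (f \<otimes>\<^sub>K g))"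

definition kclass :: "('v, 'a) pre_digraph \<Rightarrow> ('v, 'k::field) kterm set \<Rightarrow> ('v, 'k) kterm set" where
  "kclass Q S = {(s, t). keq Q s t} `` S"

type_synonym ('v, 'k) kmor = "'v word \<times> ('v, 'k) kterm set \<times> 'v word"

text \<open>An arrow of the category is a triple (source, equivalence class of terms, target).\<close>

definition KLRW :: "('v, 'a) pre_digraph \<Rightarrow> ('v word, ('v, 'k::field) kmor, 'k) monoidal_cat" where
  "KLRW Q =
   \<lparr> Obj = lists (letters Q),
     Arr = {(a, kclass Q {t}, b) | a t b. karr Q t a b},
     Src = fst,
     Tgt = (\<lambda>F. snd (snd F)),
     Ide = (\<lambda>a. (a, kclass Q {KId a}, a)),
     Comp = (\<lambda>(_, T, c) (a, S, _). (a, kclass Q {t \<circ>\<^sub>K s | t s. t \<in> T \<and> s \<in> S}, c)),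
     Nul = (\<lambda>a b. (a, kclass Q {KZero a b}, b)),
     Plus = (\<lambda>(a, S, b) (_, T, _). (a, kclass Q {s +\<^sub>K t | s t. s \<in> S \<and> t \<in> T}, b)),
     Scale = (\<lambda>x (a, S, b). (a, kclass Q (KScale x ` S), b)),
     Unit = [],
     TensO = (@),
     TensA = (\<lambda>(a, S, b) (c, T, d). (a @ c, kclass Q {s \<otimes>\<^sub>K t | s t. s \<in> S \<and> t \<in> T}, b @ d)) \<rparr>"


section \<open>The oKLRW category\<close>

text \<open>Formal expressions for morphisms of a right module category: \<open>OEmb\<close> views a morphism of the
  KLRW category as a morphism of the module category, \<open>ORho i\<close> is \<open>\<rho>\<^sub>i\<close>, and \<open>f \<otimes>\<^sub>O g\<close> is the action
  of a morphism \<open>g\<close> of the KLRW category. By the interchange law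
  \<open>f \<otimes>\<^sub>O g = (id \<otimes> g) \<circ> (f \<otimes> id)\<close>, every term is equal to a linear combination of composites of
  morphisms of the KLRW category and of morphisms \<open>\<rho>\<^sub>i \<otimes> id\<close>.\<close>

datatype ('v, 'k) oterm =
    OEmb "('v, 'k) kterm"
  | ORho 'v
  | OAct "('v, 'k) oterm" "('v, 'k) kterm"  (infixl \<open>\<otimes>\<^sub>O\<close> 75)
  | OComp "('v, 'k) oterm" "('v, 'k) oterm"  (infixr \<open>\<circ>\<^sub>O\<close> 70)
  | OZero "'v word" "'v word"
  | OAdd "('v, 'k) oterm" "('v, 'k) oterm"  (infixl \<open>+\<^sub>O\<close> 65)
  | OScale 'k "('v, 'k) oterm"

inductive oarr ::
    "('v, 'a) pre_digraph \<Rightarrow> ('v \<Rightarrow> 'v) \<Rightarrow> ('v, 'k) oterm \<Rightarrow> 'v word \<Rightarrow> 'v word \<Rightarrow> bool"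
  for Q :: "('v, 'a) pre_digraph" and \<tau> :: "'v \<Rightarrow> 'v" where
  oarr_Emb: "karr Q f a b \<Longrightarrow> oarr Q \<tau> (OEmb f) a b"
| oarr_Rho: "i \<in> verts Q \<Longrightarrow> oarr Q \<tau> (ORho i) [Black i] [Black (\<tau> i)]"
| oarr_Act: "oarr Q \<tau> f a b \<Longrightarrow> karr Q g c d \<Longrightarrow> oarr Q \<tau> (f \<otimes>\<^sub>O g) (a @ c) (b @ d)"
| oarr_Comp: "oarr Q \<tau> f a b \<Longrightarrow> oarr Q \<tau> g b c \<Longrightarrow> oarr Q \<tau> (g \<circ>\<^sub>O f) a c"
| oarr_Zero: "a \<in> lists (letters Q) \<Longrightarrow> b \<in> lists (letters Q) \<Longrightarrow> oarr Q \<tau> (OZero a b) a b"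
| oarr_Add: "oarr Q \<tau> f a b \<Longrightarrow> oarr Q \<tau> g a b \<Longrightarrow> oarr Q \<tau> (f +\<^sub>O g) a b"
| oarr_Scale: "oarr Q \<tau> f a b \<Longrightarrow> oarr Q \<tau> (OScale c f) a b"

definition ominus :: "('v, 'k::field) oterm \<Rightarrow> ('v, 'k) oterm \<Rightarrow> ('v, 'k) oterm"  (infixl \<open>-\<^sub>O\<close> 65)
  where "s -\<^sub>O t = s +\<^sub>O OScale (-1) t"

inductive orel ::
    "('v, 'a) pre_digraph \<Rightarrow> ('v \<Rightarrow> 'v) \<Rightarrow> ('v \<Rightarrow>\<^sub>0 nat) \<Rightarrow> ('v, 'k::field) oterm \<Rightarrow> ('v, 'k) oterm \<Rightarrow> bool"
  for Q :: "('v, 'a) pre_digraph" and \<tau> :: "'v \<Rightarrow> 'v" and \<mu> :: "'v \<Rightarrow>\<^sub>0 nat" where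
  orel_square:
    "i \<in> verts Q \<Longrightarrow>
     orel Q \<tau> \<mu> (ORho (\<tau> i) \<circ>\<^sub>O ORho i) (OEmb (dots [i] (f_weight \<tau> \<mu> i (- yvar 1))))"
| orel_dot:
    "i \<in> verts Q \<Longrightarrow>
     orel Q \<tau> \<mu> (ORho i \<circ>\<^sub>O OEmb (KDot i)) (OScale (-1) (OEmb (KDot (\<tau> i)) \<circ>\<^sub>O ORho i))"
| orel_reflection:
    "i \<in> verts Q \<Longrightarrow> j \<in> verts Q \<Longrightarrow>
     orel Q \<tau> \<mu>
       (OEmb (xbb (\<tau> j) (\<tau> i)) \<circ>\<^sub>O (ORho j \<otimes>\<^sub>O K1 (Black (\<tau> i)))
          \<circ>\<^sub>O OEmb (xbb (\<tau> i) j) \<circ>\<^sub>O (ORho i \<otimes>\<^sub>O K1 (Black j))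
        -\<^sub>O (ORho i \<otimes>\<^sub>O K1 (Black (\<tau> j))) \<circ>\<^sub>O OEmb (xbb (\<tau> j) i)
          \<circ>\<^sub>O (ORho j \<otimes>\<^sub>O K1 (Black i)) \<circ>\<^sub>O OEmb (xbb i j))
       (if \<tau> i = j
        then OEmb (dots [j, i]
                 (exact_quotient (f_weight \<tau> \<mu> i (yvar 1) - f_weight \<tau> \<mu> j (yvar 2))
                   (yvar 1 + yvar 2)))
               \<circ>\<^sub>O OEmb (xbb i j)
        else OZero [Black i, Black j] [Black (\<tau> i), Black (\<tau> j)])"

text \<open>Equality of morphisms: the least congruence that contains the defining relations and makes
  the terms into a strict right module category over the KLRW category, acting on embedded
  morphisms by the tensor product.\<close>

inductive oeq ::
    "('v, 'a) pre_digraph \<Rightarrow> ('v \<Rightarrow> 'v) \<Rightarrow> ('v \<Rightarrow>\<^sub>0 nat) \<Rightarrow> ('v, 'k::field) oterm \<Rightarrow> ('v, 'k) oterm \<Rightarrow> bool"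
  for Q :: "('v, 'a) pre_digraph" and \<tau> :: "'v \<Rightarrow> 'v" and \<mu> :: "'v \<Rightarrow>\<^sub>0 nat" where
  oeq_refl: "oarr Q \<tau> f a b \<Longrightarrow> oeq Q \<tau> \<mu> f f"
| oeq_sym: "oeq Q \<tau> \<mu> f g \<Longrightarrow> oeq Q \<tau> \<mu> g f"
| oeq_trans: "oeq Q \<tau> \<mu> f g \<Longrightarrow> oeq Q \<tau> \<mu> g h \<Longrightarrow> oeq Q \<tau> \<mu> f h"
| oeq_Comp: "oarr Q \<tau> f a b \<Longrightarrow> oarr Q \<tau> g b c \<Longrightarrow> oeq Q \<tau> \<mu> f f' \<Longrightarrow> oeq Q \<tau> \<mu> g g'
    \<Longrightarrow> oeq Q \<tau> \<mu> (g \<circ>\<^sub>O f) (g' \<circ>\<^sub>O f')"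
| oeq_Act: "oeq Q \<tau> \<mu> f f' \<Longrightarrow> keq Q g g' \<Longrightarrow> oeq Q \<tau> \<mu> (f \<otimes>\<^sub>O g) (f' \<otimes>\<^sub>O g')"
| oeq_Add: "oarr Q \<tau> f a b \<Longrightarrow> oarr Q \<tau> g a b \<Longrightarrow> oeq Q \<tau> \<mu> f f' \<Longrightarrow> oeq Q \<tau> \<mu> g g'
    \<Longrightarrow> oeq Q \<tau> \<mu> (f +\<^sub>O g) (f' +\<^sub>O g')"
| oeq_Scale: "oeq Q \<tau> \<mu> f f' \<Longrightarrow> oeq Q \<tau> \<mu> (OScale x f) (OScale x f')"
| oeq_rel: "orel Q \<tau> \<mu> f g \<Longrightarrow> oeq Q \<tau> \<mu> f g"
| oeq_Emb: "keq Q f g \<Longrightarrow> oeq Q \<tau> \<mu> (OEmb f) (OEmb g)"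
| oeq_Emb_Comp: "karr Q f a b \<Longrightarrow> karr Q g b c \<Longrightarrow> oeq Q \<tau> \<mu> (OEmb (g \<circ>\<^sub>K f)) (OEmb g \<circ>\<^sub>O OEmb f)"
| oeq_Emb_Add: "karr Q f a b \<Longrightarrow> karr Q g a b \<Longrightarrow> oeq Q \<tau> \<mu> (OEmb (f +\<^sub>K g)) (OEmb f +\<^sub>O OEmb g)"
| oeq_Emb_Scale: "karr Q f a b \<Longrightarrow> oeq Q \<tau> \<mu> (OEmb (KScale x f)) (OScale x (OEmb f))"
| oeq_Emb_Zero: "a \<in> lists (letters Q) \<Longrightarrow> b \<in> lists (letters Q)
    \<Longrightarrow> oeq Q \<tau> \<mu> (OEmb (KZero a b)) (OZero a b)"
| oeq_Emb_Act: "karr Q f a b \<Longrightarrow> karr Q g c d \<Longrightarrow> oeq Q \<tau> \<mu> (OEmb f \<otimes>\<^sub>O g) (OEmb (f \<otimes>\<^sub>K g))"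
| oeq_Comp_assoc: "oarr Q \<tau> f a b \<Longrightarrow> oarr Q \<tau> g b c \<Longrightarrow> oarr Q \<tau> h c d
    \<Longrightarrow> oeq Q \<tau> \<mu> (h \<circ>\<^sub>O (g \<circ>\<^sub>O f)) ((h \<circ>\<^sub>O g) \<circ>\<^sub>O f)"
| oeq_Id_left: "oarr Q \<tau> f a b \<Longrightarrow> oeq Q \<tau> \<mu> (OEmb (KId b) \<circ>\<^sub>O f) f"
| oeq_Id_right: "oarr Q \<tau> f a b \<Longrightarrow> oeq Q \<tau> \<mu> (f \<circ>\<^sub>O OEmb (KId a)) f"
| oeq_Add_assoc: "oarr Q \<tau> f a b \<Longrightarrow> oarr Q \<tau> g a b \<Longrightarrow> oarr Q \<tau> h a b
    \<Longrightarrow> oeq Q \<tau> \<mu> ((f +\<^sub>O g) +\<^sub>O h) (f +\<^sub>O (g +\<^sub>O h))"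
| oeq_Add_comm: "oarr Q \<tau> f a b \<Longrightarrow> oarr Q \<tau> g a b \<Longrightarrow> oeq Q \<tau> \<mu> (f +\<^sub>O g) (g +\<^sub>O f)"
| oeq_Add_Zero: "oarr Q \<tau> f a b \<Longrightarrow> oeq Q \<tau> \<mu> (f +\<^sub>O OZero a b) f"
| oeq_Add_inverse: "oarr Q \<tau> f a b \<Longrightarrow> oeq Q \<tau> \<mu> (f +\<^sub>O OScale (-1) f) (OZero a b)"
| oeq_Scale_Add: "oarr Q \<tau> f a b \<Longrightarrow> oarr Q \<tau> g a b
    \<Longrightarrow> oeq Q \<tau> \<mu> (OScale x (f +\<^sub>O g)) (OScale x f +\<^sub>O OScale x g)"
| oeq_Scale_add: "oarr Q \<tau> f a b \<Longrightarrow> oeq Q \<tau> \<mu> (OScale (x + x') f) (OScale x f +\<^sub>O OScale x' f)"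
| oeq_Scale_mult: "oarr Q \<tau> f a b \<Longrightarrow> oeq Q \<tau> \<mu> (OScale (x * x') f) (OScale x (OScale x' f))"
| oeq_Scale_one: "oarr Q \<tau> f a b \<Longrightarrow> oeq Q \<tau> \<mu> (OScale 1 f) f"
| oeq_Comp_Add_left: "oarr Q \<tau> f a b \<Longrightarrow> oarr Q \<tau> g b c \<Longrightarrow> oarr Q \<tau> g' b c
    \<Longrightarrow> oeq Q \<tau> \<mu> ((g +\<^sub>O g') \<circ>\<^sub>O f) (g \<circ>\<^sub>O f +\<^sub>O g' \<circ>\<^sub>O f)"
| oeq_Comp_Add_right: "oarr Q \<tau> f a b \<Longrightarrow> oarr Q \<tau> f' a b \<Longrightarrow> oarr Q \<tau> g b c
    \<Longrightarrow> oeq Q \<tau> \<mu> (g \<circ>\<^sub>O (f +\<^sub>O f')) (g \<circ>\<^sub>O f +\<^sub>O g \<circ>\<^sub>O f')"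
| oeq_Comp_Scale_left: "oarr Q \<tau> f a b \<Longrightarrow> oarr Q \<tau> g b c
    \<Longrightarrow> oeq Q \<tau> \<mu> (OScale x g \<circ>\<^sub>O f) (OScale x (g \<circ>\<^sub>O f))"
| oeq_Comp_Scale_right: "oarr Q \<tau> f a b \<Longrightarrow> oarr Q \<tau> g b c
    \<Longrightarrow> oeq Q \<tau> \<mu> (g \<circ>\<^sub>O OScale x f) (OScale x (g \<circ>\<^sub>O f))"
| oeq_Act_assoc: "oarr Q \<tau> f a b \<Longrightarrow> karr Q g c d \<Longrightarrow> karr Q h p q
    \<Longrightarrow> oeq Q \<tau> \<mu> ((f \<otimes>\<^sub>O g) \<otimes>\<^sub>O h) (f \<otimes>\<^sub>O (g \<otimes>\<^sub>K h))"
| oeq_Act_Unit: "oarr Q \<tau> f a b \<Longrightarrow> oeq Q \<tau> \<mu> (f \<otimes>\<^sub>O KId []) f"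
| oeq_Act_Comp: "oarr Q \<tau> f a b \<Longrightarrow> oarr Q \<tau> f' b c \<Longrightarrow> karr Q g p q \<Longrightarrow> karr Q g' q r
    \<Longrightarrow> oeq Q \<tau> \<mu> ((f' \<circ>\<^sub>O f) \<otimes>\<^sub>O (g' \<circ>\<^sub>K g)) ((f' \<otimes>\<^sub>O g') \<circ>\<^sub>O (f \<otimes>\<^sub>O g))"
| oeq_Act_Add_left: "oarr Q \<tau> f a b \<Longrightarrow> oarr Q \<tau> f' a b \<Longrightarrow> karr Q g c d
    \<Longrightarrow> oeq Q \<tau> \<mu> ((f +\<^sub>O f') \<otimes>\<^sub>O g) (f \<otimes>\<^sub>O g +\<^sub>O f' \<otimes>\<^sub>O g)"
| oeq_Act_Add_right: "oarr Q \<tau> f a b \<Longrightarrow> karr Q g c d \<Longrightarrow> karr Q g' c d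
    \<Longrightarrow> oeq Q \<tau> \<mu> (f \<otimes>\<^sub>O (g +\<^sub>K g')) (f \<otimes>\<^sub>O g +\<^sub>O f \<otimes>\<^sub>O g')"
| oeq_Act_Scale_left: "oarr Q \<tau> f a b \<Longrightarrow> karr Q g c d
    \<Longrightarrow> oeq Q \<tau> \<mu> (OScale x f \<otimes>\<^sub>O g) (OScale x (f \<otimes>\<^sub>O g))"
| oeq_Act_Scale_right: "oarr Q \<tau> f a b \<Longrightarrow> karr Q g c d
    \<Longrightarrow> oeq Q \<tau> \<mu> (f \<otimes>\<^sub>O KScale x g) (OScale x (f \<otimes>\<^sub>O g))"

definition oclass ::
    "('v, 'a) pre_digraph \<Rightarrow> ('v \<Rightarrow> 'v) \<Rightarrow> ('v \<Rightarrow>\<^sub>0 nat) \<Rightarrow> ('v, 'k::field) oterm set \<Rightarrow> ('v, 'k) oterm set"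
  where "oclass Q \<tau> \<mu> S = {(s, t). oeq Q \<tau> \<mu> s t} `` S"

type_synonym ('v, 'k) omor = "'v word \<times> ('v, 'k) oterm set \<times> 'v word"

definition oKLRW ::
    "('v, 'a) pre_digraph \<Rightarrow> ('v \<Rightarrow> 'v) \<Rightarrow> ('v \<Rightarrow>\<^sub>0 nat)
      \<Rightarrow> ('v word, ('v, 'k::field) omor, 'k, 'v word, ('v, 'k) kmor) module_cat" where
  "oKLRW Q \<tau> \<mu> =
   \<lparr> Obj = lists (letters Q),
     Arr = {(a, oclass Q \<tau> \<mu> {t}, b) | a t b. oarr Q \<tau> t a b},
     Src = fst,
     Tgt = (\<lambda>F. snd (snd F)),
     Ide = (\<lambda>a. (a, oclass Q \<tau> \<mu> {OEmb (KId a)}, a)),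
     Comp = (\<lambda>(_, T, c) (a, S, _). (a, oclass Q \<tau> \<mu> {t \<circ>\<^sub>O s | t s. t \<in> T \<and> s \<in> S}, c)),
     Nul = (\<lambda>a b. (a, oclass Q \<tau> \<mu> {OZero a b}, b)),
     Plus = (\<lambda>(a, S, b) (_, T, _). (a, oclass Q \<tau> \<mu> {s +\<^sub>O t | s t. s \<in> S \<and> t \<in> T}, b)),
     Scale = (\<lambda>x (a, S, b). (a, oclass Q \<tau> \<mu> (OScale x ` S), b)),
     ActO = (@),
     ActA = (\<lambda>(a, S, b) (c, T, d). (a @ c, oclass Q \<tau> \<mu> {s \<otimes>\<^sub>O t | s t. s \<in> S \<and> t \<in> T}, b @ d)) \<rparr>"

definition rho ::
    "('v, 'a) pre_digraph \<Rightarrow> ('v \<Rightarrow> 'v) \<Rightarrow> ('v \<Rightarrow>\<^sub>0 nat) \<Rightarrow> 'v \<Rightarrow> ('v, 'k::field) omor" where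
  "rho Q \<tau> \<mu> i = ([Black i], oclass Q \<tau> \<mu> {ORho i}, [Black (\<tau> i)])"


section \<open>Vector spaces and the polynomial functor\<close>

text \<open>The category of vector spaces consists of all subspaces of the polynomial ring
  \<open>U = k[B\<^sub>b, Z\<^sub>r | b \<in> 'b, r \<in> \<nat>]\<close>, with \<open>B\<^sub>b = pvar (Inl b)\<close> and \<open>Z\<^sub>r = pvar (Inr r)\<close>, and all linear
  maps between them. The type \<open>'b\<close> is arbitrary, hence so is the dimension of \<open>U\<close>.
  Inside \<open>U\<close> the identification of \<open>k[Y\<^sub>1, \<dots>, Y\<^sub>a] \<otimes> k[Y\<^sub>1, \<dots>, Y\<^sub>b]\<close> with \<open>k[Y\<^sub>1, \<dots>, Y\<^sub>a\<^sub>+\<^sub>b]\<close> becomes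
  strict when variables are numbered from the right: \<open>k[Y\<^sub>1, \<dots>, Y\<^sub>n]\<close> is \<open>k[Z\<^sub>0, \<dots>, Z\<^sub>n\<^sub>-\<^sub>1]\<close> with
  \<open>Y\<^sub>r = Z\<^sub>n\<^sub>-\<^sub>r\<close>, and \<open>V \<otimes> k[Y\<^sub>1, \<dots>, Y\<^sub>n]\<close> is spanned by the products \<open>v[Z\<^sub>r := Z\<^sub>r\<^sub>+\<^sub>n] * p\<close>, which
  represent \<open>v \<otimes> p\<close>.\<close>

type_synonym ('b, 'k) univ = "(('b + nat) \<Rightarrow>\<^sub>0 nat) \<Rightarrow>\<^sub>0 'k"

definition uscale :: "'k::field \<Rightarrow> ('b, 'k) univ \<Rightarrow> ('b, 'k) univ" where
  "uscale c p = Poly_Mapping.single 0 c * p"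

global_interpretation univ: vector_space "uscale :: 'k::field \<Rightarrow> ('b, 'k) univ \<Rightarrow> ('b, 'k) univ"
  by unfold_locales (simp_all add: uscale_def algebra_simps single_add mult_single flip: mult.assoc)

definition linear_on :: "('b, 'k::field) univ set \<Rightarrow> (('b, 'k) univ \<Rightarrow> ('b, 'k) univ) \<Rightarrow> bool" where
  "linear_on V f \<longleftrightarrow> (\<forall>u\<in>V. \<forall>v\<in>V. f (u + v) = f u + f v) \<and> (\<forall>c. \<forall>v\<in>V. f (uscale c v) = uscale c (f v))"

text \<open>\<open>polys n = k[Y\<^sub>1, \<dots>, Y\<^sub>n]\<close> with variables \<open>Y n 1, \<dots>, Y n n\<close>; in particular \<open>polys 0 = k\<close>. For \<open>f\<close> in
  \<open>polys n\<close>, \<open>eval_at [g\<^sub>1, \<dots>, g\<^sub>n] f\<close> is \<open>f(g\<^sub>1, \<dots>, g\<^sub>n)\<close>.\<close>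

definition polys :: "nat \<Rightarrow> ('b, 'k::field) univ set" where
  "polys n = {p. \<forall>m\<in>Poly_Mapping.keys p. Poly_Mapping.keys m \<subseteq> Inr ` {..<n}}"

definition Y :: "nat \<Rightarrow> nat \<Rightarrow> ('b, 'k::field) univ" where
  "Y n r = pvar (Inr (n - r))"

definition eval_at :: "('b, 'k::field) univ list \<Rightarrow> ('b, 'k) univ \<Rightarrow> ('b, 'k) univ" where
  "eval_at gs = poly_subst (\<lambda>z. case z of Inl b \<Rightarrow> pvar z
                             | Inr r \<Rightarrow> if r < length gs then rev gs ! r else pvar z)"

definition shift :: "nat \<Rightarrow> ('b, 'k::field) univ \<Rightarrow> ('b, 'k) univ" where
  "shift n = poly_subst (\<lambda>z. case z of Inl b \<Rightarrow> pvar z | Inr r \<Rightarrow> pvar (Inr (r + n)))"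

definition tens_space :: "('b, 'k::field) univ set \<Rightarrow> nat \<Rightarrow> ('b, 'k) univ set" where
  "tens_space V n = univ.span {shift n v * p | v p. v \<in> V \<and> p \<in> polys n}"

text \<open>\<open>f \<otimes> g\<close>, for a linear map \<open>f\<close> on \<open>V\<close> and a linear map \<open>g : k[Y\<^sub>1, \<dots>, Y\<^sub>n] \<rightarrow> k[Y\<^sub>1, \<dots>, Y\<^sub>m]\<close>.\<close>

definition tens_map ::
    "('b, 'k::field) univ set \<Rightarrow> nat \<Rightarrow> nat
      \<Rightarrow> (('b, 'k) univ \<Rightarrow> ('b, 'k) univ) \<Rightarrow> (('b, 'k) univ \<Rightarrow> ('b, 'k) univ) \<Rightarrow> (('b, 'k) univ \<Rightarrow> ('b, 'k) univ)"
  where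
  "tens_map V n m f g =
     (THE h. h \<in> extensional (tens_space V n) \<and> linear_on (tens_space V n) h \<and>
             (\<forall>v\<in>V. \<forall>p\<in>polys n. h (shift n v * p) = shift m (f v) * g p))"

fun poly_cross :: "('v, 'a) pre_digraph \<Rightarrow> 'v letter \<Rightarrow> 'v letter \<Rightarrow> ('b, 'k::field) univ \<Rightarrow> ('b, 'k) univ"
  where
  "poly_cross Q (Black i) (Black j) =
     (if i = j
      then (\<lambda>f\<in>polys 2. exact_quotient (eval_at [Y 2 2, Y 2 1] f - eval_at [Y 2 1, Y 2 2] f)
                           (Y 2 2 - Y 2 1))
      else (\<lambda>f\<in>polys 2. X Q i j (Y 2 2) (Y 2 1) * eval_at [Y 2 2, Y 2 1] f))"
| "poly_cross Q (Red \<theta>) (Black i) = (\<lambda>f\<in>polys 1. Y 1 1 ^ Poly_Mapping.lookup \<theta> i * f)"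
| "poly_cross Q (Black i) (Red \<theta>) = (\<lambda>f\<in>polys 1. f)"
| "poly_cross Q (Red \<theta>) (Red \<theta>') = undefined"

primrec poly_term :: "('v, 'a) pre_digraph \<Rightarrow> ('v, 'k::field) kterm \<Rightarrow> ('b, 'k) univ \<Rightarrow> ('b, 'k) univ" where
  "poly_term Q (KId w) = (\<lambda>p\<in>polys (nblack w). p)"
| "poly_term Q (KDot i) = (\<lambda>p\<in>polys 1. Y 1 1 * p)"
| "poly_term Q (KCross l m) = poly_cross Q l m"
| "poly_term Q (g \<circ>\<^sub>K f) = compose (polys (nblack (ksrc f))) (poly_term Q g) (poly_term Q f)"
| "poly_term Q (f \<otimes>\<^sub>K g) = tens_map (polys (nblack (ksrc f))) (nblack (ksrc g)) (nblack (ktgt g))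
                              (poly_term Q f) (poly_term Q g)"
| "poly_term Q (KZero a b) = (\<lambda>p\<in>polys (nblack a). 0)"
| "poly_term Q (f +\<^sub>K g) = (\<lambda>p\<in>polys (nblack (ksrc f)). poly_term Q f p + poly_term Q g p)"
| "poly_term Q (KScale c f) = (\<lambda>p\<in>polys (nblack (ksrc f)). uscale c (poly_term Q f p))"

type_synonym ('b, 'k) vmor =
  "('b, 'k) univ set \<times> (('b, 'k) univ \<Rightarrow> ('b, 'k) univ) \<times> ('b, 'k) univ set"

text \<open>The polynomial functor on the arrow \<open>(a, S, b)\<close>: all terms of the class \<open>S\<close> have the same value.\<close>

definition poly_functor ::
    "('v, 'a) pre_digraph \<Rightarrow> ('v word, ('v, 'k::field) kmor, ('b, 'k) univ set, ('b, 'k) vmor) cat_map" where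
  "poly_functor Q =
   \<lparr> onObj = (\<lambda>w. polys (nblack w)),
     onArr = (\<lambda>(a, S, b). (polys (nblack a), the_elem (poly_term Q ` S), polys (nblack b))) \<rparr>"

text \<open>The category of vector spaces with \<open>V \<otimes> C = V \<otimes> P(C)\<close>, for the polynomial functor \<open>P\<close>.\<close>

definition Vect :: "('v, 'a) pre_digraph
    \<Rightarrow> (('b, 'k::field) univ set, ('b, 'k) vmor, 'k, 'v word, ('v, 'k) kmor) module_cat" where
  "Vect Q =
   \<lparr> Obj = {V. univ.subspace V},
     Arr = {(V, f, W). univ.subspace V \<and> univ.subspace W \<and> f \<in> V \<rightarrow>\<^sub>E W \<and> linear_on V f},
     Src = fst,
     Tgt = (\<lambda>F. snd (snd F)),
     Ide = (\<lambda>V. (V, \<lambda>v\<in>V. v, V)),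
     Comp = (\<lambda>(_, g, W) (V, f, _). (V, compose V g f, W)),
     Nul = (\<lambda>V W. (V, \<lambda>v\<in>V. 0, W)),
     Plus = (\<lambda>(V, f, W) (_, g, _). (V, \<lambda>v\<in>V. f v + g v, W)),
     Scale = (\<lambda>c (V, f, W). (V, \<lambda>v\<in>V. uscale c (f v), W)),
     ActO = (\<lambda>V w. tens_space V (nblack w)),
     ActA = (\<lambda>(V, f, W) (a, S, b).
               (tens_space V (nblack a),
                tens_map V (nblack a) (nblack b) f (fst (snd (onArr (poly_functor Q) (a, S, b)))),
                tens_space W (nblack b))) \<rparr>"

end

theory Submission
  imports Defs
begin

text \<open>A functor out of a category given by generators and relations is a value on the generators that
  respects the relations, and a strict module morphism out of the oKLRW category is determined by its
  value on the empty word and on the \<open>\<rho>\<^sub>i\<close>. So everything reduces to checking relations. Every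
  generator, placed anywhere in a word, acts by the restriction to \<open>k[Z\<^sub>0, \<dots>, Z\<^sub>n\<^sub>-\<^sub>1]\<close> of an operator
  defined on the whole ring \<^typ>\<open>('b, 'k) univ\<close>: a multiplication, an exchange of two variables, a
  divided difference, or a change of sign of one variable. The relations become identities between such
  operators, which are checked after multiplication by non-zero-divisors \<open>Z\<^sub>a \<plusminus> Z\<^sub>b\<close>.\<close>

section \<open>The KLRW and oKLRW categories as quotient categories\<close>

text \<open>\<open>tens_map\<close> is a definite description over an arbitrary subspace, and its
  existence is the delicate point: a subspace need not be spanned by monomials, so the left map has
  to be extended to the whole ring before anything can be defined on the monomial basis. Once
  existence is known, every identity between tensored maps can be tested on the products
  \<open>shift n v * p\<close>.

  The relations \<open>keq\<close> and \<open>oeq\<close> are untyped, whereas the value of a term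
  refers to the ends of its parts. Soundness therefore asserts equality of the relevant ends along
  with equality of values.

  Among the relations of the mirror, only the one with \<open>\<tau> i = j\<close> has a correction
  term. Conjugating a divided difference by a change of sign turns the denominator
  \<open>var a - var b\<close> into \<open>var a + var b\<close>, and the powers of variables left
  over from the two orders of reflecting differ by \<open>f_weight \<tau> \<mu> i (var b) - f_weight
  \<tau> \<mu> j (var a)\<close>. The one-sided sign in \<open>f_weight\<close> is what makes this
  difference divisible by the new denominator.\<close>

lemma Black_in_letters [simp]: "Black i \<in> letters Q \<longleftrightarrow> i \<in> verts Q"
  and Red_in_letters [simp]: "Red \<theta> \<in> letters Q \<longleftrightarrow> dominant_weight Q \<theta>"
  by (auto simp: letters_def)

lemma karr_lists:
  assumes "karr Q t a b"
  shows "a \<in> lists (letters Q)" "b \<in> lists (letters Q)"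
  using assms by (induction rule: karr.induct) auto

lemma karr_ksrc: "karr Q t a b \<Longrightarrow> ksrc t = a"
  by (induction rule: karr.induct) auto

lemma karr_ktgt: "karr Q t a b \<Longrightarrow> ktgt t = b"
  by (induction rule: karr.induct) auto

lemma kclass_singleton: "kclass Q {t} = {s. keq Q t s}"
  by (auto simp: kclass_def)

lemma kclass_eqI: "keq Q s t \<Longrightarrow> kclass Q {s} = kclass Q {t}"
  by (auto simp: kclass_singleton intro: keq_trans keq_sym)

lemma in_kclassD: "s \<in> kclass Q {t} \<Longrightarrow> keq Q t s"
  by (simp add: kclass_singleton)

lemma self_in_kclass: "karr Q t a b \<Longrightarrow> t \<in> kclass Q {t}"
  by (auto simp: kclass_singleton intro: keq_refl)

text \<open>The operations of \<open>KLRW\<close> close up the set of all results on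
  representatives. Once these results are pairwise equal, any one of them generates the class, so
  that computations in \<open>KLRW\<close> can be done on chosen terms.\<close>

lemma kclass_eq_singleton:
  assumes "t \<in> S" "\<And>s. s \<in> S \<Longrightarrow> keq Q t s"
  shows "kclass Q S = kclass Q {t}"
proof (rule set_eqI)
  fix u
  have "u \<in> kclass Q S \<longleftrightarrow> (\<exists>s\<in>S. keq Q s u)"
    by (auto simp: kclass_def)
  also have "\<dots> \<longleftrightarrow> keq Q t u"
    using assms by (meson keq_trans)
  finally show "u \<in> kclass Q S \<longleftrightarrow> u \<in> kclass Q {t}"
    by (simp add: kclass_singleton)
qed

lemma KLRW_simps:
  "Obj (KLRW Q) = lists (letters Q)"
  "Src (KLRW Q) (a, S, b) = a"
  "Tgt (KLRW Q) (a, S, b) = b"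
  "Ide (KLRW Q) a = (a, kclass Q {KId a}, a)"
  "Nul (KLRW Q) a b = (a, kclass Q {KZero a b}, b)"
  "Unit (KLRW Q) = []"
  "TensO (KLRW Q) = (@)"
  by (simp_all add: KLRW_def)

lemma KLRW_Arr: "F \<in> Arr (KLRW Q) \<longleftrightarrow> (\<exists>a t b. F = (a, kclass Q {t}, b) \<and> karr Q t a b)"
  by (auto simp: KLRW_def)

lemma KLRW_homset: "F \<in> homset (KLRW Q) a b \<longleftrightarrow> (\<exists>t. F = (a, kclass Q {t}, b) \<and> karr Q t a b)"
  by (auto simp: KLRW_def homset_def)

lemma kclass_image2:
  assumes "karr Q s a b" "karr Q t c d" "\<And>s' t'. keq Q s s' \<Longrightarrow> keq Q t t' \<Longrightarrow> keq Q (F s t) (F s' t')"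
  shows "kclass Q {F s' t' | s' t'. s' \<in> kclass Q {s} \<and> t' \<in> kclass Q {t}} = kclass Q {F s t}"
proof (rule kclass_eq_singleton)
  show "F s t \<in> {F s' t' | s' t'. s' \<in> kclass Q {s} \<and> t' \<in> kclass Q {t}}"
    using assms(1,2)[THEN self_in_kclass] by blast
  fix u assume "u \<in> {F s' t' | s' t'. s' \<in> kclass Q {s} \<and> t' \<in> kclass Q {t}}"
  then show "keq Q (F s t) u"
    by (auto simp: kclass_singleton intro: assms(3))
qed

lemma KLRW_homI: "karr Q t a b \<Longrightarrow> (a, kclass Q {t}, b) \<in> homset (KLRW Q) a b"
  and KLRW_ArrI: "karr Q t a b \<Longrightarrow> (a, kclass Q {t}, b) \<in> Arr (KLRW Q)"
  by (auto simp: KLRW_homset KLRW_Arr)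

lemma KLRW_Comp:
  assumes "karr Q s a b" "karr Q t b c"
  shows "Comp (KLRW Q) (b, kclass Q {t}, c) (a, kclass Q {s}, b) = (a, kclass Q {t \<circ>\<^sub>K s}, c)"
  using kclass_image2[OF assms(2,1), of "(\<circ>\<^sub>K)"] keq_Comp[OF assms] by (simp add: KLRW_def)

lemma KLRW_Plus:
  assumes "karr Q s a b" "karr Q t a b"
  shows "Plus (KLRW Q) (a, kclass Q {s}, b) (a, kclass Q {t}, b) = (a, kclass Q {s +\<^sub>K t}, b)"
  using kclass_image2[OF assms, of "(+\<^sub>K)"] keq_Add[OF assms] by (simp add: KLRW_def)

lemma KLRW_Scale:
  assumes "karr Q s a b"
  shows "Scale (KLRW Q) x (a, kclass Q {s}, b) = (a, kclass Q {KScale x s}, b)"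
  using kclass_eq_singleton[of "KScale x s" "KScale x ` kclass Q {s}" Q] self_in_kclass[OF assms]
  by (auto simp: KLRW_def kclass_singleton intro: keq_Scale)

lemma KLRW_TensA:
  assumes "karr Q s a b" "karr Q t c d"
  shows "TensA (KLRW Q) (a, kclass Q {s}, b) (c, kclass Q {t}, d) = (a @ c, kclass Q {s \<otimes>\<^sub>K t}, b @ d)"
  using kclass_image2[OF assms, of "(\<otimes>\<^sub>K)", OF keq_Tens] by (simp add: KLRW_def)

lemma KLRW_homsetE:
  assumes "F \<in> homset (KLRW Q) a b"
  obtains t where "F = (a, kclass Q {t}, b)" "karr Q t a b"
  using assms by (auto simp: KLRW_homset)

lemma KLRW_ArrE:
  assumes "F \<in> Arr (KLRW Q)"
  obtains a t b where "F = (a, kclass Q {t}, b)" "karr Q t a b"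
  using assms by (auto simp: KLRW_Arr)

lemmas keq_laws = keq_Comp_assoc keq_Id_left keq_Id_right keq_Add_assoc keq_Add_comm keq_Add_Zero
  keq_Add_inverse keq_Scale_Add keq_Scale_add keq_Scale_mult keq_Scale_one keq_Comp_Add_left
  keq_Comp_Add_right keq_Comp_Scale_left keq_Comp_Scale_right keq_Tens_assoc keq_Tens_Unit
  keq_Unit_Tens keq_Tens_Id keq_Tens_Comp keq_Tens_Add_left keq_Tens_Add_right
  keq_Tens_Scale_left keq_Tens_Scale_right

text \<open>On representatives each axiom is a typing statement or a single clause of
  \<open>keq\<close>, because the laws of a strict linear monoidal category are among its generating
  clauses.\<close>

lemma strict_monoidal_category_KLRW:
  "strict_monoidal_category (KLRW Q :: ('v word, ('v, 'k::field) kmor, 'k) monoidal_cat)"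
  by (unfold_locales; (elim KLRW_homsetE KLRW_ArrE)?;
      (simp add: KLRW_simps KLRW_Comp KLRW_Plus KLRW_Scale KLRW_TensA
        KLRW_homI KLRW_ArrI karr.intros karr_lists)?;
      (rule kclass_eqI, rule keq_laws; assumption)?)

section \<open>Classes of module terms\<close>

lemma oarr_lists:
  assumes "oarr Q \<tau> t a b" "\<And>i. i \<in> verts Q \<Longrightarrow> \<tau> i \<in> verts Q"
  shows "a \<in> lists (letters Q)" "b \<in> lists (letters Q)"
  using assms by (induction rule: oarr.induct) (auto dest: karr_lists)

lemma oclass_singleton: "oclass Q \<tau> \<mu> {t} = {s. oeq Q \<tau> \<mu> t s}"
  by (auto simp: oclass_def)

lemma oclass_eqI: "oeq Q \<tau> \<mu> s t \<Longrightarrow> oclass Q \<tau> \<mu> {s} = oclass Q \<tau> \<mu> {t}"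
  by (auto simp: oclass_singleton intro: oeq_trans oeq_sym)

lemma self_in_oclass: "oarr Q \<tau> t a b \<Longrightarrow> t \<in> oclass Q \<tau> \<mu> {t}"
  by (auto simp: oclass_singleton intro: oeq_refl)

lemma oclass_eq_singleton:
  assumes "t \<in> S" "\<And>s. s \<in> S \<Longrightarrow> oeq Q \<tau> \<mu> t s"
  shows "oclass Q \<tau> \<mu> S = oclass Q \<tau> \<mu> {t}"
proof (rule set_eqI)
  fix u
  have "u \<in> oclass Q \<tau> \<mu> S \<longleftrightarrow> (\<exists>s\<in>S. oeq Q \<tau> \<mu> s u)"
    by (auto simp: oclass_def)
  also have "\<dots> \<longleftrightarrow> oeq Q \<tau> \<mu> t u"
    using assms by (meson oeq_trans)
  finally show "u \<in> oclass Q \<tau> \<mu> S \<longleftrightarrow> u \<in> oclass Q \<tau> \<mu> {t}"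
    by (simp add: oclass_singleton)
qed

lemma oKLRW_simps:
  "Obj (oKLRW Q \<tau> \<mu>) = lists (letters Q)"
  "Src (oKLRW Q \<tau> \<mu>) (a, S, b) = a"
  "Tgt (oKLRW Q \<tau> \<mu>) (a, S, b) = b"
  "Ide (oKLRW Q \<tau> \<mu>) a = (a, oclass Q \<tau> \<mu> {OEmb (KId a)}, a)"
  "Nul (oKLRW Q \<tau> \<mu>) a b = (a, oclass Q \<tau> \<mu> {OZero a b}, b)"
  "ActO (oKLRW Q \<tau> \<mu>) = (@)"
  by (simp_all add: oKLRW_def)

lemma oKLRW_Arr:
  "F \<in> Arr (oKLRW Q \<tau> \<mu>) \<longleftrightarrow> (\<exists>a t b. F = (a, oclass Q \<tau> \<mu> {t}, b) \<and> oarr Q \<tau> t a b)"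
  by (auto simp: oKLRW_def)

lemma oKLRW_homset:
  "F \<in> homset (oKLRW Q \<tau> \<mu>) a b \<longleftrightarrow> (\<exists>t. F = (a, oclass Q \<tau> \<mu> {t}, b) \<and> oarr Q \<tau> t a b)"
  by (auto simp: oKLRW_def homset_def)

lemma oKLRW_homI: "oarr Q \<tau> t a b \<Longrightarrow> (a, oclass Q \<tau> \<mu> {t}, b) \<in> homset (oKLRW Q \<tau> \<mu>) a b"
  and oKLRW_ArrI: "oarr Q \<tau> t a b \<Longrightarrow> (a, oclass Q \<tau> \<mu> {t}, b) \<in> Arr (oKLRW Q \<tau> \<mu>)"
  by (auto simp: oKLRW_homset oKLRW_Arr)

lemma oKLRW_homsetE:
  assumes "F \<in> homset (oKLRW Q \<tau> \<mu>) a b"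
  obtains t where "F = (a, oclass Q \<tau> \<mu> {t}, b)" "oarr Q \<tau> t a b"
  using assms by (auto simp: oKLRW_homset)

lemma oKLRW_ArrE:
  assumes "F \<in> Arr (oKLRW Q \<tau> \<mu>)"
  obtains a t b where "F = (a, oclass Q \<tau> \<mu> {t}, b)" "oarr Q \<tau> t a b"
  using assms by (auto simp: oKLRW_Arr)

lemma oclass_image2:
  assumes "oarr Q \<tau> s a b" "oarr Q \<tau> t c d"
    and "\<And>s' t'. oeq Q \<tau> \<mu> s s' \<Longrightarrow> oeq Q \<tau> \<mu> t t' \<Longrightarrow> oeq Q \<tau> \<mu> (F s t) (F s' t')"
  shows "oclass Q \<tau> \<mu> {F s' t' | s' t'. s' \<in> oclass Q \<tau> \<mu> {s} \<and> t' \<in> oclass Q \<tau> \<mu> {t}}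
       = oclass Q \<tau> \<mu> {F s t}"
proof (rule oclass_eq_singleton)
  show "F s t \<in> {F s' t' | s' t'. s' \<in> oclass Q \<tau> \<mu> {s} \<and> t' \<in> oclass Q \<tau> \<mu> {t}}"
    using assms(1,2)[THEN self_in_oclass, where \<mu> = \<mu>] by blast
  fix u assume "u \<in> {F s' t' | s' t'. s' \<in> oclass Q \<tau> \<mu> {s} \<and> t' \<in> oclass Q \<tau> \<mu> {t}}"
  then show "oeq Q \<tau> \<mu> (F s t) u"
    by (auto simp: oclass_singleton intro: assms(3))
qed

lemma oKLRW_Comp:
  assumes "oarr Q \<tau> s a b" "oarr Q \<tau> t b c"
  shows "Comp (oKLRW Q \<tau> \<mu>) (b, oclass Q \<tau> \<mu> {t}, c) (a, oclass Q \<tau> \<mu> {s}, b)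
       = (a, oclass Q \<tau> \<mu> {t \<circ>\<^sub>O s}, c)"
  using oclass_image2[OF assms(2,1), of \<mu> "(\<circ>\<^sub>O)"] oeq_Comp[OF assms] by (simp add: oKLRW_def)

lemma oKLRW_Plus:
  assumes "oarr Q \<tau> s a b" "oarr Q \<tau> t a b"
  shows "Plus (oKLRW Q \<tau> \<mu>) (a, oclass Q \<tau> \<mu> {s}, b) (a, oclass Q \<tau> \<mu> {t}, b)
       = (a, oclass Q \<tau> \<mu> {s +\<^sub>O t}, b)"
  using oclass_image2[OF assms, of \<mu> "(+\<^sub>O)"] oeq_Add[OF assms] by (simp add: oKLRW_def)

lemma oKLRW_Scale:
  assumes "oarr Q \<tau> s a b"
  shows "Scale (oKLRW Q \<tau> \<mu>) x (a, oclass Q \<tau> \<mu> {s}, b) = (a, oclass Q \<tau> \<mu> {OScale x s}, b)"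
  using oclass_eq_singleton[of "OScale x s" "OScale x ` oclass Q \<tau> \<mu> {s}" Q \<tau> \<mu>] self_in_oclass[OF assms]
  by (auto simp: oKLRW_def oclass_singleton intro: oeq_Scale)

lemma oKLRW_ActA:
  assumes "oarr Q \<tau> s a b" "karr Q t c d"
  shows "ActA (oKLRW Q \<tau> \<mu>) (a, oclass Q \<tau> \<mu> {s}, b) (c, kclass Q {t}, d)
       = (a @ c, oclass Q \<tau> \<mu> {s \<otimes>\<^sub>O t}, b @ d)"
proof -
  have "oclass Q \<tau> \<mu> {s' \<otimes>\<^sub>O t' | s' t'. s' \<in> oclass Q \<tau> \<mu> {s} \<and> t' \<in> kclass Q {t}}
      = oclass Q \<tau> \<mu> {s \<otimes>\<^sub>O t}"
  proof (rule oclass_eq_singleton)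
    show "s \<otimes>\<^sub>O t \<in> {s' \<otimes>\<^sub>O t' | s' t'. s' \<in> oclass Q \<tau> \<mu> {s} \<and> t' \<in> kclass Q {t}}"
      using self_in_oclass[OF assms(1), of \<mu>] self_in_kclass[OF assms(2)] by blast
  qed (auto simp: oclass_singleton kclass_singleton intro: oeq_Act)
  then show ?thesis
    by (simp add: oKLRW_def)
qed

lemmas oeq_laws = oeq_Comp_assoc oeq_Id_left oeq_Id_right oeq_Add_assoc oeq_Add_comm oeq_Add_Zero
  oeq_Add_inverse oeq_Scale_Add oeq_Scale_add oeq_Scale_mult oeq_Scale_one oeq_Comp_Add_left
  oeq_Comp_Add_right oeq_Comp_Scale_left oeq_Comp_Scale_right oeq_Act_assoc oeq_Act_Unit
  oeq_Act_Comp oeq_Act_Add_left oeq_Act_Add_right oeq_Act_Scale_left oeq_Act_Scale_right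

text \<open>Compatibility of the action with identities is the one law of morphisms without a clause
  of its own in \<open>oeq\<close>; it is inherited from \<open>keq_Tens_Id\<close> through the
  embedding.\<close>

lemma oeq_Act_Id:
  assumes "a \<in> lists (letters Q)" "c \<in> lists (letters Q)"
  shows "oeq Q \<tau> \<mu> (OEmb (KId a) \<otimes>\<^sub>O KId c) (OEmb (KId (a @ c)))"
  using assms by (blast intro: oeq_trans[OF oeq_Emb_Act oeq_Emb[OF keq_Tens_Id]] karr_Id)

lemma strict_right_module_oKLRW:
  fixes Q :: "('v, 'a) pre_digraph" and \<mu> :: "'v \<Rightarrow>\<^sub>0 nat"
  assumes \<tau>: "\<And>i. i \<in> verts Q \<Longrightarrow> \<tau> i \<in> verts Q"
  shows "strict_right_module (KLRW Q)
    (oKLRW Q \<tau> \<mu> :: ('v word, ('v, 'k::field) omor, 'k, 'v word, ('v, 'k) kmor) module_cat)"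
proof -
  interpret K: strict_monoidal_category "KLRW Q :: ('v word, ('v, 'k) kmor, 'k) monoidal_cat"
    by (rule strict_monoidal_category_KLRW)
  show ?thesis
    by (unfold_locales; (elim KLRW_homsetE KLRW_ArrE oKLRW_homsetE oKLRW_ArrE)?;
      (simp add: KLRW_simps KLRW_Comp KLRW_Plus KLRW_Scale KLRW_TensA KLRW_homI KLRW_ArrI
        oKLRW_simps oKLRW_Comp oKLRW_Plus oKLRW_Scale oKLRW_ActA oKLRW_homI oKLRW_ArrI
        oarr.intros karr.intros karr_lists oarr_lists[OF _ \<tau>])?;
      (rule oclass_eqI, rule oeq_laws oeq_Act_Id; assumption)?)
qed

section \<open>Substitution in polynomials\<close>

abbreviation cst :: "'k::comm_ring_1 \<Rightarrow> ('x \<Rightarrow>\<^sub>0 nat) \<Rightarrow>\<^sub>0 'k" where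
  "cst c \<equiv> Poly_Mapping.single 0 c"

lemma poly_mapping_single_induct [case_names zero single add]:
  fixes p :: "'a \<Rightarrow>\<^sub>0 'b::comm_monoid_add"
  assumes "P 0" "\<And>m c. P (Poly_Mapping.single m c)" "\<And>p q. P p \<Longrightarrow> P q \<Longrightarrow> P (p + q)"
  shows "P p"
proof -
  have "p = (\<Sum>m\<in>Poly_Mapping.keys p. Poly_Mapping.single m (Poly_Mapping.lookup p m))"
    by (rule poly_mapping_eqI)
       (auto simp: lookup_sum lookup_single when_def in_keys_iff)
  moreover have "P (\<Sum>m\<in>A. Poly_Mapping.single m (Poly_Mapping.lookup p m))" if "finite A" for A
    using that by (induction A) (auto intro: assms)
  ultimately show ?thesis
    by (metis finite_keys)
qed

definition mono_subst :: "('x \<Rightarrow> ('y \<Rightarrow>\<^sub>0 nat) \<Rightarrow>\<^sub>0 'k::comm_ring_1) \<Rightarrow> ('x \<Rightarrow>\<^sub>0 nat) \<Rightarrow> (('y \<Rightarrow>\<^sub>0 nat) \<Rightarrow>\<^sub>0 'k)" where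
  "mono_subst s m = (\<Prod>x\<in>Poly_Mapping.keys m. s x ^ Poly_Mapping.lookup m x)"

text \<open>Additional factors have exponent \<open>0\<close>. With a common index set for two
  monomials, multiplicativity of the substitution becomes a factorwise statement.\<close>

lemma mono_subst_superset:
  assumes "finite A" "Poly_Mapping.keys m \<subseteq> A"
  shows "mono_subst s m = (\<Prod>x\<in>A. s x ^ Poly_Mapping.lookup m x)"
  unfolding mono_subst_def by (rule prod.mono_neutral_left) (use assms in \<open>auto simp: in_keys_iff\<close>)

lemma mono_subst_0 [simp]: "mono_subst s 0 = 1"
  by (simp add: mono_subst_def)

lemma mono_subst_single [simp]: "mono_subst s (Poly_Mapping.single x n) = s x ^ n"
  by (simp add: mono_subst_def)

lemma mono_subst_add: "mono_subst s (m + n) = mono_subst s m * mono_subst s n"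
proof -
  let ?A = "Poly_Mapping.keys m \<union> Poly_Mapping.keys n"
  have "Poly_Mapping.keys (m + n) \<subseteq> ?A"
    by (rule Poly_Mapping.keys_add)
  then show ?thesis
    by (simp add: mono_subst_superset[of ?A] lookup_add power_add prod.distrib)
qed

lemma poly_subst_superset:
  assumes "finite A" "Poly_Mapping.keys p \<subseteq> A"
  shows "poly_subst s p = (\<Sum>m\<in>A. cst (Poly_Mapping.lookup p m) * mono_subst s m)"
  unfolding poly_subst_def mono_subst_def
  by (rule sum.mono_neutral_left) (use assms in \<open>auto simp: in_keys_iff\<close>)

lemma poly_subst_single: "poly_subst s (Poly_Mapping.single m c) = cst c * mono_subst s m"
  by (subst poly_subst_superset[of "{m}"]) auto

lemma poly_subst_0 [simp]: "poly_subst s 0 = 0"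
  by (simp add: poly_subst_def)

lemma poly_subst_cst [simp]: "poly_subst s (cst c) = cst c"
  by (simp add: poly_subst_single)

lemma poly_subst_1 [simp]: "poly_subst s 1 = 1"
  using poly_subst_cst[of s 1] by simp

lemma poly_subst_pvar [simp]: "poly_subst s (pvar x) = s x"
  by (simp add: poly_subst_single pvar_def)

lemma poly_subst_add [simp]: "poly_subst s (p + q) = poly_subst s p + poly_subst s q"
proof -
  let ?A = "Poly_Mapping.keys p \<union> Poly_Mapping.keys q"
  have "Poly_Mapping.keys (p + q) \<subseteq> ?A"
    by (rule Poly_Mapping.keys_add)
  then show ?thesis
    by (simp add: poly_subst_superset[of ?A] lookup_add single_add sum.distrib algebra_simps)
qed

lemma cst_mult: "cst (c * d) = cst c * cst d"
  by (simp add: mult_single)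

lemma poly_subst_mult [simp]: "poly_subst s (p * q) = poly_subst s p * poly_subst s q"
proof (induction p rule: poly_mapping_single_induct)
  case (single m c)
  show ?case
  proof (induction q rule: poly_mapping_single_induct)
    case (single m' c')
    show ?case
      by (simp only: mult_single poly_subst_single mono_subst_add) (simp only: add_0 cst_mult ac_simps)
  qed (simp_all add: distrib_left)
qed (simp_all add: algebra_simps)

lemma poly_subst_uminus [simp]: "poly_subst s (- p) = - poly_subst s p"
  using poly_subst_add[of s p "- p"] by (simp add: eq_neg_iff_add_eq_0 add.commute del: poly_subst_add)

lemma poly_subst_diff [simp]: "poly_subst s (p - q) = poly_subst s p - poly_subst s q"
  using poly_subst_add[of s p "- q"] by simp

lemma poly_subst_power [simp]: "poly_subst s (p ^ n) = poly_subst s p ^ n"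
  by (induction n) simp_all

text \<open>Allowing any set of variables gives facts about the whole ring (\<open>A = UNIV\<close>)
  and about the rings \<open>polys n\<close> (the \<open>Inr r\<close> with \<open>r < n\<close>) a
  single proof.\<close>

definition polys_in :: "'x set \<Rightarrow> (('x \<Rightarrow>\<^sub>0 nat) \<Rightarrow>\<^sub>0 'k::comm_ring_1) set" where
  "polys_in A = {p. \<forall>m\<in>Poly_Mapping.keys p. Poly_Mapping.keys m \<subseteq> A}"

lemma polys_in_UNIV [simp]: "p \<in> polys_in UNIV"
  by (simp add: polys_in_def)

lemma polys_in_0 [simp]: "0 \<in> polys_in A"
  by (simp add: polys_in_def)

lemma polys_in_cst [simp]: "cst c \<in> polys_in A"
  by (auto simp: polys_in_def split: if_splits)

lemma polys_in_1 [simp]: "1 \<in> polys_in A"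
  using polys_in_cst[of 1] by simp

lemma polys_in_pvar: "x \<in> A \<Longrightarrow> pvar x \<in> polys_in A"
  by (auto simp: polys_in_def pvar_def split: if_splits)

lemma polys_in_add: "p \<in> polys_in A \<Longrightarrow> q \<in> polys_in A \<Longrightarrow> p + q \<in> polys_in A"
  using Poly_Mapping.keys_add[of p q] by (auto simp: polys_in_def)

lemma polys_in_uminus: "p \<in> polys_in A \<Longrightarrow> - p \<in> polys_in A"
  by (auto simp: polys_in_def in_keys_iff)

lemma polys_in_diff: "p \<in> polys_in A \<Longrightarrow> q \<in> polys_in A \<Longrightarrow> p - q \<in> polys_in A"
  using polys_in_add[of p A "- q"] by (simp add: polys_in_uminus)

lemma polys_in_mult:
  assumes "p \<in> polys_in A" "q \<in> polys_in A"
  shows "p * q \<in> polys_in A"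
  unfolding polys_in_def
proof safe
  fix m x assume "m \<in> Poly_Mapping.keys (p * q)" and x: "x \<in> Poly_Mapping.keys m"
  then obtain a b where "m = a + b" "a \<in> Poly_Mapping.keys p" "b \<in> Poly_Mapping.keys q"
    using keys_mult[of p q] by auto
  with x assms Poly_Mapping.keys_add[of a b] show "x \<in> A"
    unfolding polys_in_def by blast
qed

lemma polys_in_power: "p \<in> polys_in A \<Longrightarrow> p ^ n \<in> polys_in A"
  by (induction n) (simp_all add: polys_in_mult)

lemma polys_in_mono: "p \<in> polys_in A \<Longrightarrow> A \<subseteq> B \<Longrightarrow> p \<in> polys_in B"
  by (fastforce simp: polys_in_def)

lemmas polys_in_closed = polys_in_add polys_in_uminus polys_in_diff polys_in_mult polys_in_power

lemma single_eq_prod: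
  fixes m :: "'x \<Rightarrow>\<^sub>0 nat"
  shows "Poly_Mapping.single m (c::'k::comm_ring_1) = cst c * mono_subst pvar m"
proof -
  have "mono_subst pvar m = Poly_Mapping.single m (1::'k)"
  proof (induction m rule: poly_mapping_single_induct)
    case (single x n)
    have "pvar x ^ n = Poly_Mapping.single (Poly_Mapping.single x n) (1::'k)"
      by (induction n) (simp_all add: pvar_def mult_single flip: single_add)
    then show ?case by simp
  qed (simp_all add: mono_subst_add mult_single)
  then show ?thesis
    by (simp add: mult_single)
qed

text \<open>\<open>polys_in A\<close> is generated as an algebra by the variables in
  \<open>A\<close>. Equality of two substitutions, or a closure property, therefore only has to be
  checked on variables.\<close>

lemma polys_in_induct [consumes 1, case_names cst pvar add mult]:
  fixes p :: "('x \<Rightarrow>\<^sub>0 nat) \<Rightarrow>\<^sub>0 'k::comm_ring_1"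
  assumes p: "p \<in> polys_in A"
    and cst: "\<And>c. P (cst c)" and pvar: "\<And>x. x \<in> A \<Longrightarrow> P (pvar x)"
    and add: "\<And>p q. P p \<Longrightarrow> P q \<Longrightarrow> P (p + q)" and mult: "\<And>p q. P p \<Longrightarrow> P q \<Longrightarrow> P (p * q)"
  shows "P p"
proof -
  have 0: "P 0" and 1: "P 1"
    using cst[of 0] cst[of 1] by simp_all
  have pow: "P q \<Longrightarrow> P (q ^ n)" for q n
    by (induction n) (auto intro: mult 1)
  have prod: "(\<And>x. x \<in> B \<Longrightarrow> P (g x)) \<Longrightarrow> P (prod g B)" for g :: "'x \<Rightarrow> _" and B
    by (induction B rule: infinite_finite_induct) (auto intro: mult 1)
  have "P (mono_subst pvar m)" if "Poly_Mapping.keys m \<subseteq> A" for m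
    unfolding mono_subst_def by (rule prod) (use that in \<open>auto intro: pow pvar\<close>)
  then have mono: "P (Poly_Mapping.single m c)" if "Poly_Mapping.keys m \<subseteq> A" for m c
    using that by (subst single_eq_prod) (auto intro: mult cst)
  have "p = (\<Sum>m\<in>Poly_Mapping.keys p. Poly_Mapping.single m (Poly_Mapping.lookup p m))"
    by (rule poly_mapping_eqI) (auto simp: lookup_sum lookup_single when_def in_keys_iff)
  moreover have "P (\<Sum>m\<in>B. Poly_Mapping.single m (Poly_Mapping.lookup p m))"
    if "finite B" "B \<subseteq> Poly_Mapping.keys p" for B
    using that
  proof (induction B)
    case (insert m B)
    then have "Poly_Mapping.keys m \<subseteq> A"
      using p by (simp add: polys_in_def)
    with insert show ?case
      by (simp add: add mono)
  qed (simp add: 0)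
  ultimately show ?thesis
    by (metis finite_keys order_refl)
qed

lemma poly_subst_in:
  assumes "p \<in> polys_in A" "\<And>x. x \<in> A \<Longrightarrow> s x \<in> polys_in B"
  shows "poly_subst s p \<in> polys_in B"
  using assms(1) by (induction rule: polys_in_induct) (auto intro: assms(2) polys_in_closed)

lemma poly_subst_cong:
  assumes "p \<in> polys_in A" "\<And>x. x \<in> A \<Longrightarrow> s x = t x"
  shows "poly_subst s p = poly_subst t p"
  using assms(1) by (induction rule: polys_in_induct) (auto simp: assms(2))

lemma poly_subst_pvar_id [simp]: "poly_subst pvar p = p"
  by (induction p rule: polys_in_induct[OF polys_in_UNIV]) auto

lemma poly_subst_poly_subst: "poly_subst s (poly_subst t p) = poly_subst (\<lambda>x. poly_subst s (t x)) p"
  by (induction p rule: polys_in_induct[OF polys_in_UNIV]) auto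

lemma poly_subst_id:
  assumes "p \<in> polys_in A" "\<And>x. x \<in> A \<Longrightarrow> s x = pvar x"
  shows "poly_subst s p = p"
  using poly_subst_cong[OF assms] by simp

section \<open>Cancellation and exact division in polynomial rings\<close>

lemma lookup_single_mult:
  fixes p :: "('x \<Rightarrow>\<^sub>0 nat) \<Rightarrow>\<^sub>0 'k::comm_ring_1"
  shows "Poly_Mapping.lookup (Poly_Mapping.single m c * p) (m + n) = c * Poly_Mapping.lookup p n"
proof (induction p rule: poly_mapping_single_induct)
  case (single m' c')
  have "m + m' = m + n \<longleftrightarrow> m' = n"
    by simp
  then show ?case
    by (simp add: mult_single lookup_single when_def del: add_left_cancel)
qed (simp_all add: lookup_add algebra_simps)

text \<open>For \<open>h \<noteq> 0\<close>, a monomial of \<open>h\<close> of maximal degree in \<open>x\<close> contributes to \<open>x * h\<close> but not to \<open>y * h\<close>.\<close>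

lemma pvar_add_mult_eq_0D:
  fixes h :: "('x \<Rightarrow>\<^sub>0 nat) \<Rightarrow>\<^sub>0 'k::comm_ring_1"
  assumes "(pvar x + cst c * pvar y) * h = 0" "x \<noteq> y"
  shows "h = 0"
proof (rule ccontr)
  assume "h \<noteq> 0"
  then have "Poly_Mapping.keys h \<noteq> {}"
    by (metis ex_in_conv in_keys_iff lookup_zero poly_mapping_eqI)
  define d where "d = Max ((\<lambda>m. Poly_Mapping.lookup m x) ` Poly_Mapping.keys h)"
  have "d \<in> (\<lambda>m. Poly_Mapping.lookup m x) ` Poly_Mapping.keys h"
    unfolding d_def by (rule Max_in) (use \<open>Poly_Mapping.keys h \<noteq> {}\<close> in auto)
  then obtain m where m: "m \<in> Poly_Mapping.keys h" "Poly_Mapping.lookup m x = d"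
    by blast
  have max: "Poly_Mapping.lookup m' x \<le> d" if "m' \<in> Poly_Mapping.keys h" for m'
    unfolding d_def using that by simp
  let ?k = "Poly_Mapping.single x 1 + m"
  have "Poly_Mapping.lookup (pvar y * h) ?k = 0"
  proof (rule ccontr)
    assume "Poly_Mapping.lookup (pvar y * h) ?k \<noteq> 0"
    then have "?k \<in> Poly_Mapping.keys (pvar y * h)"
      by (simp add: in_keys_iff)
    then obtain b where b: "?k = Poly_Mapping.single y 1 + b" "b \<in> Poly_Mapping.keys h"
      using keys_mult[of "pvar y" h] by (auto simp: pvar_def split: if_splits)
    from b(1) have "Poly_Mapping.lookup ?k x = Poly_Mapping.lookup (Poly_Mapping.single y 1 + b) x"
      by simp
    with assms(2) m(2) max[OF b(2)] show False
      by (simp add: lookup_add lookup_single)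
  qed
  moreover have "Poly_Mapping.lookup (pvar x * h) ?k = Poly_Mapping.lookup h m"
    unfolding pvar_def using lookup_single_mult[of "Poly_Mapping.single x 1" 1 h m] by simp
  moreover have "Poly_Mapping.lookup (cst c * (pvar y * h)) (0 + ?k) = c * Poly_Mapping.lookup (pvar y * h) ?k"
    by (rule lookup_single_mult)
  moreover have "Poly_Mapping.lookup ((pvar x + cst c * pvar y) * h) ?k = 0"
    using assms(1) by simp
  ultimately show False
    using m(1) by (simp add: algebra_simps lookup_add in_keys_iff)
qed

lemma pvar_plus_cancel:
  assumes "x \<noteq> y"
  shows "(pvar x + pvar y) * g = (pvar x + pvar y) * h \<longleftrightarrow> g = h"
  using pvar_add_mult_eq_0D[of x 1 y "g - h"] assms by (auto simp: algebra_simps)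

lemma pvar_diff_cancel:
  assumes "x \<noteq> y"
  shows "(pvar x - pvar y) * g = (pvar x - pvar y) * h \<longleftrightarrow> g = h"
  using pvar_add_mult_eq_0D[of x "- 1" y "g - h"] assms
  by (auto simp: algebra_simps single_uminus)

lemma exact_quotient_eqI:
  assumes "h * q = p" "\<And>g. g * q = p \<Longrightarrow> g = h"
  shows "exact_quotient p q = h"
  unfolding exact_quotient_def using assms by blast

text \<open>Divisibility by \<open>q\<close> propagates from the variables to all polynomials, since
  \<open>q\<close> divides a difference of products once it divides the differences of the factors.
  Keeping the quotient in \<open>polys_in B\<close> is what later shows that divided differences
  preserve \<open>polys n\<close>.\<close>

lemma subst_diff_factor:
  assumes p: "p \<in> polys_in A"
    and in_B: "\<And>x. x \<in> A \<Longrightarrow> s x \<in> polys_in B" "\<And>x. x \<in> A \<Longrightarrow> t x \<in> polys_in B"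
    and factor: "\<And>x. x \<in> A \<Longrightarrow> \<exists>h\<in>polys_in B. h * q = s x - t x"
  shows "\<exists>h\<in>polys_in B. h * q = poly_subst s p - poly_subst t p"
proof -
  \<comment> \<open>The two images are carried through the induction because they occur in the
    quotient for a product.\<close>
  have "poly_subst s p \<in> polys_in B \<and> poly_subst t p \<in> polys_in B \<and>
      (\<exists>h\<in>polys_in B. h * q = poly_subst s p - poly_subst t p)"
    using p
  proof (induction p rule: polys_in_induct)
    case (cst c)
    show ?case by (auto intro: bexI[of _ 0])
  next
    case (pvar x)
    then show ?case using in_B factor by simp
  next
    case (add p1 p2)
    then obtain g h where "g \<in> polys_in B" "g * q = poly_subst s p1 - poly_subst t p1"
      "h \<in> polys_in B" "h * q = poly_subst s p2 - poly_subst t p2" by blast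
    then have "\<exists>h\<in>polys_in B. h * q = poly_subst s (p1 + p2) - poly_subst t (p1 + p2)"
      by (intro bexI[of _ "g + h"]) (auto simp: algebra_simps intro: polys_in_add)
    with add show ?case by (simp add: polys_in_add)
  next
    case (mult p1 p2)
    then obtain g h where gh: "g \<in> polys_in B" "g * q = poly_subst s p1 - poly_subst t p1"
      "h \<in> polys_in B" "h * q = poly_subst s p2 - poly_subst t p2" by blast
    \<comment> \<open>Telescoping: with \<open>s\<close>, \<open>t\<close> short for the two
      substitutions, \<open>s p1 * s p2 - t p1 * t p2 = s p1 * (s p2 - t p2) + (s p1 - t p1) * t
      p2\<close>.\<close>
    have "(poly_subst s p1 * h + g * poly_subst t p2) * q = poly_subst s p1 * (h * q) + (g * q) * poly_subst t p2"
      by (simp add: algebra_simps)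
    also have "\<dots> = poly_subst s (p1 * p2) - poly_subst t (p1 * p2)"
      unfolding gh by (simp add: algebra_simps)
    finally have "\<exists>h\<in>polys_in B. h * q = poly_subst s (p1 * p2) - poly_subst t (p1 * p2)"
      by (rule bexI) (use mult gh in \<open>auto intro: polys_in_closed\<close>)
    with mult show ?case by (simp add: polys_in_mult)
  qed
  then show ?thesis by blast
qed

definition var :: "nat \<Rightarrow> ('b, 'k::field) univ" where
  "var r = pvar (Inr r)"

lemma Y_eq_var: "Y n r = var (n - r)"
  by (simp add: Y_def var_def)

lemma polys_eq: "polys n = polys_in (Inr ` {..<n})"
  by (auto simp: polys_def polys_in_def)

lemma var_in_polys [simp]: "r < n \<Longrightarrow> var r \<in> polys n"
  by (simp add: polys_eq var_def polys_in_pvar)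

lemma subspace_polys: "univ.subspace (polys n)"
  by (auto simp: univ.subspace_def polys_eq uscale_def intro: polys_in_closed)

section \<open>Tensor products of linear maps\<close>

lemma uscale_lookup: "uscale c (Poly_Mapping.single m d) = Poly_Mapping.single m (c * d)"
  by (simp add: uscale_def mult_single)

lemma uscale_mult_left: "uscale c p * q = uscale c (p * q)"
  and uscale_mult_right: "p * uscale c q = uscale c (p * q)"
  by (simp_all add: uscale_def algebra_simps)

lemma linear_onI:
  assumes "\<And>u v. u \<in> V \<Longrightarrow> v \<in> V \<Longrightarrow> f (u + v) = f u + f v"
    and "\<And>c v. v \<in> V \<Longrightarrow> f (uscale c v) = uscale c (f v)"
  shows "linear_on V f"
  using assms by (auto simp: linear_on_def)

lemma linear_onD:
  assumes "linear_on V f"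
  shows "u \<in> V \<Longrightarrow> v \<in> V \<Longrightarrow> f (u + v) = f u + f v" "v \<in> V \<Longrightarrow> f (uscale c v) = uscale c (f v)"
  using assms by (auto simp: linear_on_def)

lemma linear_on_0: "linear_on V f \<Longrightarrow> univ.subspace V \<Longrightarrow> f 0 = 0"
  using linear_onD(2)[of V f 0 0] by (simp add: univ.subspace_0)

lemma linear_on_subset: "linear_on V f \<Longrightarrow> W \<subseteq> V \<Longrightarrow> linear_on W f"
  unfolding linear_on_def by blast

lemma linear_on_restrict: "univ.subspace V \<Longrightarrow> linear_on V f \<Longrightarrow> linear_on V (restrict f V)"
  by (auto simp: linear_on_def univ.subspace_def)

lemma linear_on_eq_on_span:
  assumes "linear_on (univ.span S) f" "linear_on (univ.span S) g" "\<And>x. x \<in> S \<Longrightarrow> f x = g x"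
    "x \<in> univ.span S"
  shows "f x = g x"
proof -
  have "x \<in> univ.span S \<and> f x = g x"
    using assms(4)
  proof (induction rule: univ.span_induct_alt)
    case base
    show ?case using assms(1,2) by (simp add: linear_on_0 univ.span_zero)
  next
    case (step c x y)
    then have "x \<in> univ.span S" "uscale c x \<in> univ.span S"
      by (auto intro: univ.span_base univ.span_scale)
    with step show ?case
      by (simp add: linear_onD[OF assms(1)] linear_onD[OF assms(2)] assms(3) univ.span_add)
  qed
  then show ?thesis ..
qed

text \<open>Extend linearly from a basis of \<open>V\<close>. A construction on the monomial basis
  has to start from a map on the whole ring, since \<open>V\<close> may contain no monomial at
  all.\<close>

lemma linear_on_extend:
  assumes V: "univ.subspace V" and f: "linear_on V f"
  shows "\<exists>F. linear_on UNIV F \<and> (\<forall>v\<in>V. F v = f v)"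
proof -
  interpret vp: vector_space_pair uscale uscale ..
  obtain B where B: "B \<subseteq> V" "univ.independent B" "V \<subseteq> univ.span B"
    using univ.basis_exists by metis
  then have span: "univ.span B = V"
    using V by (simp add: univ.span_minimal subset_antisym)
  obtain F where F: "Vector_Spaces.linear uscale uscale F" "\<And>x. x \<in> B \<Longrightarrow> F x = f x"
    using vp.linear_independent_extend[OF B(2)] by blast
  have "linear_on UNIV F"
    using F(1) by (auto simp: linear_on_def vp.linear_add vp.linear_scale)
  moreover have "F v = f v" if "v \<in> V" for v
  proof (rule linear_on_eq_on_span[of B F f])
    show "linear_on (univ.span B) F"
      using \<open>linear_on UNIV F\<close> by (rule linear_on_subset) simp
    show "linear_on (univ.span B) f" "v \<in> univ.span B"
      using f that by (simp_all add: span)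
  qed (rule F(2))
  ultimately show ?thesis by blast
qed

section \<open>Existence of the tensor product of two linear maps\<close>

definition linext :: "(('b + nat \<Rightarrow>\<^sub>0 nat) \<Rightarrow> ('b, 'k::field) univ) \<Rightarrow> ('b, 'k) univ \<Rightarrow> ('b, 'k) univ" where
  "linext T u = (\<Sum>e\<in>Poly_Mapping.keys u. uscale (Poly_Mapping.lookup u e) (T e))"

lemma linext_superset:
  assumes "finite A" "Poly_Mapping.keys u \<subseteq> A"
  shows "linext T u = (\<Sum>e\<in>A. uscale (Poly_Mapping.lookup u e) (T e))"
  unfolding linext_def by (rule sum.mono_neutral_left) (use assms in \<open>auto simp: in_keys_iff\<close>)

lemma linext_single: "linext T (Poly_Mapping.single e c) = uscale c (T e)"
  by (subst linext_superset[of "{e}"]) auto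

lemma linear_on_linext:
  fixes T :: "('b + nat \<Rightarrow>\<^sub>0 nat) \<Rightarrow> ('b, 'k::field) univ"
  shows "linear_on V (linext T)"
proof (rule linear_onI)
  fix u v :: "('b, 'k) univ"
  let ?A = "Poly_Mapping.keys u \<union> Poly_Mapping.keys v"
  have "Poly_Mapping.keys (u + v) \<subseteq> ?A"
    by (rule Poly_Mapping.keys_add)
  then show "linext T (u + v) = linext T u + linext T v"
    by (simp add: linext_superset[of ?A] lookup_add univ.scale_left_distrib sum.distrib)
next
  fix c and v :: "('b, 'k) univ"
  have "Poly_Mapping.lookup (uscale c v) e = c * Poly_Mapping.lookup v e" for e
    using lookup_single_mult[of 0 c v e] by (simp add: uscale_def)
  moreover from this have "Poly_Mapping.keys (uscale c v) \<subseteq> Poly_Mapping.keys v"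
    by (auto simp: in_keys_iff)
  ultimately show "linext T (uscale c v) = uscale c (linext T v)"
    by (simp add: linext_superset[of "Poly_Mapping.keys v"] univ.scale_sum_right)
qed

text \<open>Writing \<open>shift\<close> as a substitution by variables reduces its interaction with
  other substitutions to a comparison on each variable.\<close>

definition shift_var :: "nat \<Rightarrow> 'b + nat \<Rightarrow> 'b + nat" where
  "shift_var n = map_sum id (\<lambda>r. r + n)"

lemma shift_var_simps [simp]:
  "shift_var n (Inl b) = Inl b" "shift_var n (Inr r) = Inr (r + n)"
  by (simp_all add: shift_var_def)

lemma shift_eq: "shift n = poly_subst (\<lambda>z. pvar (shift_var n z))"
  unfolding shift_def shift_var_def by (intro arg_cong[of _ _ poly_subst] ext) (auto split: sum.split)

lemma shift_add [simp]: "shift n (p + q) = shift n p + shift n q"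
  and shift_mult [simp]: "shift n (p * q) = shift n p * shift n q"
  and shift_cst [simp]: "shift n (cst c) = cst c"
  and shift_0 [simp]: "shift n 0 = 0"
  and shift_1 [simp]: "shift n 1 = 1"
  and shift_uscale [simp]: "shift n (uscale c p) = uscale c (shift n p)"
  by (simp_all add: shift_eq uscale_def)

lemma shift_shift [simp]:
  fixes p :: "('b, 'k::field) univ"
  shows "shift n (shift m p) = shift (n + m) p"
proof -
  have "shift_var n (shift_var m z) = shift_var (n + m) z" for z :: "'b + nat"
    by (cases z) auto
  then show ?thesis
    by (simp add: shift_eq poly_subst_poly_subst)
qed

lemma shift_zero [simp]:
  fixes p :: "('b, 'k::field) univ"
  shows "shift 0 p = p"
proof -
  have "shift_var 0 z = z" for z :: "'b + nat"
    by (cases z) auto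
  then show ?thesis
    by (simp add: shift_eq)
qed

lemma shift_in_polys: "p \<in> polys m \<Longrightarrow> shift n p \<in> polys (n + m)"
  unfolding polys_eq shift_eq
  by (erule poly_subst_in) (auto simp: shift_var_def intro!: polys_in_pvar)

lemma shift_var_poly [simp]: "shift n (var r) = var (r + n)"
  by (simp add: shift_eq var_def shift_var_def)

text \<open>Needed so that a shifted monomial times a monomial is again an element of the monomial
  basis, with coefficient \<open>1\<close>.\<close>

lemma mono_subst_pvar: "\<exists>a'. mono_subst (\<lambda>x. pvar (s x)) a = Poly_Mapping.single a' (1::'k::comm_ring_1)"
proof (induction a rule: poly_mapping_single_induct)
  case zero
  show ?case by (auto intro: exI[of _ 0])
next
  case (single x n)
  have "pvar (s x) ^ n = Poly_Mapping.single (Poly_Mapping.single (s x) n) (1::'k)"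
    by (induction n) (simp_all add: pvar_def mult_single flip: single_add)
  then show ?case by auto
next
  case (add p q)
  then show ?case by (auto simp: mono_subst_add mult_single)
qed

text \<open>Linear induction, for maps that are not multiplicative. Membership is kept in the sum
  step because a map may be linear on \<open>polys n\<close> only.\<close>

lemma polys_in_single_induct [consumes 1, case_names zero single add]:
  fixes p :: "('x \<Rightarrow>\<^sub>0 nat) \<Rightarrow>\<^sub>0 'k::comm_ring_1"
  assumes p: "p \<in> polys_in A"
    and 0: "P 0" and single: "\<And>m c. Poly_Mapping.keys m \<subseteq> A \<Longrightarrow> P (Poly_Mapping.single m c)"
    and add: "\<And>p q. p \<in> polys_in A \<Longrightarrow> q \<in> polys_in A \<Longrightarrow> P p \<Longrightarrow> P q \<Longrightarrow> P (p + q)"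
  shows "P p"
proof -
  have *: "P (\<Sum>m\<in>B. Poly_Mapping.single m (Poly_Mapping.lookup p m)) \<and>
      (\<Sum>m\<in>B. Poly_Mapping.single m (Poly_Mapping.lookup p m)) \<in> polys_in A"
    if "finite B" "B \<subseteq> Poly_Mapping.keys p" for B
    using that
  proof (induction B)
    case (insert m B)
    then have "Poly_Mapping.keys m \<subseteq> A"
      using p by (simp add: polys_in_def)
    moreover from this have "Poly_Mapping.single m (Poly_Mapping.lookup p m) \<in> polys_in A"
      by (auto simp: polys_in_def split: if_splits)
    ultimately show ?case
      using insert by (simp add: add single polys_in_add)
  qed (simp add: 0)
  have "p = (\<Sum>m\<in>Poly_Mapping.keys p. Poly_Mapping.single m (Poly_Mapping.lookup p m))"
    by (rule poly_mapping_eqI) (auto simp: lookup_sum lookup_single when_def in_keys_iff)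
  then show ?thesis
    using *[OF finite_keys order_refl] by argo
qed

text \<open>The monomials of \<^typ>\<open>('b, 'k) univ\<close> are products of a shifted monomial, recovered by \<open>hi\<close>, and
  a monomial in the first \<open>n\<close> variables, recovered by \<open>lo\<close>; so a tensor product of maps can be
  defined on the monomial basis.\<close>

lemma tens_map_exists:
  fixes f g :: "('b, 'k::field) univ \<Rightarrow> ('b, 'k) univ"
  assumes "univ.subspace V" "linear_on V f" and g: "linear_on (polys n) g"
  shows "\<exists>h. linear_on UNIV h \<and> (\<forall>v\<in>V. \<forall>p\<in>polys n. h (shift n v * p) = shift m (f v) * g p)"
proof -
  obtain F where F: "linear_on UNIV F" "\<And>v. v \<in> V \<Longrightarrow> F v = f v"
    using linear_on_extend[OF assms(1,2)] by blast
  \<comment> \<open>Sending the unwanted variables to \<open>1\<close> makes the projection of a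
    monomial onto one of its two factors a ring homomorphism, so both factors of a product can be
    computed by substitution.\<close>
  define lo :: "('b, 'k) univ \<Rightarrow> ('b, 'k) univ"
    where "lo = poly_subst (\<lambda>z. if z \<in> Inr ` {..<n} then pvar z else 1)"
  define hi :: "('b, 'k) univ \<Rightarrow> ('b, 'k) univ"
    where "hi = poly_subst (\<lambda>z. case z of Inl b \<Rightarrow> pvar z | Inr r \<Rightarrow> if r < n then 1 else pvar (Inr (r - n)))"
  define h where "h = linext (\<lambda>e. shift m (F (hi (Poly_Mapping.single e 1))) * g (lo (Poly_Mapping.single e 1)))"
  have lin: "linear_on UNIV h"
    unfolding h_def by (rule linear_on_linext)
  have const: "poly_subst (\<lambda>_. 1) (Poly_Mapping.single a (1::'k)) = (1 :: ('b, 'k) univ)"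
    for a :: "'b + nat \<Rightarrow>\<^sub>0 nat"
    by (simp add: poly_subst_single mono_subst_def)
  have hi_shift: "hi (shift n p) = p" for p :: "('b, 'k) univ"
    unfolding hi_def shift_eq poly_subst_poly_subst
  proof (rule poly_subst_id[of _ UNIV])
    show "poly_subst (\<lambda>z. case z of Inl b \<Rightarrow> pvar z | Inr r \<Rightarrow> if r < n then 1 else pvar (Inr (r - n)))
        (pvar (shift_var n z)) = pvar z" for z :: "'b + nat"
      by (cases z) auto
  qed simp
  have lo_shift: "lo (shift n (Poly_Mapping.single a 1)) = 1" for a :: "'b + nat \<Rightarrow>\<^sub>0 nat"
  proof -
    have "lo (shift n (Poly_Mapping.single a 1)) = poly_subst (\<lambda>_. 1) (Poly_Mapping.single a 1)"
      unfolding lo_def shift_eq poly_subst_poly_subst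
    proof (rule poly_subst_cong[of _ UNIV])
      show "poly_subst (\<lambda>z. if z \<in> Inr ` {..<n} then pvar z else 1) (pvar (shift_var n z)) = 1" for z :: "'b + nat"
        by (cases z) auto
    qed simp
    then show ?thesis by (simp add: const)
  qed
  have monomials: "h (shift n (Poly_Mapping.single a c) * Poly_Mapping.single b d)
      = shift m (F (Poly_Mapping.single a c)) * g (Poly_Mapping.single b d)"
    if b: "Poly_Mapping.keys b \<subseteq> Inr ` {..<n}" for a b :: "'b + nat \<Rightarrow>\<^sub>0 nat" and c d :: 'k
  proof -
    have in_polys: "Poly_Mapping.single b 1 \<in> polys n" "Poly_Mapping.single b 1 \<in> polys_in (Inr ` {..<n})"
      using b by (auto simp: polys_def polys_in_def)
    obtain a' where a': "mono_subst (\<lambda>z. pvar (shift_var n z)) a = Poly_Mapping.single a' (1::'k)"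
      using mono_subst_pvar by blast
    then have prod: "shift n (Poly_Mapping.single a c) * Poly_Mapping.single b d = Poly_Mapping.single (a' + b) (c * d)" for c d :: 'k
      by (simp add: shift_eq poly_subst_single mult_single)
    have "hi (Poly_Mapping.single b 1) = poly_subst (\<lambda>_. 1) (Poly_Mapping.single b 1)"
      unfolding hi_def by (rule poly_subst_cong[OF in_polys(2)]) auto
    then have hi: "hi (Poly_Mapping.single (a' + b) 1) = Poly_Mapping.single a 1"
      using hi_shift[of "Poly_Mapping.single a 1"] const[of b]
      unfolding prod[of 1 1, simplified, symmetric] by (simp add: hi_def)
    have "lo (Poly_Mapping.single b 1) = Poly_Mapping.single b 1"
      unfolding lo_def by (rule poly_subst_id[OF in_polys(2)]) auto
    then have lo: "lo (Poly_Mapping.single (a' + b) 1) = Poly_Mapping.single b 1"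
      using lo_shift[of a] unfolding prod[of 1 1, simplified, symmetric] by (simp add: lo_def)
    have "F (Poly_Mapping.single a c) = uscale c (F (Poly_Mapping.single a 1))"
      using linear_onD(2)[OF F(1), of "Poly_Mapping.single a 1" c] by (simp add: uscale_lookup)
    moreover have "g (Poly_Mapping.single b d) = uscale d (g (Poly_Mapping.single b 1))"
      using linear_onD(2)[OF g in_polys(1), of d] by (simp add: uscale_lookup)
    ultimately show ?thesis
      unfolding prod h_def linext_single hi lo
      by (simp add: uscale_mult_left uscale_mult_right mult.commute)
  qed
  have F0: "F 0 = 0" and g0: "g 0 = 0" and h0: "h 0 = 0"
    using F(1) g lin by (auto intro: linear_on_0 subspace_polys)
  \<comment> \<open>Both sides are linear in \<open>p\<close> and in \<open>v\<close>, so the case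
    of monomials suffices.\<close>
  have "h (shift n v * p) = shift m (F v) * g p" if "p \<in> polys n" for v p :: "('b, 'k) univ"
    using that unfolding polys_eq
  proof (induction p rule: polys_in_single_induct)
    case (single b d)
    show ?case
    proof (induction v rule: poly_mapping_single_induct)
      case (add p q)
      then show ?case
        by (simp add: distrib_right linear_onD[OF lin] linear_onD[OF F(1)])
    qed (simp_all add: F0 h0 monomials single)
  next
    case (add p q)
    then show ?case
      using linear_onD(1)[OF g, of p q]
      by (simp add: distrib_left linear_onD[OF lin] polys_eq)
  qed (simp add: g0 h0)
  with lin F(2) show ?thesis
    by (intro exI[of _ h]) auto
qed

text \<open>The arrows of \<open>Vect\<close> with given ends, stated for the bare function.
  Extensionality makes equality of arrows an equality of functions.\<close>

definition lin_map :: "('b, 'k::field) univ set \<Rightarrow> ('b, 'k) univ set \<Rightarrow> (('b, 'k) univ \<Rightarrow> ('b, 'k) univ) \<Rightarrow> bool" where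
  "lin_map V W f \<longleftrightarrow> univ.subspace V \<and> univ.subspace W \<and> f \<in> V \<rightarrow>\<^sub>E W \<and> linear_on V f"

lemma lin_mapI:
  assumes "univ.subspace V" "univ.subspace W" "\<And>v. v \<in> V \<Longrightarrow> f v \<in> W" "linear_on V f"
  shows "lin_map V W (restrict f V)"
  using assms by (auto simp: lin_map_def intro: linear_on_restrict)

lemma lin_mapD:
  assumes "lin_map V W f"
  shows "univ.subspace V" "univ.subspace W" "v \<in> V \<Longrightarrow> f v \<in> W" "linear_on V f"
    "restrict f V = f" "f \<in> extensional V" "v \<notin> V \<Longrightarrow> f v = undefined"
  using assms by (auto simp: lin_map_def PiE_def extensional_def)

lemma lin_map_compose: "lin_map V W f \<Longrightarrow> lin_map W U g \<Longrightarrow> lin_map V U (compose V g f)"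
  unfolding compose_def
  by (rule lin_mapI)
     (auto simp: lin_mapD(1-3) linear_on_def lin_mapD(4)[unfolded linear_on_def] dest: lin_mapD)

lemma lin_map_id: "univ.subspace V \<Longrightarrow> lin_map V V (\<lambda>v\<in>V. v)"
  by (rule lin_mapI) (auto simp: linear_on_def)

lemma lin_map_zero: "univ.subspace V \<Longrightarrow> univ.subspace W \<Longrightarrow> lin_map V W (\<lambda>v\<in>V. 0)"
  by (rule lin_mapI) (auto simp: linear_on_def univ.subspace_0)

lemma lin_map_add:
  assumes f: "lin_map V W f" and g: "lin_map V W g"
  shows "lin_map V W (\<lambda>v\<in>V. f v + g v)"
  by (rule lin_mapI)
     (use lin_mapD[OF f] lin_mapD[OF g] in \<open>auto simp: linear_on_def univ.subspace_add univ.scale_right_distrib\<close>)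

lemma lin_map_scale:
  assumes f: "lin_map V W f"
  shows "lin_map V W (\<lambda>v\<in>V. uscale c (f v))"
  by (rule lin_mapI)
     (use lin_mapD[OF f] in \<open>auto simp: linear_on_def univ.subspace_scale univ.scale_right_distrib mult.commute\<close>)

lemma linear_on_span_in:
  assumes "linear_on (univ.span S) f" "univ.subspace T" "\<And>x. x \<in> S \<Longrightarrow> f x \<in> T" "x \<in> univ.span S"
  shows "f x \<in> T"
proof -
  have "x \<in> univ.span S \<and> f x \<in> T"
    using assms(4)
  proof (induction rule: univ.span_induct_alt)
    case base
    show ?case using assms(1,2) by (simp add: linear_on_0 univ.span_zero univ.subspace_0)
  next
    case (step c x y)
    then have "x \<in> univ.span S" "uscale c x \<in> univ.span S"
      by (auto intro: univ.span_base univ.span_scale)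
    with step show ?case
      by (simp add: linear_onD[OF assms(1)] assms(2,3) univ.span_add univ.subspace_add univ.subspace_scale)
  qed
  then show ?thesis ..
qed

lemma linear_on_mult: "linear_on V (\<lambda>u. u * q)" "linear_on V (\<lambda>u. p * u)"
  and linear_on_shift_mult: "linear_on V (\<lambda>u. shift m u * q)"
  by (auto simp: linear_on_def algebra_simps uscale_mult_left uscale_mult_right)

lemma subspace_tens_space: "univ.subspace (tens_space V n)"
  by (simp add: tens_space_def)

lemma tens_space_gen: "v \<in> V \<Longrightarrow> p \<in> polys n \<Longrightarrow> shift n v * p \<in> tens_space V n"
  unfolding tens_space_def by (rule univ.span_base) blast

lemma tens_space_linear_eqI:
  assumes "linear_on (tens_space V n) f" "linear_on (tens_space V n) g"
    and "\<And>v p. v \<in> V \<Longrightarrow> p \<in> polys n \<Longrightarrow> f (shift n v * p) = g (shift n v * p)"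
    and "x \<in> tens_space V n"
  shows "f x = g x"
  by (rule linear_on_eq_on_span[of "{shift n v * p |v p. v \<in> V \<and> p \<in> polys n}" f g x,
        folded tens_space_def, OF assms(1,2) _ assms(4)]) (use assms(3) in blast)

lemma tens_space_linear_in:
  assumes "linear_on (tens_space V n) f" "univ.subspace T"
    and "\<And>v p. v \<in> V \<Longrightarrow> p \<in> polys n \<Longrightarrow> f (shift n v * p) \<in> T"
    and "x \<in> tens_space V n"
  shows "f x \<in> T"
  by (rule linear_on_span_in[of "{shift n v * p |v p. v \<in> V \<and> p \<in> polys n}" f T x,
        folded tens_space_def, OF assms(1,2) _ assms(4)]) (use assms(3) in blast)

text \<open>The products \<open>shift n v * p\<close> span \<open>tens_space V n\<close>, so the
  definite description has at most one solution. Any linear operator with the right values on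
  products computes it.\<close>

lemma tens_map_eqI:
  assumes h: "linear_on (tens_space V n) h"
    and gen: "\<And>v p. v \<in> V \<Longrightarrow> p \<in> polys n \<Longrightarrow> h (shift n v * p) = shift m (f v) * g p"
  shows "tens_map V n m f g = restrict h (tens_space V n)"
  unfolding tens_map_def
proof (rule the_equality)
  show "restrict h (tens_space V n) \<in> extensional (tens_space V n) \<and>
      linear_on (tens_space V n) (restrict h (tens_space V n)) \<and>
      (\<forall>v\<in>V. \<forall>p\<in>polys n. restrict h (tens_space V n) (shift n v * p) = shift m (f v) * g p)"
    using h gen by (auto simp: tens_space_gen linear_on_restrict subspace_tens_space)
next
  fix h' assume h': "h' \<in> extensional (tens_space V n) \<and> linear_on (tens_space V n) h' \<and>
      (\<forall>v\<in>V. \<forall>p\<in>polys n. h' (shift n v * p) = shift m (f v) * g p)"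
  show "h' = restrict h (tens_space V n)"
  proof (rule extensionalityI)
    show "h' x = restrict h (tens_space V n) x" if "x \<in> tens_space V n" for x
      using tens_space_linear_eqI[of V n h' h x] that h h' gen by simp
  qed (use h' in auto)
qed

lemma tens_map_lin_map:
  assumes f: "lin_map V W f" and g: "lin_map (polys n) (polys m) g"
  shows "lin_map (tens_space V n) (tens_space W m) (tens_map V n m f g)"
    and "\<And>v p. v \<in> V \<Longrightarrow> p \<in> polys n \<Longrightarrow> tens_map V n m f g (shift n v * p) = shift m (f v) * g p"
proof -
  obtain h where h: "linear_on UNIV h" "\<And>v p. v \<in> V \<Longrightarrow> p \<in> polys n \<Longrightarrow> h (shift n v * p) = shift m (f v) * g p"
    using tens_map_exists[of V f n g m] lin_mapD[OF f] lin_mapD[OF g] by blast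
  have lin: "linear_on (tens_space V n) h"
    using h(1) by (rule linear_on_subset) simp
  have eq: "tens_map V n m f g = restrict h (tens_space V n)"
    using lin h(2) by (rule tens_map_eqI)
  show "tens_map V n m f g (shift n v * p) = shift m (f v) * g p" if "v \<in> V" "p \<in> polys n" for v p
    using that by (simp add: eq tens_space_gen h(2))
  have "h x \<in> tens_space W m" if "x \<in> tens_space V n" for x
    using lin subspace_tens_space _ that
    by (rule tens_space_linear_in) (simp add: h(2) tens_space_gen lin_mapD(3)[OF f] lin_mapD(3)[OF g])
  then show "lin_map (tens_space V n) (tens_space W m) (tens_map V n m f g)"
    unfolding eq by (intro lin_mapI subspace_tens_space lin)
qed

text \<open>The working form for the laws of the tensor product: one side of a law is already a
  linear map between the right spaces, and its values on products identify it with the other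
  side.\<close>

lemma tens_map_unique:
  assumes h: "lin_map (tens_space V n) U h"
    and gen: "\<And>v p. v \<in> V \<Longrightarrow> p \<in> polys n \<Longrightarrow> h (shift n v * p) = shift m (f v) * g p"
  shows "tens_map V n m f g = h"
  using tens_map_eqI[OF lin_mapD(4)[OF h] gen] lin_mapD(5)[OF h] by simp

section \<open>Strictness of the tensor product of spaces\<close>

lemma polys_0: "polys 0 = (range cst :: ('b, 'k::field) univ set)"
proof -
  have "p = cst (Poly_Mapping.lookup p 0)" if "p \<in> polys 0" for p :: "('b, 'k) univ"
  proof (rule poly_mapping_eqI)
    fix m
    have "m = 0" if "m \<in> Poly_Mapping.keys p"
      using \<open>p \<in> polys 0\<close> that by (auto simp: polys_def)
    then show "Poly_Mapping.lookup p m = Poly_Mapping.lookup (cst (Poly_Mapping.lookup p 0)) m"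
      by (auto simp: lookup_single when_def in_keys_iff)
  qed
  moreover have "cst c \<in> (polys 0 :: ('b, 'k) univ set)" for c :: 'k
    by (simp add: polys_eq)
  ultimately show ?thesis
    by blast
qed

lemma tens_space_0:
  fixes V :: "('b, 'k::field) univ set"
  assumes "univ.subspace V"
  shows "tens_space V 0 = V"
proof -
  have "{shift 0 v * p |v p. v \<in> V \<and> p \<in> polys 0} = V"
  proof safe
    fix v and p :: "('b, 'k) univ" assume "v \<in> V" "p \<in> polys 0"
    then show "shift 0 v * p \<in> V"
      using univ.subspace_scale[OF assms] by (auto simp: polys_0 uscale_def mult.commute)
  next
    fix v assume "v \<in> V"
    then show "\<exists>v' p. v = shift 0 v' * p \<and> v' \<in> V \<and> p \<in> polys 0"
      by (intro exI[of _ v] exI[of _ 1]) (simp add: polys_eq)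
  qed
  then show ?thesis
    using assms by (simp add: tens_space_def univ.span_eq_iff)
qed

text \<open>The products \<open>shift n v * p\<close> form a set closed under multiplication that
  contains the constants and the variables: \<open>Inr r\<close> with \<open>r < n\<close> lies in
  the right factor, and \<open>Inr r\<close> with \<open>n \<le> r\<close> is the shift of
  \<open>Inr (r - n)\<close>. Hence it contains all monomials of
  \<open>polys (k + n)\<close>.\<close>

lemma tens_space_polys: "tens_space (polys k) n = (polys (k + n) :: ('b, 'k::field) univ set)"
proof (rule antisym)
  have "shift n v * p \<in> (polys (k + n) :: ('b, 'k) univ set)" if "v \<in> polys k" "p \<in> polys n" for v p
    using shift_in_polys[OF that(1), of n] that(2)
    by (auto simp: polys_eq add.commute intro!: polys_in_mult elim: polys_in_mono)
  then show "tens_space (polys k) n \<subseteq> (polys (k + n) :: ('b, 'k) univ set)"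
    unfolding tens_space_def by (intro univ.span_minimal subspace_polys) auto
next
  define G :: "('b, 'k) univ set" where "G = {shift n v * p |v p. v \<in> polys k \<and> p \<in> polys n}"
  have G: "shift n v * p \<in> G" if "v \<in> polys k" "p \<in> polys n" for v p
    using that by (auto simp: G_def)
  have mult: "p * q \<in> G" if pq: "p \<in> G" "q \<in> G" for p q
  proof -
    from pq obtain v w p' q' where "p = shift n v * p'" "q = shift n w * q'"
      "v \<in> polys k" "w \<in> polys k" "p' \<in> polys n" "q' \<in> polys n" unfolding G_def by blast
    then have "p * q = shift n (v * w) * (p' * q')" "v * w \<in> polys k" "p' * q' \<in> polys n"
      by (auto simp: polys_eq polys_in_mult ac_simps)
    then show ?thesis by (simp add: G del: shift_mult)
  qed
  have cst: "cst c \<in> G" for c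
    using G[of 1 "cst c"] by (simp add: polys_eq)
  have var: "pvar (Inr r) \<in> G" if "r < k + n" for r
  proof (cases "r < n")
    case True
    then show ?thesis
      using G[of 1 "pvar (Inr r)"] by (simp add: polys_eq polys_in_pvar)
  next
    case False
    then show ?thesis
      using that G[of "pvar (Inr (r - n))" 1] by (simp add: polys_eq shift_eq polys_in_pvar)
  qed
  have pow: "p ^ i \<in> G" if "p \<in> G" for p i
    by (induction i) (use that cst[of 1] in \<open>auto intro!: mult\<close>)
  have prod: "prod g B \<in> G" if "\<And>x. x \<in> B \<Longrightarrow> g x \<in> G" for g :: "'b + nat \<Rightarrow> _" and B
    using that by (induction B rule: infinite_finite_induct) (use cst[of 1] in \<open>auto intro!: mult\<close>)
  show "(polys (k + n) :: ('b, 'k) univ set) \<subseteq> tens_space (polys k) n"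
  proof
    fix p :: "('b, 'k) univ" assume "p \<in> polys (k + n)"
    then show "p \<in> tens_space (polys k) n"
      unfolding polys_eq[of "k + n"]
    proof (induction p rule: polys_in_single_induct)
      case (single m c)
      have "mono_subst pvar m \<in> G"
        unfolding mono_subst_def by (rule prod, rule pow) (use single var in auto)
      then have "Poly_Mapping.single m c \<in> G"
        by (subst single_eq_prod) (rule mult[OF cst])
      then show ?case
        unfolding tens_space_def G_def by (rule univ.span_base)
    qed (auto simp: univ.subspace_0 univ.subspace_add subspace_tens_space)
  qed
qed

lemma tens_space_tens_space:
  fixes V :: "('b, 'k::field) univ set"
  shows "tens_space (tens_space V n) m = tens_space V (n + m)"
proof (rule antisym)
  have "shift m u * q \<in> tens_space V (n + m)" if "u \<in> tens_space V n" and q: "q \<in> polys m" for u q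
  proof (rule tens_space_linear_in[OF linear_on_shift_mult subspace_tens_space _ that(1)])
    fix v p :: "('b, 'k) univ" assume v: "v \<in> V" and p: "p \<in> polys n"
    have "shift m p * q \<in> polys (n + m)"
      using tens_space_gen[OF p q] by (simp add: tens_space_polys)
    from tens_space_gen[OF v this] show "shift m (shift n v * p) * q \<in> tens_space V (n + m)"
      by (simp add: mult.assoc add.commute)
  qed
  then show "tens_space (tens_space V n) m \<subseteq> tens_space V (n + m)"
    unfolding tens_space_def[of "tens_space V n"]
    by (intro univ.span_minimal subspace_tens_space) auto
next
  have "shift (n + m) v * r \<in> tens_space (tens_space V n) m" if v: "v \<in> V" and "r \<in> polys (n + m)" for v r
  proof (rule tens_space_linear_in[OF linear_on_mult(2) subspace_tens_space])
    show "r \<in> tens_space (polys n) m"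
      using that by (simp add: tens_space_polys)
    fix p q :: "('b, 'k) univ" assume "p \<in> polys n" "q \<in> polys m"
    from tens_space_gen[OF tens_space_gen[OF v this(1)] this(2)]
    show "shift (n + m) v * (shift m p * q) \<in> tens_space (tens_space V n) m"
      by (simp add: mult.assoc add.commute)
  qed
  then show "tens_space V (n + m) \<subseteq> tens_space (tens_space V n) m"
    unfolding tens_space_def[of V "n + m"]
    by (intro univ.span_minimal subspace_tens_space) auto
qed

section \<open>Laws for tensor products of maps\<close>

lemma tens_map_polys:
  assumes f: "lin_map (polys k) (polys l) f" and g: "lin_map (polys n) (polys m) g"
  shows "lin_map (polys (k + n)) (polys (l + m)) (tens_map (polys k) n m f g)"
  using tens_map_lin_map(1)[OF f g] by (simp add: tens_space_polys)

lemma tens_map_assoc: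
  fixes V :: "('b, 'k::field) univ set"
  assumes f: "lin_map V W f" and g: "lin_map (polys n) (polys n') g" and h: "lin_map (polys k) (polys k') h"
  shows "tens_map (tens_space V n) k k' (tens_map V n n' f g) h
       = tens_map V (n + k) (n' + k') f (tens_map (polys n) k k' g h)"
proof -
  note gh = tens_map_polys[OF g h]
  note H = tens_map_lin_map[OF f gh]
  show ?thesis
  proof (rule tens_map_unique)
    show "lin_map (tens_space (tens_space V n) k) (tens_space W (n' + k'))
        (tens_map V (n + k) (n' + k') f (tens_map (polys n) k k' g h))"
      using H(1) by (simp add: tens_space_tens_space)
    fix u q :: "('b, 'k) univ" assume u: "u \<in> tens_space V n" and q: "q \<in> polys k"
    let ?H = "tens_map V (n + k) (n' + k') f (tens_map (polys n) k k' g h)"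
    show "?H (shift k u * q) = shift k' (tens_map V n n' f g u) * h q"
    \<comment> \<open>\<open>u\<close> is only a sum of products. For fixed \<open>q\<close> both
      sides are linear in \<open>u\<close>, which reduces the claim to
      \<open>u = shift n v * p\<close>.\<close>
    proof (rule tens_space_linear_eqI[OF _ _ _ u])
      have "shift k x * q \<in> tens_space V (n + k)" if "x \<in> tens_space V n" for x
        using tens_space_gen[OF that q] by (simp add: tens_space_tens_space)
      then show "linear_on (tens_space V n) (\<lambda>u. ?H (shift k u * q))"
        using lin_mapD(4)[OF H(1)]
        by (auto simp: linear_on_def distrib_right uscale_mult_left)
      show "linear_on (tens_space V n) (\<lambda>u. shift k' (tens_map V n n' f g u) * h q)"
        using lin_mapD(4)[OF tens_map_lin_map(1)[OF f g]]
        by (auto simp: linear_on_def distrib_right uscale_mult_left)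
      fix v p :: "('b, 'k) univ" assume v: "v \<in> V" and p: "p \<in> polys n"
      have "shift k p * q \<in> polys (n + k)"
        using tens_space_gen[OF p q] by (simp add: tens_space_polys)
      from H(2)[OF v this] tens_map_lin_map(2)[OF f g v p] tens_map_lin_map(2)[OF g h p q]
      show "?H (shift k (shift n v * p) * q) = shift k' (tens_map V n n' f g (shift n v * p)) * h q"
        by (simp add: mult.assoc add.commute)
    qed
  qed
qed

lemma tens_map_compose:
  assumes f: "lin_map V W f" and f': "lin_map W U f'"
    and g: "lin_map (polys n) (polys m) g" and g': "lin_map (polys m) (polys l) g'"
  shows "tens_map V n l (compose V f' f) (compose (polys n) g' g)
       = compose (tens_space V n) (tens_map W m l f' g') (tens_map V n m f g)"
  by (rule tens_map_unique[OF lin_map_compose[OF tens_map_lin_map(1)[OF f g] tens_map_lin_map(1)[OF f' g']]])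
     (simp add: compose_def tens_space_gen tens_map_lin_map(2)[OF f g] tens_map_lin_map(2)[OF f' g']
        lin_mapD(3)[OF f] lin_mapD(3)[OF g])

lemma tens_map_id:
  assumes "univ.subspace V"
  shows "tens_map V n n (\<lambda>v\<in>V. v) (\<lambda>p\<in>polys n. p) = (\<lambda>u\<in>tens_space V n. u)"
  by (rule tens_map_unique[OF lin_map_id[OF subspace_tens_space]]) (simp add: tens_space_gen)

lemma tens_map_unit:
  assumes f: "lin_map V W f"
  shows "tens_map V 0 0 f (\<lambda>p\<in>polys 0. p) = f"
proof (rule tens_map_unique)
  show "lin_map (tens_space V 0) W f"
    using f by (simp add: tens_space_0 lin_mapD(1)[OF f])
  show "f (shift 0 v * p) = shift 0 (f v) * (\<lambda>p\<in>polys 0. p) p" if "v \<in> V" "p \<in> polys 0" for v p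
    using that linear_onD(2)[OF lin_mapD(4)[OF f] that(1)]
    by (auto simp: polys_0 uscale_def mult.commute)
qed

lemma unit_tens_map:
  assumes g: "lin_map (polys n) (polys m) g"
  shows "tens_map (polys 0) n m (\<lambda>p\<in>polys 0. p) g = g"
proof (rule tens_map_unique)
  show "lin_map (tens_space (polys 0) n) (polys m) g"
    using g by (simp add: tens_space_polys)
  show "g (shift n v * p) = shift m ((\<lambda>p\<in>polys 0. p) v) * g p" if "v \<in> polys 0" "p \<in> polys n" for v p
    using that linear_onD(2)[OF lin_mapD(4)[OF g] that(2)]
    by (auto simp: polys_0 uscale_def)
qed

lemma tens_map_add_left:
  assumes f: "lin_map V W f" and f': "lin_map V W f'" and g: "lin_map (polys n) (polys m) g"
  shows "tens_map V n m (\<lambda>v\<in>V. f v + f' v) g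
       = (\<lambda>u\<in>tens_space V n. tens_map V n m f g u + tens_map V n m f' g u)"
  by (rule tens_map_unique[OF lin_map_add[OF tens_map_lin_map(1)[OF f g] tens_map_lin_map(1)[OF f' g]]])
     (simp add: tens_space_gen tens_map_lin_map(2)[OF f g] tens_map_lin_map(2)[OF f' g] distrib_right)

lemma tens_map_add_right:
  assumes f: "lin_map V W f" and g: "lin_map (polys n) (polys m) g" and g': "lin_map (polys n) (polys m) g'"
  shows "tens_map V n m f (\<lambda>p\<in>polys n. g p + g' p)
       = (\<lambda>u\<in>tens_space V n. tens_map V n m f g u + tens_map V n m f g' u)"
  by (rule tens_map_unique[OF lin_map_add[OF tens_map_lin_map(1)[OF f g] tens_map_lin_map(1)[OF f g']]])
     (simp add: tens_space_gen tens_map_lin_map(2)[OF f g] tens_map_lin_map(2)[OF f g'] distrib_left)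

lemma tens_map_scale_left:
  assumes f: "lin_map V W f" and g: "lin_map (polys n) (polys m) g"
  shows "tens_map V n m (\<lambda>v\<in>V. uscale c (f v)) g = (\<lambda>u\<in>tens_space V n. uscale c (tens_map V n m f g u))"
  by (rule tens_map_unique[OF lin_map_scale[OF tens_map_lin_map(1)[OF f g]]])
     (simp add: tens_space_gen tens_map_lin_map(2)[OF f g] uscale_mult_left)

lemma tens_map_scale_right:
  assumes f: "lin_map V W f" and g: "lin_map (polys n) (polys m) g"
  shows "tens_map V n m f (\<lambda>p\<in>polys n. uscale c (g p)) = (\<lambda>u\<in>tens_space V n. uscale c (tens_map V n m f g u))"
  by (rule tens_map_unique[OF lin_map_scale[OF tens_map_lin_map(1)[OF f g]]])
     (simp add: tens_space_gen tens_map_lin_map(2)[OF f g] uscale_mult_right)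

section \<open>Divided differences\<close>

lemma var_diff_cancel: "a \<noteq> b \<Longrightarrow> (var a - var b) * g = (var a - var b) * h \<longleftrightarrow> g = h"
  and var_plus_cancel: "a \<noteq> b \<Longrightarrow> (var a + var b) * g = (var a + var b) * h \<longleftrightarrow> g = h"
  unfolding var_def by (simp_all add: pvar_diff_cancel pvar_plus_cancel)

definition swap :: "nat \<Rightarrow> nat \<Rightarrow> ('b, 'k::field) univ \<Rightarrow> ('b, 'k) univ" where
  "swap a b = poly_subst (\<lambda>z. if z = Inr a then var b else if z = Inr b then var a else pvar z)"

text \<open>The Demazure operator with the sign and numbering of the polynomial functor: for
  \<open>a = 0\<close>, \<open>b = 1\<close> one has \<open>Y\<^sub>2 = var 0\<close> and
  \<open>Y\<^sub>1 = var 1\<close>, so the denominator is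
  \<open>Y\<^sub>2 - Y\<^sub>1\<close>.\<close>

definition dem :: "nat \<Rightarrow> nat \<Rightarrow> ('b, 'k::field) univ \<Rightarrow> ('b, 'k) univ" where
  "dem a b f = exact_quotient (swap a b f - f) (var a - var b)"

definition neg :: "nat \<Rightarrow> ('b, 'k::field) univ \<Rightarrow> ('b, 'k) univ" where
  "neg a = poly_subst (\<lambda>z. if z = Inr a then - var a else pvar z)"

lemma swap_simps [simp]:
  "swap a b (p + q) = swap a b p + swap a b q"
  "swap a b (p - q) = swap a b p - swap a b q"
  "swap a b (- p) = - swap a b p"
  "swap a b (p * q) = swap a b p * swap a b q"
  "swap a b (p ^ n) = swap a b p ^ n"
  "swap a b 0 = 0" "swap a b 1 = 1"
  "swap a b (uscale x p) = uscale x (swap a b p)"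
  "swap a b (var c) = (if c = a then var b else if c = b then var a else var c)"
  by (simp_all add: swap_def uscale_def var_def)

lemma neg_simps [simp]:
  "neg a (p + q) = neg a p + neg a q"
  "neg a (p - q) = neg a p - neg a q"
  "neg a (- p) = - neg a p"
  "neg a (p * q) = neg a p * neg a q"
  "neg a (p ^ n) = neg a p ^ n"
  "neg a 0 = 0" "neg a 1 = 1"
  "neg a (uscale x p) = uscale x (neg a p)"
  "neg a (var c) = (if c = a then - var a else var c)"
  by (simp_all add: neg_def uscale_def var_def)

lemma swap_swap [simp]: "swap a b (swap a b p) = p"
  unfolding swap_def poly_subst_poly_subst
  by (rule poly_subst_id[of _ UNIV]) (auto simp: var_def)

lemma neg_neg [simp]: "neg a (neg a p) = p"
  unfolding neg_def poly_subst_poly_subst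
  by (rule poly_subst_id[of _ UNIV]) (auto simp: var_def)

text \<open>Together with \<open>swap_swap\<close>, \<open>neg_neg\<close>, \<open>neg_swap\<close>
  and \<open>neg_commute\<close> this describes the action of signed permutations on the variables.
  Both sides are substitutions that agree on each variable.\<close>

lemma swap_braid:
  assumes "a \<noteq> b" "b \<noteq> c" "a \<noteq> c"
  shows "swap b c (swap a b (swap b c p)) = swap a b (swap b c (swap a b p))"
  unfolding swap_def poly_subst_poly_subst
  by (rule poly_subst_cong[of _ UNIV]) (use assms in \<open>auto simp: var_def\<close>)

lemma neg_swap: "a \<noteq> b \<Longrightarrow> neg b (swap a b p) = swap a b (neg a p)"
  and neg_swap': "a \<noteq> b \<Longrightarrow> neg a (swap a b p) = swap a b (neg b p)"
  unfolding swap_def neg_def poly_subst_poly_subst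
  by (rule poly_subst_cong[of _ UNIV]; auto simp: var_def)+

lemma neg_commute: "neg a (neg b p) = neg b (neg a p)"
  unfolding neg_def poly_subst_poly_subst
  by (rule poly_subst_cong[of _ UNIV]) (auto simp: var_def)

lemma swap_shift: "swap (a + n) (b + n) (shift n p) = shift n (swap a b p)"
  for p :: "('b, 'k::field) univ"
  unfolding swap_def shift_eq poly_subst_poly_subst
proof (rule poly_subst_cong[of _ UNIV])
  show "poly_subst (\<lambda>z. if z = Inr (a + n) then var (b + n) else if z = Inr (b + n) then var (a + n) else pvar z) (pvar (shift_var n z))
      = poly_subst (\<lambda>z. pvar (shift_var n z)) (if z = Inr a then var b else if z = Inr b then var a else pvar z)"
    for z :: "'b + nat"
    by (cases z) (auto simp: var_def)
qed simp

text \<open>A polynomial shifted by \<open>n\<close> contains no variable \<open>Inr r\<close> with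
  \<open>r < n\<close>. An operator on the \<open>n\<close> rightmost strands thus treats the factor
  of the strands to their left as a scalar.\<close>

lemma swap_shift_low: "a < n \<Longrightarrow> b < n \<Longrightarrow> swap a b (shift n p) = shift n p"
  for p :: "('b, 'k::field) univ"
  unfolding swap_def shift_eq poly_subst_poly_subst
proof (rule poly_subst_cong[of _ UNIV])
  show "a < n \<Longrightarrow> b < n \<Longrightarrow> poly_subst (\<lambda>z. if z = Inr a then var b else if z = Inr b then var a else pvar z) (pvar (shift_var n z))
      = pvar (shift_var n z)"
    for z :: "'b + nat"
    by (cases z) auto
qed simp

lemma swap_polys_high: "p \<in> polys n \<Longrightarrow> n \<le> a \<Longrightarrow> n \<le> b \<Longrightarrow> swap a b p = p"
  unfolding swap_def polys_eq by (erule poly_subst_id) auto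

lemma neg_shift: "neg (a + n) (shift n p) = shift n (neg a p)"
  for p :: "('b, 'k::field) univ"
  unfolding neg_def shift_eq poly_subst_poly_subst
proof (rule poly_subst_cong[of _ UNIV])
  show "poly_subst (\<lambda>z. if z = Inr (a + n) then - var (a + n) else pvar z) (pvar (shift_var n z))
      = poly_subst (\<lambda>z. pvar (shift_var n z)) (if z = Inr a then - var a else pvar z)"
    for z :: "'b + nat"
    by (cases z) (auto simp: var_def)
qed simp

lemma neg_polys_high: "p \<in> polys n \<Longrightarrow> n \<le> a \<Longrightarrow> neg a p = p"
  unfolding neg_def polys_eq by (erule poly_subst_id) auto

lemma swap_in_polys: "p \<in> polys n \<Longrightarrow> a < n \<Longrightarrow> b < n \<Longrightarrow> swap a b p \<in> polys n"
  unfolding swap_def polys_eq by (erule poly_subst_in) (auto simp: var_def intro: polys_in_pvar)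

lemma neg_in_polys: "p \<in> polys n \<Longrightarrow> neg a p \<in> polys n"
  unfolding neg_def polys_eq by (erule poly_subst_in) (auto simp: var_def intro!: polys_in_pvar polys_in_uminus)

lemma dem_factor:
  fixes p :: "('b, 'k::field) univ"
  assumes "p \<in> polys_in A" "Inr a \<in> A" "Inr b \<in> A"
  shows "\<exists>h\<in>polys_in A. h * (var a - var b) = swap a b p - p"
proof -
  have "\<exists>h\<in>polys_in A. h * (var a - var b) =
      poly_subst (\<lambda>z. if z = Inr a then var b else if z = Inr b then var a else pvar z) p - poly_subst pvar p"
  proof (rule subst_diff_factor[OF assms(1)])
    fix z assume "z \<in> A"
    show "\<exists>h\<in>polys_in A. h * (var a - var b) =
        (if z = Inr a then var b else if z = Inr b then var a else pvar z) - pvar z"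
      \<comment> \<open>\<open>swap a b\<close> changes \<open>var a\<close> by
        \<open>- (var a - var b)\<close> and \<open>var b\<close> by \<open>var a - var b\<close>,
        and it fixes the other variables.\<close>
      by (rule bexI[of _ "if z = Inr a then - 1 else if z = Inr b then 1 else 0"])
         (auto simp: var_def intro: polys_in_uminus)
  qed (use assms(2,3) in \<open>auto simp: var_def intro: polys_in_pvar\<close>)
  then show ?thesis by (simp add: swap_def)
qed

text \<open>Replaces the definite description in \<open>exact_quotient\<close> by an equation
  without denominators: the quotient exists by \<open>dem_factor\<close> and is unique because
  \<open>var a - var b\<close> is not a zero divisor.\<close>

lemma dem_eq_iff:
  assumes "a \<noteq> b"
  shows "dem a b p = h \<longleftrightarrow> (var a - var b) * h = swap a b p - p"
proof -
  have unique: "g = h" if "g * (var a - var b) = swap a b p - p" "h * (var a - var b) = swap a b p - p" for g h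
    using that var_diff_cancel[OF assms, of g h] by (simp add: mult.commute)
  obtain h' where "h' * (var a - var b) = swap a b p - p"
    using dem_factor[of p UNIV a b] by auto
  then have "dem a b p * (var a - var b) = swap a b p - p"
    unfolding dem_def using unique by (metis exact_quotient_eqI)
  then show ?thesis
    using unique by (metis mult.commute)
qed

lemma dem_mult: "a \<noteq> b \<Longrightarrow> (var a - var b) * dem a b p = swap a b p - p"
  using dem_eq_iff[of a b p "dem a b p"] by simp

lemma dem_in_polys:
  assumes "p \<in> polys n" "a < n" "b < n" "a \<noteq> b"
  shows "dem a b p \<in> polys n"
proof -
  obtain h where "h \<in> polys n" "h * (var a - var b) = swap a b p - p"
    using dem_factor[of p "Inr ` {..<n}" a b] assms by (auto simp: polys_eq)
  moreover from this(2) have "dem a b p = h"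
    by (simp add: dem_eq_iff[OF assms(4)] mult.commute)
  ultimately show ?thesis by simp
qed

lemma dem_linear:
  assumes "a \<noteq> b"
  shows "dem a b (p + q) = dem a b p + dem a b q" "dem a b (uscale c p) = uscale c (dem a b p)"
  using assms by (simp_all add: dem_eq_iff dem_mult distrib_left uscale_mult_right univ.scale_right_diff_distrib)

text \<open>An invariant factor comes out of \<open>swap a b p - p\<close>. The variables of other
  strands are such factors, and so are symmetric expressions in \<open>var a\<close> and
  \<open>var b\<close>.\<close>

lemma dem_mult_invariant:
  assumes "a \<noteq> b" "swap a b q = q"
  shows "dem a b (q * p) = q * dem a b p"
proof -
  have "(var a - var b) * (q * dem a b p) = q * ((var a - var b) * dem a b p)"
    by (simp add: ac_simps)
  then show ?thesis
    using assms by (simp add: dem_eq_iff dem_mult right_diff_distrib)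
qed

lemma dem_shift:
  assumes "a \<noteq> b"
  shows "dem (a + n) (b + n) (shift n p) = shift n (dem a b p)"
proof -
  have "(var (a + n) - var (b + n)) * shift n (dem a b p) = shift n ((var a - var b) * dem a b p)"
    by (simp add: shift_eq var_def)
  also have "\<dots> = swap (a + n) (b + n) (shift n p) - shift n p"
    using assms by (simp add: dem_mult swap_shift) (simp add: shift_eq)
  finally show ?thesis
    using assms by (subst dem_eq_iff) auto
qed

text \<open>Variables are numbered from the right, so the crossing of the neighbouring strands with variables
  \<open>Z\<^sub>a\<close> and \<open>Z\<^sub>b\<close>, \<open>b = a + 1\<close>, has \<open>Y\<^sub>1 = Z\<^sub>b\<close> and \<open>Y\<^sub>2 = Z\<^sub>a\<close>.\<close>

definition cross :: "('v, 'a) pre_digraph \<Rightarrow> 'v \<Rightarrow> 'v \<Rightarrow> nat \<Rightarrow> nat \<Rightarrow> ('b, 'k::field) univ \<Rightarrow> ('b, 'k) univ" where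
  "cross Q i j a b p = (if i = j then dem a b p else X Q i j (var a) (var b) * swap a b p)"

lemma cross_linear:
  assumes "a \<noteq> b"
  shows "cross Q i j a b (p + q) = cross Q i j a b p + cross Q i j a b q"
    "cross Q i j a b (uscale c p) = uscale c (cross Q i j a b p)"
  using assms by (simp_all add: cross_def dem_linear distrib_left uscale_mult_right)

lemma X_in_polys_in: "u \<in> polys_in A \<Longrightarrow> v \<in> polys_in A \<Longrightarrow> X Q i j u v \<in> polys_in A"
  by (simp add: X_def polys_in_diff)

lemma cross_in_polys:
  assumes "p \<in> polys n" "a < n" "b < n" "a \<noteq> b"
  shows "cross Q i j a b p \<in> polys n"
  using dem_in_polys[OF assms] swap_in_polys[OF assms(1-3)] assms(2,3)
  by (auto simp: cross_def polys_eq var_def intro!: polys_in_mult X_in_polys_in polys_in_pvar)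

text \<open>The factor \<open>q\<close> belongs to the strands to the right of the crossing and is
  invariant under the exchange; their number \<open>n\<close> is added to the indices of the
  crossing.\<close>

lemma cross_shift_mult:
  assumes "q \<in> polys n" "a \<noteq> b"
  shows "cross Q i j (a + n) (b + n) (shift n p * q) = shift n (cross Q i j a b p) * q"
proof -
  have q: "swap (a + n) (b + n) q = q"
    using assms(1) by (rule swap_polys_high) auto
  have X: "X Q i j (var (a + n)) (var (b + n)) = shift n (X Q i j (var a) (var b))"
    by (simp add: X_def shift_eq var_def)
  show ?thesis
    using assms(2) dem_mult_invariant[OF _ q, of "shift n p"]
    by (simp add: cross_def q X swap_shift dem_shift mult.commute mult.left_commute)
qed

lemma cross_shift_low:
  assumes "a < n" "b < n" "a \<noteq> b"
  shows "cross Q i j a b (shift n p * q) = shift n p * cross Q i j a b q"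
  using assms by (simp add: cross_def swap_shift_low dem_mult_invariant mult.left_commute)

section \<open>Values of the generators\<close>

lemma nblack_simps [simp]:
  "nblack [] = 0" "nblack (Black i # w) = Suc (nblack w)" "nblack (Red \<theta> # w) = nblack w"
  "nblack (v @ w) = nblack v + nblack w"
  by (simp_all add: nblack_def)

lemma nblack_map_Black [simp]: "nblack (map Black is) = length is"
  by (induction "is") auto

text \<open>\<open>eval_at\<close> lists its arguments from the left, while variables are numbered
  from the right. Hence the increasing list is the exchange, and the decreasing one in
  \<open>eval_at_id\<close> is the identity.\<close>

lemma eval_at_swap: "eval_at [var 0, var (Suc 0)] = swap 0 (Suc 0)"
  unfolding eval_at_def swap_def
  by (intro arg_cong[of _ _ poly_subst] ext) (auto simp: less_Suc_eq split: sum.split)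

lemma eval_at_id: "eval_at [var (Suc 0), var 0] p = p"
  unfolding eval_at_def
  by (rule poly_subst_id[of _ UNIV]) (auto simp: var_def less_Suc_eq split: sum.split)

lemma eval_at_neg: "eval_at [- var 0] = neg 0"
  unfolding eval_at_def neg_def
  by (intro arg_cong[of _ _ poly_subst] ext) (auto split: sum.split)

lemma poly_cross_black: "poly_cross Q (Black i) (Black j) = restrict (cross Q i j 0 (Suc 0)) (polys (Suc (Suc 0)))"
  by (auto simp: cross_def dem_def eval_at_swap eval_at_id numeral_2_eq_2 Y_eq_var intro!: restrict_ext)

declare poly_cross.simps(1) [simp del]
declare poly_cross_black [simp]

lemma poly_cross_red [simp]:
  "poly_cross Q (Red \<theta>) (Black i) = (\<lambda>f\<in>polys (Suc 0). var 0 ^ Poly_Mapping.lookup \<theta> i * f)"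
  "poly_cross Q (Black i) (Red \<theta>) = (\<lambda>f\<in>polys (Suc 0). f)"
  by (simp_all add: Y_eq_var)

declare poly_cross.simps(2,3) [simp del]

lemma poly_term_dot: "poly_term Q (KDot i) = (\<lambda>p\<in>polys (Suc 0). var 0 * p)"
  by (simp add: Y_eq_var)

declare poly_term.simps(2) [simp del]
declare poly_term_dot [simp]

lemma polys_mult: "p \<in> polys n \<Longrightarrow> q \<in> polys n \<Longrightarrow> p * q \<in> polys n"
  and polys_power: "p \<in> polys n \<Longrightarrow> p ^ k \<in> polys n"
  by (simp_all add: polys_eq polys_in_mult polys_in_power)

lemma lin_map_mult:
  assumes "c \<in> polys n"
  shows "lin_map (polys n) (polys n) (\<lambda>p\<in>polys n. c * p)"
  by (rule lin_mapI) (use assms in \<open>auto simp: subspace_polys polys_mult linear_on_mult\<close>)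

lemma lin_map_cross: "lin_map (polys (Suc (Suc 0))) (polys (Suc (Suc 0))) (restrict (cross Q i j 0 (Suc 0)) (polys (Suc (Suc 0))))"
  by (rule lin_mapI) (auto simp: subspace_polys cross_in_polys linear_on_def cross_linear)

lemma lin_map_poly_cross:
  assumes "is_black l \<or> is_black m"
  shows "lin_map (polys (nblack [l, m])) (polys (nblack [m, l])) (poly_cross Q l m)"
  using assms lin_map_cross lin_map_mult[of "var 0 ^ k" "Suc 0" for k] lin_map_id[OF subspace_polys]
  by (cases l; cases m) (auto simp: polys_power)

lemma lin_map_poly_term:
  assumes "karr Q t a b"
  shows "lin_map (polys (nblack a)) (polys (nblack b)) (poly_term Q t)"
  using assms
proof (induction rule: karr.induct)
  case (karr_Id w)
  show ?case unfolding poly_term.simps by (rule lin_map_id[OF subspace_polys])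
next
  case (karr_Dot i)
  show ?case unfolding poly_term_dot nblack_simps by (rule lin_map_mult) simp
next
  case (karr_Cross l m)
  then show ?case unfolding poly_term.simps by (intro lin_map_poly_cross)
next
  case (karr_Comp f a b g c)
  then show ?case unfolding poly_term.simps by (simp add: karr_ksrc lin_map_compose)
next
  case (karr_Tens f a b g c d)
  then show ?case unfolding poly_term.simps by (simp add: karr_ksrc karr_ktgt tens_map_polys)
next
  case (karr_Zero a b)
  show ?case unfolding poly_term.simps by (intro lin_map_zero subspace_polys)
next
  case (karr_Add f a b g)
  then show ?case unfolding poly_term.simps karr_ksrc[OF karr_Add.hyps(1)] by (intro lin_map_add)
next
  case (karr_Scale f a b c)
  then show ?case unfolding poly_term.simps karr_ksrc[OF karr_Scale.hyps] by (intro lin_map_scale)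
qed

section \<open>Values of the diagrams\<close>

text \<open>Strands added on the left receive higher indices, so the indices in \<open>G\<close> do
  not change: the same operator works on the larger ring, provided the shifted factor is a scalar
  for it.\<close>

lemma tens_map_right:
  assumes G: "\<And>p q. G (p + q) = G p + G q" "\<And>c p. G (uscale c p) = uscale c (G p)"
    and gen: "\<And>v p. v \<in> polys n \<Longrightarrow> p \<in> polys k \<Longrightarrow> G (shift k v * p) = shift k v * G p"
  shows "tens_map (polys n) k k (\<lambda>p\<in>polys n. p) (restrict G (polys k)) = restrict G (polys (n + k))"
proof -
  have "linear_on (tens_space (polys n) k) G"
    using G by (simp add: linear_on_def)
  then show ?thesis
    by (subst tens_map_eqI[where h = G]) (simp_all add: gen tens_space_polys)
qed

text \<open>Strands added on the right push the indices in \<open>g\<close> up by \<open>k\<close>,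
  so another operator \<open>G\<close> represents the result; the new variables are scalars for
  it.\<close>

lemma tens_map_left:
  assumes G: "\<And>p q. G (p + q) = G p + G q" "\<And>c p. G (uscale c p) = uscale c (G p)"
    and gen: "\<And>v p. v \<in> polys n \<Longrightarrow> p \<in> polys k \<Longrightarrow> G (shift k v * p) = shift k (g v) * p"
  shows "tens_map (polys n) k k (restrict g (polys n)) (\<lambda>p\<in>polys k. p) = restrict G (polys (n + k))"
proof -
  have "linear_on (tens_space (polys n) k) G"
    using G by (simp add: linear_on_def)
  then show ?thesis
    by (subst tens_map_eqI[where h = G]) (simp_all add: gen tens_space_polys)
qed

lemma poly_term_Id_Cross:
  "poly_term Q (KId w \<otimes>\<^sub>K xbb i j) = restrict (cross Q i j 0 (Suc 0)) (polys (nblack w + 2))"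
  using tens_map_right[where G = "cross Q i j 0 (Suc 0)" and k = 2, OF cross_linear]
  by (simp add: cross_shift_low numeral_2_eq_2)

lemma poly_term_Cross_Id:
  "poly_term Q (xbb i j \<otimes>\<^sub>K KId w) = restrict (cross Q i j (nblack w) (Suc (nblack w))) (polys (2 + nblack w))"
proof -
  have "tens_map (polys 2) k k (restrict (cross Q i j 0 (Suc 0)) (polys 2)) (\<lambda>p\<in>polys k. p)
      = restrict (cross Q i j k (Suc k)) (polys (2 + k))" for k
    by (rule tens_map_left)
       (simp_all add: cross_linear cross_shift_mult[where a = 0 and b = "Suc 0", simplified])
  then show ?thesis
    by (simp add: numeral_2_eq_2)
qed

lemma poly_term_Id_mult:
  assumes "poly_term Q t = (\<lambda>p\<in>polys k. c * p)" "nblack (ksrc t) = k" "nblack (ktgt t) = k"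
  shows "poly_term Q (KId w \<otimes>\<^sub>K t) = (\<lambda>p\<in>polys (nblack w + k). c * p)"
  using tens_map_right[where G = "\<lambda>p. c * p" and k = k and n = "nblack w"] assms
  by (simp add: distrib_left uscale_mult_right mult.left_commute)

lemma poly_term_mult_Id:
  assumes "poly_term Q t = (\<lambda>p\<in>polys n. c * p)" "nblack (ksrc t) = n"
  shows "poly_term Q (t \<otimes>\<^sub>K KId w) = (\<lambda>p\<in>polys (n + nblack w). shift (nblack w) c * p)"
  using tens_map_left[where G = "\<lambda>p. shift (nblack w) c * p" and k = "nblack w" and n = n] assms
  by (simp add: distrib_left uscale_mult_right mult.assoc)

lemma ksrc_kpow [simp]: "ksrc (kpow w t n) = w"
  unfolding kpow_def by (induction n) auto

lemma ktgt_kpow [simp]: "ktgt t = w \<Longrightarrow> ktgt (kpow w t n) = w"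
  unfolding kpow_def by (induction n) auto

lemma poly_term_kpow:
  assumes "poly_term Q t = (\<lambda>p\<in>polys (nblack w). c * p)" "c \<in> polys (nblack w)"
  shows "poly_term Q (kpow w t n) = (\<lambda>p\<in>polys (nblack w). c ^ n * p)"
proof (induction n)
  case (Suc n)
  have "kpow w t (Suc n) = t \<circ>\<^sub>K kpow w t n"
    by (simp add: kpow_def)
  with Suc assms show ?case
    by (auto simp: compose_def polys_mult polys_power mult.assoc intro!: restrict_ext)
qed (auto simp: kpow_def intro!: restrict_ext)

lemma poly_term_ydot:
  assumes "r \<ge> 1" "r \<le> length is"
  shows "poly_term Q (ydot is r) = (\<lambda>p\<in>polys (length is). var (length is - r) * p)"
proof -
  let ?w = "map Black (drop r is)" and ?v = "map Black (take (r - 1) is)" and ?i = "is ! (r - 1)"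
  have "poly_term Q (KDot ?i \<otimes>\<^sub>K KId ?w) = (\<lambda>p\<in>polys (Suc 0 + nblack ?w). shift (nblack ?w) (var 0) * p)"
    by (rule poly_term_mult_Id) auto
  then have "poly_term Q (KId ?v \<otimes>\<^sub>K KDot ?i \<otimes>\<^sub>K KId ?w)
      = (\<lambda>p\<in>polys (nblack ?v + (Suc 0 + nblack ?w)). shift (nblack ?w) (var 0) * p)"
    by (rule poly_term_Id_mult) auto
  moreover have n: "nblack ?v + (Suc 0 + nblack ?w) = length is"
    using assms by simp
  ultimately show ?thesis
    unfolding n ydot_def by simp
qed

lemma ydot_source_target:
  assumes "r \<ge> 1" "r \<le> length is"
  shows "ksrc (ydot is r) = map Black is" "ktgt (ydot is r) = map Black is"
proof -
  have "take (r - 1) is @ (is ! (r - 1)) # drop r is = is"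
    using assms id_take_nth_drop[of "r - 1" "is"] by simp
  from arg_cong[OF this, of "map Black"]
  show "ksrc (ydot is r) = map Black is" "ktgt (ydot is r) = map Black is"
    by (simp_all add: ydot_def)
qed

lemma ksrc_dots_monomial [simp]: "ksrc (dots_monomial is m) = map Black is"
proof -
  have "ksrc (foldr (\<lambda>r t. kpow (map Black is) (ydot is r) (Poly_Mapping.lookup m r) \<circ>\<^sub>K t) rs (KId (map Black is)))
      = map Black is" for rs
    by (induction rs) auto
  then show ?thesis by (simp add: dots_monomial_def del: upt_Suc)
qed

lemma ktgt_dots_monomial [simp]: "ktgt (dots_monomial is m) = map Black is"
proof -
  have "ktgt (foldr (\<lambda>r t. kpow (map Black is) (ydot is r) (Poly_Mapping.lookup m r) \<circ>\<^sub>K t) rs (KId (map Black is)))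
      = map Black is" if "\<forall>r\<in>set rs. 1 \<le> r \<and> r \<le> length is" for rs
    using that by (cases rs) (auto simp: ydot_source_target)
  from this[of "[1..<Suc (length is)]"] show ?thesis
    unfolding dots_monomial_def by auto
qed

lemma ksrc_dots [simp]: "ksrc (dots is p) = map Black is"
proof -
  have "ksrc (foldr (\<lambda>m t. KScale (Poly_Mapping.lookup p m) (dots_monomial is m) +\<^sub>K t) ms
      (KZero (map Black is) (map Black is))) = map Black is" for ms
    by (cases ms) auto
  then show ?thesis by (simp add: dots_def)
qed

lemma ktgt_dots [simp]: "ktgt (dots is p) = map Black is"
proof -
  have "ktgt (foldr (\<lambda>m t. KScale (Poly_Mapping.lookup p m) (dots_monomial is m) +\<^sub>K t) ms
      (KZero (map Black is) (map Black is))) = map Black is" for ms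
    by (cases ms) auto
  then show ?thesis by (simp add: dots_def)
qed

text \<open>\<open>dots\<close> ignores the variables that do not belong to a strand, hence their value \<open>1\<close>.\<close>

definition dots_eval :: "nat \<Rightarrow> ((nat \<Rightarrow>\<^sub>0 nat) \<Rightarrow>\<^sub>0 'k::field) \<Rightarrow> ('b, 'k) univ" where
  "dots_eval n = poly_subst (\<lambda>r. if 1 \<le> r \<and> r \<le> n then var (n - r) else 1)"

lemma poly_term_dots_monomial:
  fixes "is" :: "'v list"
  shows "(poly_term Q (dots_monomial is m) :: ('b, 'k::field) univ \<Rightarrow> _) =
    (\<lambda>p\<in>polys (length is). mono_subst (\<lambda>r. if 1 \<le> r \<and> r \<le> length is then var (length is - r) else 1) m * p)"
proof -
  let ?n = "length is"
  let ?f = "\<lambda>r t. kpow (map Black is) (ydot is r) (Poly_Mapping.lookup m r) \<circ>\<^sub>K t"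
  let ?s = "\<lambda>r. if 1 \<le> r \<and> r \<le> ?n then var (?n - r) else 1 :: ('b, 'k) univ"
  let ?D = "\<lambda>rs. foldr ?f rs (KId (map Black is)) :: ('v, 'k) kterm"
  \<comment> \<open>\<open>compose\<close> restricts to the source of the inner term, and the outer
    factor is known on \<open>polys\<close> only; hence the source and the membership of the product
    are part of the induction.\<close>
  have "(poly_term Q (?D rs) :: ('b, 'k) univ \<Rightarrow> _) =
      (\<lambda>p\<in>polys ?n. (\<Prod>r\<leftarrow>rs. var (?n - r) ^ Poly_Mapping.lookup m r) * p) \<and>
      ksrc (?D rs) = map Black is \<and>
      (\<Prod>r\<leftarrow>rs. var (?n - r) ^ Poly_Mapping.lookup m r :: ('b, 'k) univ) \<in> polys ?n"
    if "\<forall>r\<in>set rs. 1 \<le> r \<and> r \<le> ?n" for rs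
    using that
  proof (induction rs)
    case Nil
    show ?case by (auto simp: polys_eq intro!: restrict_ext)
  next
    case (Cons r rs)
    have "(poly_term Q (kpow (map Black is) (ydot is r) (Poly_Mapping.lookup m r)) :: ('b, 'k) univ \<Rightarrow> _)
        = (\<lambda>p\<in>polys ?n. var (?n - r) ^ Poly_Mapping.lookup m r * p)"
      by (rule poly_term_kpow[where w = "map Black is", unfolded nblack_map_Black])
         (use Cons.prems in \<open>auto simp: poly_term_ydot intro!: var_in_polys\<close>)
    moreover have "var (?n - r) \<in> (polys ?n :: ('b, 'k) univ set)"
      using Cons.prems by (auto intro!: var_in_polys)
    ultimately show ?case
      using Cons
      by (auto simp: compose_def polys_mult polys_power mult.assoc intro!: restrict_ext)
  qed
  from this[of "[1..<Suc ?n]"] have "(poly_term Q (dots_monomial is m) :: ('b, 'k) univ \<Rightarrow> _) =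
      (\<lambda>p\<in>polys ?n. (\<Prod>r\<leftarrow>[1..<Suc ?n]. var (?n - r) ^ Poly_Mapping.lookup m r) * p)"
    by (simp add: dots_monomial_def del: upt_Suc)
  also have "(\<Prod>r\<leftarrow>[1..<Suc ?n]. var (?n - r) ^ Poly_Mapping.lookup m r)
      = (\<Prod>r\<in>{1..?n}. ?s r ^ Poly_Mapping.lookup m r)"
    by (subst prod.distinct_set_conv_list[symmetric], rule distinct_upt, rule prod.cong) auto
  \<comment> \<open>Over the union both products agree: outside the strands the base is
    \<open>1\<close>, outside the keys the exponent is \<open>0\<close>.\<close>
  also have "\<dots> = (\<Prod>r\<in>{1..?n} \<union> Poly_Mapping.keys m. ?s r ^ Poly_Mapping.lookup m r)"
    by (rule prod.mono_neutral_left) auto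
  also have "\<dots> = mono_subst ?s m"
    by (rule mono_subst_superset[symmetric]) auto
  finally show ?thesis .
qed

lemma poly_term_dots:
  "(poly_term Q (dots is p) :: ('b, 'k::field) univ \<Rightarrow> _) = (\<lambda>u\<in>polys (length is). dots_eval (length is) p * u)"
proof -
  let ?n = "length is"
  let ?s = "\<lambda>r. if 1 \<le> r \<and> r \<le> ?n then var (?n - r) else 1 :: ('b, 'k) univ"
  have "(poly_term Q (foldr (\<lambda>m t. KScale (Poly_Mapping.lookup p m) (dots_monomial is m) +\<^sub>K t) ms
        (KZero (map Black is) (map Black is))) :: ('b, 'k) univ \<Rightarrow> _) =
      (\<lambda>u\<in>polys ?n. (\<Sum>m\<leftarrow>ms. uscale (Poly_Mapping.lookup p m) (mono_subst ?s m)) * u)" for ms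
    by (induction ms) (auto simp: poly_term_dots_monomial distrib_right uscale_mult_left intro!: restrict_ext)
  moreover have "(\<Sum>m\<leftarrow>sorted_list_of_set (Poly_Mapping.keys p). uscale (Poly_Mapping.lookup p m) (mono_subst ?s m))
      = dots_eval ?n p"
    by (subst sum.distinct_set_conv_list[symmetric]) (auto simp: dots_eval_def poly_subst_superset[of "Poly_Mapping.keys p"] uscale_def)
  ultimately show ?thesis by (simp add: dots_def)
qed

lemma foldr_KAdd_source_target:
  assumes "\<forall>t\<in>set ts. ksrc t = w \<and> ktgt t = w'"
  shows "ksrc (foldr (+\<^sub>K) ts (KZero w w')) = w" "ktgt (foldr (+\<^sub>K) ts (KZero w w')) = w'"
  using assms by (cases ts; auto)+

lemma poly_term_foldr_KAdd:
  assumes "\<And>t. t \<in> set ts \<Longrightarrow> ksrc t = w"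
    and "\<And>t. t \<in> set ts \<Longrightarrow> poly_term Q t = (\<lambda>p\<in>polys (nblack w). C t * p)"
  shows "poly_term Q (foldr (+\<^sub>K) ts (KZero w w')) = (\<lambda>p\<in>polys (nblack w). (\<Sum>t\<leftarrow>ts. C t) * p)"
  using assms
proof (induction ts)
  case (Cons t ts)
  have IH: "poly_term Q (foldr (+\<^sub>K) ts (KZero w w')) = (\<lambda>p\<in>polys (nblack w). (\<Sum>t\<leftarrow>ts. C t) * p)"
    by (rule Cons.IH; rule Cons.prems; erule list.set_intros(2))
  have t: "ksrc t = w" "poly_term Q t = (\<lambda>p\<in>polys (nblack w). C t * p)"
    by (rule Cons.prems; rule list.set_intros(1))+
  show ?case
    by (rule ext) (simp add: IH t distrib_right)
qed (auto intro!: restrict_ext)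

section \<open>The relations of the KLRW category\<close>

lemma swap_X [simp]: "swap a b (X Q i j u v) = X Q i j (swap a b u) (swap a b v)"
  and neg_X [simp]: "neg a (X Q i j u v) = X Q i j (neg a u) (neg a v)"
  by (simp_all add: X_def)

text \<open>This divisibility makes the quotient in the braid relation an honest polynomial. It is
  checked in each of the four cases for the arrows between \<open>i\<close> and
  \<open>j\<close>.\<close>

lemma f_arrow_diff_dvd:
  fixes u v w :: "'r::comm_ring_1"
  shows "u - w dvd f_arrow Q i j u v - f_arrow Q i j w v"
proof -
  have "u - w dvd (u - v) * (v - u) - (w - v) * (v - w)"
    \<comment> \<open>The left-hand side is \<open>(w - v)^2 - (u - v)^2\<close>, a difference of
      squares.\<close>
    by (rule dvdI[of _ _ "2 * v - u - w"]) (simp add: algebra_simps)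
  moreover have "u - w dvd v - u - (v - w)"
    by (rule dvdI[of _ _ "- 1"]) simp
  moreover have "u - w dvd u - v - (w - v)"
    by simp
  ultimately show ?thesis
    unfolding f_arrow_def X_def by (cases "j \<rightarrow>\<^bsub>Q\<^esub> i"; cases "i \<rightarrow>\<^bsub>Q\<^esub> j") (simp_all only: if_True if_False mult_1_left mult_1_right diff_self dvd_0_right)
qed

lemma dots_eval_simps [simp]:
  "dots_eval n (p + q) = dots_eval n p + dots_eval n q"
  "dots_eval n (p - q) = dots_eval n p - dots_eval n q"
  "dots_eval n (- p) = - dots_eval n p"
  "dots_eval n (p * q) = dots_eval n p * dots_eval n q"
  "dots_eval n (p ^ k) = dots_eval n p ^ k"
  "dots_eval n 1 = 1"
  "1 \<le> r \<Longrightarrow> r \<le> n \<Longrightarrow> dots_eval n (yvar r) = var (n - r)"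
  by (simp_all add: dots_eval_def)

lemma dots_eval_X [simp]: "dots_eval n (X Q i j u v) = X Q i j (dots_eval n u) (dots_eval n v)"
  by (simp add: X_def)

lemma dots_eval_f_arrow [simp]:
  "dots_eval n (f_arrow Q i j u v) = f_arrow Q i j (dots_eval n u) (dots_eval n v)"
  by (simp add: f_arrow_def)

text \<open>The quotient itself is never computed. Evaluation in the dots is a ring homomorphism, so
  it preserves the product of quotient and denominator, and this product is all that the braid and
  reflection identities use.\<close>

lemma dots_eval_exact_quotient:
  assumes "q dvd p" "\<And>g h. q * g = q * h \<Longrightarrow> g = h"
  shows "dots_eval n q * dots_eval n (exact_quotient p q) = dots_eval n p"
proof -
  obtain h where p: "p = q * h"
    using assms(1) by (elim dvdE)
  have "exact_quotient p q = h"
  proof (rule exact_quotient_eqI)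
    fix g assume "g * q = p"
    then have "q * g = q * h"
      by (simp only: p mult.commute)
    then show "g = h"
      by (rule assms(2))
  qed (simp only: p mult.commute)
  then show ?thesis
    unfolding p by simp
qed

text \<open>Applying the ring automorphism \<open>swap c d\<close> to the defining equation of
  \<open>dem\<close> shows which factor clears the denominator of a conjugated divided
  difference.\<close>

lemma swap_dem_mult:
  "a \<noteq> b \<Longrightarrow> swap c d (var a - var b) * swap c d (dem a b p) = swap c d (swap a b p) - swap c d p"
  using arg_cong[OF dem_mult[of a b p], of "swap c d"] by simp

text \<open>The elimination common to both sides of \<open>dem_braid\<close>: \<open>q0\<close> and
  \<open>q1\<close> are the differences of neighbouring variables, \<open>q0 + q1\<close> is the
  outer difference, \<open>w\<close>, \<open>u\<close>, \<open>d\<close> are the onefold, twofold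
  and threefold divided differences of \<open>p\<close>, and \<open>w0\<close>, \<open>u1\<close>,
  \<open>w01\<close> and the capital letters are images of \<open>w\<close>, \<open>u\<close> and
  \<open>p\<close> under exchanges.\<close>

lemma dem_braid_aux:
  fixes q0 q1 :: "'r::comm_ring_1"
  assumes "q1 * w = A - p" "q0 * u = w0 - w" "q1 * d = u1 - u" "(q0 + q1) * u1 = w01 - w"
    "(q0 + q1) * w0 = B - C" "q0 * w01 = E - F"
  shows "q0 * (q1 * ((q0 + q1) * d)) = E - F - B + C + A - p"
proof -
  have "q0 * (q1 * ((q0 + q1) * d)) = q0 * ((q0 + q1) * (q1 * d))"
    by (simp only: ac_simps)
  also have "\<dots> = q0 * ((q0 + q1) * u1) - (q0 + q1) * (q0 * u)"
    unfolding assms(3) by (simp add: algebra_simps)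
  also have "\<dots> = q0 * w01 - (q0 + q1) * w0 + q1 * w"
    unfolding assms(2,4) by (simp add: algebra_simps)
  also have "\<dots> = E - F - B + C + A - p"
    unfolding assms(1,5,6) by simp
  finally show ?thesis .
qed

text \<open>Numerator and denominator both change sign.\<close>

lemma swap_dem [simp]:
  assumes "a \<noteq> b"
  shows "swap a b (dem a b p) = dem a b p"
proof -
  have "(var a - var b) * swap a b (dem a b p) = - (swap a b (var a - var b) * swap a b (dem a b p))"
    using assms by (simp add: algebra_simps)
  also have "\<dots> = (var a - var b) * dem a b p"
    unfolding swap_dem_mult[OF assms] by (simp add: dem_mult[OF assms])
  finally have "(var a - var b) * swap a b (dem a b p) = (var a - var b) * dem a b p" .
  then show ?thesis
    using assms by (simp add: var_diff_cancel)
qed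

text \<open>Multiplied by the three differences of the variables, either side becomes the
  alternating sum of the images of \<open>p\<close> under the six permutations. The two sums differ
  only in how the longest permutation is written, which is \<open>swap_braid\<close>.\<close>

lemma dem_braid:
  assumes "a \<noteq> b" "b \<noteq> c" "a \<noteq> c"
  shows "dem b c (dem a b (dem b c p)) = dem a b (dem b c (dem a b p))"
proof -
  let ?r = "var a - var b + (var b - var c)"
  have w01: "(var a - var b) * swap b c (swap a b (dem b c p)) = swap b c (swap a b (swap b c p)) - swap b c (swap a b p)"
    using assms arg_cong[OF swap_dem_mult[of b c a b p], of "swap b c"] by simp
  have w10: "(var b - var c) * swap a b (swap b c (dem a b p)) = swap a b (swap b c (swap a b p)) - swap a b (swap b c p)"
    using assms arg_cong[OF swap_dem_mult[of a b b c p], of "swap a b"] by simp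
  let ?rhs = "swap b c (swap a b (swap b c p)) - swap b c (swap a b p) - swap a b (swap b c p)
      + swap a b p + swap b c p - p"
  have "(var a - var b) * ((var b - var c) * (?r * dem b c (dem a b (dem b c p)))) = ?rhs"
    by (rule dem_braid_aux[of _ "dem b c p" _ _ _ "dem a b (dem b c p)" "swap a b (dem b c p)" _
          "swap b c (dem a b (dem b c p))" "swap b c (swap a b (dem b c p))"])
      (use assms swap_dem_mult[of b c a b p] swap_dem_mult[of a b b c "dem b c p"]
         w01 in \<open>simp_all add: dem_mult\<close>)
  moreover have "(var b - var c) * ((var a - var b) * ((var b - var c + (var a - var b)) * dem a b (dem b c (dem a b p))))
      = swap a b (swap b c (swap a b p)) - swap a b (swap b c p) - swap b c (swap a b p)
      + swap b c p + swap a b p - p"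
    by (rule dem_braid_aux[of _ "dem a b p" _ _ _ "dem b c (dem a b p)" "swap b c (dem a b p)" _
          "swap a b (dem b c (dem a b p))" "swap a b (swap b c (dem a b p))"])
      (use assms swap_dem_mult[of a b b c p] swap_dem_mult[of b c a b "dem a b p"]
         w10 in \<open>simp_all add: dem_mult\<close>)
  moreover have "\<dots> = ?rhs"
    by (simp add: swap_braid[OF assms])
  ultimately have "(var a - var b) * ((var b - var c) * ((var a - var c) * dem b c (dem a b (dem b c p))))
      = (var a - var b) * ((var b - var c) * ((var a - var c) * dem a b (dem b c (dem a b p))))"
    by (simp add: mult.left_commute)
  then show ?thesis
    using assms by (simp add: var_diff_cancel)
qed

text \<open>If exactly two neighbouring colours agree, one divided difference slides through two
  exchanges. For \<open>i = k\<close>, \<open>i \<noteq> j\<close> the divided difference sits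
  between two exchanges and each side retains a multiple of \<open>p\<close> itself; these multiples
  differ by the right-hand side of the equation for \<open>R\<close>.\<close>

lemma cross_braid:
  assumes abc: "a \<noteq> b" "b \<noteq> c" "a \<noteq> c"
    and R: "(var a - var c) * R = f_arrow Q i j (var a) (var b) - f_arrow Q i j (var c) (var b)"
  shows "cross Q j k b c (cross Q i k a b (cross Q i j b c p)) - cross Q i j a b (cross Q i k b c (cross Q j k a b p))
       = (if i = k \<and> k \<noteq> j then R * p else 0)"
proof -
  consider (same) "i = j" "j = k" | (outer) "i = k" "i \<noteq> j" | (left) "i = j" "i \<noteq> k" | (right) "j = k" "i \<noteq> k"
    | (distinct) "i \<noteq> j" "j \<noteq> k" "i \<noteq> k"
    by blast
  then show ?thesis
  proof cases
    case same
    then show ?thesis by (simp add: cross_def dem_braid[OF abc])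
  next
    case distinct
    then show ?thesis
      using abc by (simp add: cross_def swap_braid[OF abc] ac_simps)
  next
    case left
    \<comment> \<open>\<open>var a - var b\<close> is the image of \<open>var b - var c\<close>
      under the two exchanges, so it clears the denominator of the conjugated
      \<open>dem b c p\<close>.\<close>
    have "(var a - var b) * (X Q i k (var b) (var c) * (X Q i k (var a) (var c) * swap b c (swap a b (dem b c p))))
        = X Q i k (var b) (var c) * X Q i k (var a) (var c) *
          swap b c (swap a b ((var b - var c) * dem b c p))"
      using abc by (simp add: ac_simps)
    also have "\<dots> = X Q i k (var b) (var c) * X Q i k (var a) (var c) *
          (swap a b (swap b c (swap a b p)) - swap b c (swap a b p))"
      using abc by (simp add: dem_mult swap_braid[OF abc])
    finally have "dem a b (cross Q i k b c (cross Q i k a b p)) = cross Q i k b c (cross Q i k a b (dem b c p))"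
      using abc left by (subst dem_eq_iff) (simp_all add: cross_def algebra_simps)
    with left show ?thesis by (simp add: cross_def)
  next
    case right
    have "(var b - var c) * (X Q i j (var a) (var b) * (X Q i j (var a) (var c) * swap a b (swap b c (dem a b p))))
        = X Q i j (var a) (var b) * X Q i j (var a) (var c) *
          swap a b (swap b c ((var a - var b) * dem a b p))"
      using abc by (simp add: ac_simps)
    also have "\<dots> = X Q i j (var a) (var b) * X Q i j (var a) (var c) *
          (swap b c (swap a b (swap b c p)) - swap a b (swap b c p))"
      using abc by (simp add: dem_mult swap_braid[OF abc])
    finally have "dem b c (cross Q i j a b (cross Q i j b c p)) = cross Q i j a b (cross Q i j b c (dem a b p))"
      using abc right by (subst dem_eq_iff) (simp_all add: cross_def algebra_simps)
    with right show ?thesis by (simp add: cross_def)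
  next
    case outer
    \<comment> \<open>\<open>swap b c\<close> turns the denominator \<open>var a - var b\<close>
      into \<open>var a - var c\<close>; on the other side \<open>swap a b\<close> turns
      \<open>var b - var c\<close> into the same difference.\<close>
    have 1: "(var a - var c) * (X Q j i (var b) (var c) * swap b c (dem a b (X Q i j (var b) (var c) * swap b c p)))
        = X Q j i (var b) (var c) * (X Q i j (var a) (var b) * swap b c (swap a b (swap b c p))
          - X Q i j (var c) (var b) * p)"
      using abc swap_dem_mult[of a b b c "X Q i j (var b) (var c) * swap b c p"]
      by (subst mult.left_commute) simp
    have 2: "(var a - var c) * (X Q i j (var a) (var b) * swap a b (dem b c (X Q j i (var a) (var b) * swap a b p)))
        = X Q i j (var a) (var b) * (X Q j i (var b) (var c) * swap a b (swap b c (swap a b p))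
          - X Q j i (var b) (var a) * p)"
      using abc swap_dem_mult[of b c a b "X Q j i (var a) (var b) * swap a b p"]
      by (subst mult.left_commute) simp
    have L: "cross Q j k b c (cross Q i k a b (cross Q i j b c p))
        = X Q j i (var b) (var c) * swap b c (dem a b (X Q i j (var b) (var c) * swap b c p))"
      and M: "cross Q i j a b (cross Q i k b c (cross Q j k a b p))
        = X Q i j (var a) (var b) * swap a b (dem b c (X Q j i (var a) (var b) * swap a b p))"
      using outer by (auto simp: cross_def)
    have "(var a - var c) * (cross Q j k b c (cross Q i k a b (cross Q i j b c p)) - cross Q i j a b (cross Q i k b c (cross Q j k a b p)))
        = X Q j i (var b) (var c) * (X Q i j (var a) (var b) * swap b c (swap a b (swap b c p)) - X Q i j (var c) (var b) * p)
        - X Q i j (var a) (var b) * (X Q j i (var b) (var c) * swap a b (swap b c (swap a b p)) - X Q j i (var b) (var a) * p)"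
      unfolding L M right_diff_distrib[of "var a - var c"] 1 2 ..
    also have "\<dots> = (f_arrow Q i j (var a) (var b) - f_arrow Q i j (var c) (var b)) * p"
      by (simp add: f_arrow_def swap_braid[OF abc] algebra_simps)
    also have "\<dots> = (var a - var c) * (R * p)"
      unfolding R[symmetric] by (simp only: mult.assoc)
    finally have "(var a - var c) * (cross Q j k b c (cross Q i k a b (cross Q i j b c p)) - cross Q i j a b (cross Q i k b c (cross Q j k a b p)))
        = (var a - var c) * (R * p)" .
    with abc outer show ?thesis by (simp add: var_diff_cancel)
  qed
qed

section \<open>Values of the elementary diagrams\<close>

lemma poly_term_Id_Dot: "poly_term Q (KId w \<otimes>\<^sub>K KDot i) = (\<lambda>p\<in>polys (nblack w + Suc 0). var 0 * p)"
  by (rule poly_term_Id_mult) simp_all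

lemma poly_term_Dot_Id: "poly_term Q (KDot i \<otimes>\<^sub>K KId w) = (\<lambda>p\<in>polys (Suc 0 + nblack w). var (nblack w) * p)"
proof -
  have "poly_term Q (KDot i \<otimes>\<^sub>K KId w) = (\<lambda>p\<in>polys (Suc 0 + nblack w). shift (nblack w) (var 0) * p)"
    by (rule poly_term_mult_Id) simp_all
  then show ?thesis
    by (simp del: poly_term.simps)
qed

lemma poly_term_Id_red_black:
  "poly_term Q (KId w \<otimes>\<^sub>K xrb \<theta> i) = (\<lambda>p\<in>polys (nblack w + Suc 0). var 0 ^ Poly_Mapping.lookup \<theta> i * p)"
  by (rule poly_term_Id_mult) simp_all

lemma shift_power [simp]: "shift n (p ^ k) = shift n p ^ k"
  by (simp add: shift_eq)

lemma poly_term_red_black_Id: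
  "poly_term Q (xrb \<theta> i \<otimes>\<^sub>K KId w) = (\<lambda>p\<in>polys (Suc 0 + nblack w). var (nblack w) ^ Poly_Mapping.lookup \<theta> i * p)"
proof -
  have "poly_term Q (xrb \<theta> i \<otimes>\<^sub>K KId w)
      = (\<lambda>p\<in>polys (Suc 0 + nblack w). shift (nblack w) (var 0 ^ Poly_Mapping.lookup \<theta> i) * p)"
    by (rule poly_term_mult_Id) simp_all
  then show ?thesis
    by (simp del: poly_term.simps)
qed

lemma poly_term_Id_black_red:
  "poly_term Q (KId w \<otimes>\<^sub>K xbr i \<theta>) = (\<lambda>p\<in>polys (nblack w + Suc 0). p)"
  using tens_map_id[OF subspace_polys, of "nblack w" "Suc 0"] by (simp add: tens_space_polys)

lemma poly_term_black_red_Id: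
  "poly_term Q (xbr i \<theta> \<otimes>\<^sub>K KId w) = (\<lambda>p\<in>polys (Suc 0 + nblack w). p)"
  using tens_map_id[OF subspace_polys, of "Suc 0" "nblack w"] by (simp add: tens_space_polys)

lemma poly_term_kpow_Dot:
  "poly_term Q (kpow [Black i] (KDot i) n) = (\<lambda>p\<in>polys (Suc 0). var 0 ^ n * p)"
proof -
  have "poly_term Q (kpow [Black i] (KDot i) n) = (\<lambda>p\<in>polys (nblack [Black i]). var 0 ^ n * p)"
    by (rule poly_term_kpow) simp_all
  then show ?thesis
    by (simp del: poly_term.simps)
qed

lemma poly_term_Id_kpow_Dot:
  "poly_term Q (KId w \<otimes>\<^sub>K kpow [Black i] (KDot i) n) = (\<lambda>p\<in>polys (nblack w + Suc 0). var 0 ^ n * p)"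
  by (rule poly_term_Id_mult) (simp_all add: poly_term_kpow_Dot)

lemma poly_term_kpow_Dot_Id:
  "poly_term Q (kpow [Black i] (KDot i) n \<otimes>\<^sub>K KId w) = (\<lambda>p\<in>polys (Suc 0 + nblack w). var (nblack w) ^ n * p)"
proof -
  have "poly_term Q (kpow [Black i] (KDot i) n \<otimes>\<^sub>K KId w)
      = (\<lambda>p\<in>polys (Suc 0 + nblack w). shift (nblack w) (var 0 ^ n) * p)"
    by (rule poly_term_mult_Id) (simp_all add: poly_term_kpow_Dot)
  then show ?thesis
    by (simp del: poly_term.simps)
qed

lemma poly_term_kpow_Red_kpow:
  "poly_term Q (kpow [Black i] (KDot i) m \<otimes>\<^sub>K K1 (Red \<theta>) \<otimes>\<^sub>K kpow [Black j] (KDot j) n)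
    = (\<lambda>p\<in>polys (Suc (Suc 0)). var (Suc 0) ^ m * var 0 ^ n * p)"
proof -
  have 1: "tens_map (polys (Suc 0)) (Suc 0) (Suc 0) (\<lambda>p\<in>polys (Suc 0). var 0 ^ m * p) (\<lambda>p\<in>polys (Suc 0). var 0 ^ n * p)
      = (\<lambda>p\<in>tens_space (polys (Suc 0)) (Suc 0). var (Suc 0) ^ m * var 0 ^ n * p)"
    by (rule tens_map_eqI) (simp_all add: linear_on_mult ac_simps)
  have 2: "poly_term Q (K1 (Red \<theta>) \<otimes>\<^sub>K kpow [Black j] (KDot j) n) = (\<lambda>p\<in>polys (Suc 0). var 0 ^ n * p)"
    by (subst poly_term_Id_kpow_Dot) simp
  show ?thesis
    by (subst poly_term.simps(5)) (simp add: 1 2 poly_term_kpow_Dot tens_space_polys del: poly_term.simps(5))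
qed

lemmas poly_term_eval = poly_term_Id_Cross[unfolded add_2_eq_Suc'] poly_term_Cross_Id[unfolded add_2_eq_Suc] poly_term_Id_Dot poly_term_Dot_Id
  poly_term_Id_red_black poly_term_red_black_Id poly_term_Id_black_red poly_term_black_red_Id
  poly_term_kpow_Dot poly_term_Id_kpow_Dot poly_term_kpow_Dot_Id

text \<open>The twisted Leibniz rule. The case \<open>n = 1\<close> yields the dot relations; with
  \<open>n\<close> a coefficient of \<open>\<theta>\<close> it yields the correction for a red
  strand between two black strands of the same colour.\<close>

lemma dem_power_mult:
  assumes "a \<noteq> b" "(var a - var b) * R = var a ^ n - var b ^ n"
  shows "var b ^ n * dem a b p - dem a b (var a ^ n * p) = R * p"
proof -
  have "(var a - var b) * (var b ^ n * dem a b p - dem a b (var a ^ n * p))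
      = var b ^ n * ((var a - var b) * dem a b p) - (var a - var b) * dem a b (var a ^ n * p)"
    by (simp add: algebra_simps)
  also have "\<dots> = (var a ^ n - var b ^ n) * p"
    unfolding dem_mult[OF assms(1)] by (simp add: algebra_simps)
  also have "\<dots> = (var a - var b) * (R * p)"
    unfolding assms(2)[symmetric] by (simp only: mult.assoc)
  finally show ?thesis
    using assms(1) by (simp add: var_diff_cancel)
qed

lemma dem_power_symmetric:
  "a \<noteq> b \<Longrightarrow> dem a b (var a ^ n * (var b ^ n * p)) = var a ^ n * (var b ^ n * dem a b p)"
  using dem_mult_invariant[of a b "var a ^ n * var b ^ n" p] by (simp add: ac_simps)

lemma dem_var:
  assumes "a \<noteq> b"
  shows "dem a b (var a * p) = var b * dem a b p - p" "dem a b (var b * p) = var a * dem a b p + p"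
proof -
  show *: "dem a b (var a * p) = var b * dem a b p - p"
    using dem_power_mult[OF assms, of 1 1 p] by (simp add: algebra_simps)
  \<comment> \<open>The second identity follows from the first because \<open>var a + var b\<close>
    is symmetric.\<close>
  have "dem a b ((var a + var b) * p) = (var a + var b) * dem a b p"
    using assms by (intro dem_mult_invariant) (simp_all add: add.commute)
  then have "dem a b (var a * p) + dem a b (var b * p) = var a * dem a b p + var b * dem a b p"
    by (simp only: distrib_right dem_linear(1)[OF assms])
  then show "dem a b (var b * p) = var a * dem a b p + p"
    unfolding * by (simp add: algebra_simps)
qed

lemma cross_var:
  assumes "a \<noteq> b"
  shows "cross Q i j a b (var a * p) = var b * cross Q i j a b p - (if i = j then p else 0)"
    "cross Q i j a b (var b * p) = var a * cross Q i j a b p + (if i = j then p else 0)"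
  using assms by (simp_all add: cross_def dem_var)

lemma dem_dem: "a \<noteq> b \<Longrightarrow> dem a b (dem a b p) = 0"
  by (simp add: dem_eq_iff)

lemma sum_list_concat: "sum_list (concat (map f xs)) = (\<Sum>x\<leftarrow>xs. sum_list (f x))"
  by (induction xs) auto

lemma sum_comprehension:
  "sum_list (map C [t a b. a \<leftarrow> [0..<n], b \<leftarrow> [0..<n], a + b + 1 = n]) = (\<Sum>a<n. C (t a (n - Suc a)))"
proof -
  have "(\<Sum>b\<leftarrow>[0..<n]. sum_list (map C (if a + b + 1 = n then [t a b] else []))) = C (t a (n - Suc a))"
    if "a < n" for a
  proof -
    have "(\<Sum>b\<leftarrow>[0..<n]. sum_list (map C (if a + b + 1 = n then [t a b] else [])))
        = (\<Sum>b<n. if b = n - Suc a then C (t a b) else 0)"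
      unfolding interv_sum_list_conv_sum_set_nat using that by (intro sum.cong) auto
    then show ?thesis using that by simp
  qed
  then show ?thesis
    by (simp add: map_concat sum_list_concat comp_def interv_sum_list_conv_sum_set_nat atLeast0LessThan)
qed

text \<open>The ends are compared together with the values because the value of a composite or
  tensor product refers to the ends of its parts, so the congruence clauses of \<open>keq\<close>
  use both.\<close>

lemma krel_sound:
  fixes s t :: "('v, 'k::field) kterm"
  assumes "krel Q s t"
  shows "ksrc s = ksrc t \<and> ktgt s = ktgt t \<and> (poly_term Q s :: ('b, 'k) univ \<Rightarrow> _) = poly_term Q t"
  using assms
proof (induction rule: krel.induct)
  case (krel_dot_left i j)
  show ?case
    by (auto simp: fun_eq_iff compose_def poly_term_eval cross_var polys_mult cross_in_polys simp del: poly_term.simps(5))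
next
  case (krel_dot_right i j)
  show ?case
    by (auto simp: fun_eq_iff compose_def poly_term_eval cross_var polys_mult cross_in_polys simp del: poly_term.simps(5))
next
  case (krel_square_same i)
  show ?case
    by (auto simp: fun_eq_iff compose_def cross_in_polys cross_def dem_dem dem_in_polys)
next
  case (krel_square_diff i j)
  then show ?case
    by (auto simp: fun_eq_iff compose_def cross_in_polys poly_term_dots) (auto simp: cross_def f_arrow_def)
next
  case (krel_braid i j k)
  \<comment> \<open>On three strands \<open>y\<^sub>1\<close>, \<open>y\<^sub>2\<close>,
    \<open>y\<^sub>3\<close> are \<open>var 2\<close>, \<open>var 1\<close>, \<open>var 0\<close>,
    which is \<open>cross_braid\<close> with \<open>a = 0\<close>, \<open>b = 1\<close>,
    \<open>c = 2\<close>.\<close>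
  let ?P = "f_arrow Q i j (yvar 3) (yvar 2) - f_arrow Q i j (yvar 1) (yvar 2) :: (nat \<Rightarrow>\<^sub>0 nat) \<Rightarrow>\<^sub>0 'k"
  let ?R = "dots_eval 3 (exact_quotient ?P (yvar 3 - yvar 1))"
  have "(dots_eval 3 (yvar 3 - yvar 1 :: (nat \<Rightarrow>\<^sub>0 nat) \<Rightarrow>\<^sub>0 'k) :: ('b, 'k) univ) * ?R = dots_eval 3 ?P"
    by (rule dots_eval_exact_quotient[OF f_arrow_diff_dvd], erule pvar_diff_cancel[THEN iffD1, rotated]) simp
  then have "(var 0 - var 2) * (?R :: ('b, 'k) univ) = f_arrow Q i j (var 0) (var 1) - f_arrow Q i j (var 2) (var 1)"
    by simp
  from cross_braid[OF _ _ _ this, of k, simplified] show ?case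
    by (auto simp: fun_eq_iff compose_def kminus_def poly_term_eval cross_in_polys poly_term_dots numeral_2_eq_2 numeral_3_eq_3
       simp del: poly_term.simps(5))
next
  case (krel_red_middle i j \<theta>)
  define n where "n = Poly_Mapping.lookup \<theta> i"
  let ?t = "\<lambda>a b. kpow [Black i] (KDot i) a \<otimes>\<^sub>K K1 (Red \<theta>) \<otimes>\<^sub>K kpow [Black j] (KDot j) b :: ('v, 'k) kterm"
  let ?ts = "[?t a b. a \<leftarrow> [0..<n], b \<leftarrow> [0..<n], a + b + 1 = n]"
  let ?w = "[Black i, Red \<theta>, Black j]" and ?w' = "[Black j, Red \<theta>, Black i]"
  show ?case
  proof (cases "i = j")
    case True
    \<comment> \<open>Every summand acts as multiplication by a polynomial, which is recovered as
      its value at \<open>1\<close>.\<close>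
    let ?C = "\<lambda>t. poly_term Q t 1 :: ('b, 'k) univ"
    have C: "?C (?t a b) = var 1 ^ a * var 0 ^ b" for a b
      by (subst poly_term_kpow_Red_kpow) (simp add: polys_eq)
    have "poly_term Q (foldr (+\<^sub>K) ?ts (KZero ?w ?w')) = (\<lambda>p\<in>polys (nblack ?w). (\<Sum>t\<leftarrow>?ts. ?C t) * p)"
    proof (rule poly_term_foldr_KAdd)
      fix t assume "t \<in> set ?ts"
      then obtain a b where t: "t = ?t a b"
        by auto
      show "ksrc t = ?w"
        by (simp add: t)
      show "poly_term Q t = (\<lambda>p\<in>polys (nblack ?w). ?C t * p)"
        unfolding t C unfolding poly_term_kpow_Red_kpow by simp
    qed
    then have sum: "poly_term Q (foldr (+\<^sub>K) ?ts (KZero ?w ?w'))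
        = (\<lambda>p\<in>polys (Suc (Suc 0)). (\<Sum>a<n. var 1 ^ a * var 0 ^ (n - Suc a) :: ('b, 'k) univ) * p)"
      unfolding sum_comprehension C by simp
    have st: "ksrc (foldr (+\<^sub>K) ?ts (KZero ?w ?w')) = ?w" "ktgt (foldr (+\<^sub>K) ?ts (KZero ?w ?w')) = ?w'"
      by (rule foldr_KAdd_source_target; use True in auto)+
    \<comment> \<open>By the geometric sum, the sum over \<open>a + b + 1 = n\<close> is the
      quotient \<open>R\<close> required by \<open>dem_power_mult\<close>.\<close>
    have "(var 0 - var 1) * (\<Sum>a<n. var 1 ^ a * var 0 ^ (n - Suc a) :: ('b, 'k) univ) = var 0 ^ n - var 1 ^ n"
      using power_diff_sumr2[of "var 1 :: ('b, 'k) univ" n "var 0"] by (simp add: algebra_simps)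
    from dem_power_mult[OF _ this]
    have dem: "var (Suc 0) ^ n * dem 0 (Suc 0) p - dem 0 (Suc 0) (var 0 ^ n * p)
        = (\<Sum>a<n. var 1 ^ a * var 0 ^ (n - Suc a)) * p" for p :: "('b, 'k) univ"
      by simp
    have nj: "Poly_Mapping.lookup \<theta> j = n"
      using True by (simp add: n_def)
    show ?thesis
      unfolding if_P[OF True] n_def[symmetric] st sum
      using True dem
      by (auto simp: fun_eq_iff compose_def kminus_def poly_term_eval cross_in_polys polys_mult polys_power
          nj cross_def dem_in_polys simp del: poly_term.simps(5))
  next
    case False
    then show ?thesis
      by (auto simp: fun_eq_iff compose_def kminus_def poly_term_eval cross_in_polys polys_mult polys_power
          simp del: poly_term.simps(5)) (auto simp: cross_def)
  qed
next
  case (krel_red_right i j \<theta>)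
  show ?case
    by (auto simp: fun_eq_iff compose_def poly_term_eval cross_in_polys simp del: poly_term.simps(5))
next
  case (krel_red_left i j \<theta>)
  show ?case
    by (auto simp: fun_eq_iff compose_def poly_term_eval cross_in_polys polys_mult polys_power simp del: poly_term.simps(5))
       (auto simp: cross_def dem_power_symmetric)
next
  case (krel_dot_red_left i \<theta>)
  show ?case
    by (auto simp: fun_eq_iff compose_def poly_term_eval polys_mult polys_power simp del: poly_term.simps(5))
next
  case (krel_dot_red_right i \<theta>)
  show ?case
    by (auto simp: fun_eq_iff compose_def poly_term_eval polys_mult polys_power simp del: poly_term.simps(5))
next
  case (krel_square_red_black i \<theta>)
  show ?case
    by (auto simp: fun_eq_iff compose_def poly_term_eval polys_mult polys_power simp del: poly_term.simps(5))
next
  case (krel_square_black_red i \<theta>)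
  show ?case
    by (auto simp: fun_eq_iff compose_def poly_term_eval polys_mult polys_power simp del: poly_term.simps(5))
qed

section \<open>Linear algebra of restricted functions\<close>

lemma compose_lin_map_id:
  assumes "lin_map V W f"
  shows "compose V (\<lambda>w\<in>W. w) f = f" "compose V f (\<lambda>v\<in>V. v) = f"
  by (rule ext; simp add: compose_def lin_mapD(3,7)[OF assms])+

lemma lin_map_algebra:
  assumes f: "lin_map V W f"
  shows lin_map_add_zero: "(\<lambda>v\<in>V. f v + (\<lambda>v\<in>V. 0) v) = f"
    and lin_map_add_inverse: "(\<lambda>v\<in>V. f v + (\<lambda>v\<in>V. uscale (- 1) (f v)) v) = (\<lambda>v\<in>V. 0)"
    and lin_map_scale_one: "(\<lambda>v\<in>V. uscale 1 (f v)) = f"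
  by (rule ext; simp add: lin_mapD(7)[OF f])+

text \<open>\<open>poly_term\<close> and \<open>Vect\<close> restrict after every operation. Stated
  with these nested restrictions, the laws rewrite whole functions.\<close>

lemma restrict_add_assoc: "(\<lambda>v\<in>V. (\<lambda>v\<in>V. f v + g v) v + h v) = (\<lambda>v\<in>V. f v + (\<lambda>v\<in>V. g v + h v) v)"
  and restrict_scale_add: "(\<lambda>v\<in>V. uscale x ((\<lambda>v\<in>V. f v + g v) v)) = (\<lambda>v\<in>V. (\<lambda>v\<in>V. uscale x (f v)) v + (\<lambda>v\<in>V. uscale x (g v)) v)"
  and restrict_add_scale: "(\<lambda>v\<in>V. uscale (x + y) (f v)) = (\<lambda>v\<in>V. (\<lambda>v\<in>V. uscale x (f v)) v + (\<lambda>v\<in>V. uscale y (f v)) v)"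
  and restrict_mult_scale: "(\<lambda>v\<in>V. uscale (x * y) (f v)) = (\<lambda>v\<in>V. uscale x ((\<lambda>v\<in>V. uscale y (f v)) v))"
  for f g h :: "('b, 'k::field) univ \<Rightarrow> ('b, 'k) univ"
  by (rule ext; simp add: algebra_simps univ.scale_right_distrib univ.scale_left_distrib)+

lemma compose_linear:
  assumes f: "lin_map V W f" and f': "lin_map V W f'" and g: "lin_map W U g" and g': "lin_map W U g'"
  shows "compose V (\<lambda>w\<in>W. g w + g' w) f = (\<lambda>v\<in>V. compose V g f v + compose V g' f v)"
    and "compose V g (\<lambda>v\<in>V. f v + f' v) = (\<lambda>v\<in>V. compose V g f v + compose V g f' v)"
    and "compose V (\<lambda>w\<in>W. uscale x (g w)) f = (\<lambda>v\<in>V. uscale x (compose V g f v))"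
    and "compose V g (\<lambda>v\<in>V. uscale x (f v)) = (\<lambda>v\<in>V. uscale x (compose V g f v))"
  by (rule ext; simp add: compose_def lin_mapD(3)[OF f] lin_mapD(3)[OF f'] linear_onD[OF lin_mapD(4)[OF g]])+

lemma compose_lin_map_assoc:
  assumes "lin_map V W f"
  shows "compose V h (compose V g f) = compose V (compose W h g) f"
  by (rule compose_assoc) (use lin_mapD(3)[OF assms] in auto)

text \<open>Apart from the relations and the congruence rules, each clause of \<open>keq\<close> is
  a law of linear maps or of \<open>tens_map\<close>; its typing hypotheses supply the
  \<open>lin_map\<close> facts that the law requires.\<close>

lemma keq_sound:
  fixes s t :: "('v, 'k::field) kterm"
  assumes "keq Q s t"
  shows "ksrc s = ksrc t \<and> ktgt s = ktgt t \<and> (poly_term Q s :: ('b, 'k) univ \<Rightarrow> _) = poly_term Q t"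
  using assms
proof (induction rule: keq.induct)
  case (keq_rel f g)
  then show ?case by (rule krel_sound)
next
  case (keq_Comp_assoc f a b g c h d)
  then show ?case
    unfolding poly_term.simps by (simp add: karr_ksrc karr_ktgt compose_lin_map_assoc[OF lin_map_poly_term])
next
  case (keq_Id_left f a b)
  then show ?case
    unfolding poly_term.simps by (simp add: karr_ksrc karr_ktgt compose_lin_map_id[OF lin_map_poly_term])
next
  case (keq_Id_right f a b)
  then show ?case
    unfolding poly_term.simps by (simp add: karr_ksrc karr_ktgt compose_lin_map_id[OF lin_map_poly_term])
next
  case (keq_Add_assoc f a b g h)
  then show ?case
    unfolding poly_term.simps by (simp add: karr_ksrc karr_ktgt restrict_add_assoc add.assoc cong: restrict_cong)
next
  case (keq_Add_comm f a b g)
  then show ?case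
    unfolding poly_term.simps by (simp add: karr_ksrc karr_ktgt add.commute)
next
  case (keq_Add_Zero f a b)
  then show ?case
    unfolding poly_term.simps by (simp add: karr_ksrc karr_ktgt lin_map_algebra[OF lin_map_poly_term] del: restrict_apply)
next
  case (keq_Add_inverse f a b)
  then show ?case
    unfolding poly_term.simps by (simp add: karr_ksrc karr_ktgt cong: restrict_cong)
next
  case (keq_Scale_Add f a b g x)
  then show ?case
    unfolding poly_term.simps by (simp add: karr_ksrc karr_ktgt restrict_scale_add del: restrict_apply)
next
  case (keq_Scale_add f a b x x')
  then show ?case
    unfolding poly_term.simps by (simp add: karr_ksrc karr_ktgt restrict_add_scale del: restrict_apply)
next
  case (keq_Scale_mult f a b x x')
  then show ?case
    unfolding poly_term.simps by (simp add: karr_ksrc karr_ktgt restrict_mult_scale del: restrict_apply univ.scale_scale)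
next
  case (keq_Scale_one f a b)
  then show ?case
    unfolding poly_term.simps by (simp add: karr_ksrc karr_ktgt lin_map_algebra[OF lin_map_poly_term] del: restrict_apply univ.scale_one)
next
  case (keq_Comp_Add_left f a b g c g')
  note * = keq_Comp_Add_left[THEN lin_map_poly_term]
  from keq_Comp_Add_left show ?case
    unfolding poly_term.simps by (simp add: karr_ksrc karr_ktgt compose_linear(1)[OF *(1,1,2,3)] del: restrict_apply)
next
  case (keq_Comp_Add_right f a b f' g c)
  note * = keq_Comp_Add_right[THEN lin_map_poly_term]
  from keq_Comp_Add_right show ?case
    unfolding poly_term.simps by (simp add: karr_ksrc karr_ktgt compose_linear(2)[OF *(1,2,3,3)] del: restrict_apply)
next
  case (keq_Comp_Scale_left f a b g c x)
  note * = keq_Comp_Scale_left[THEN lin_map_poly_term]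
  from keq_Comp_Scale_left show ?case
    unfolding poly_term.simps by (simp add: karr_ksrc karr_ktgt compose_linear(3)[OF *(1,1,2,2)] del: restrict_apply)
next
  case (keq_Comp_Scale_right f a b g c x)
  note * = keq_Comp_Scale_right[THEN lin_map_poly_term]
  from keq_Comp_Scale_right show ?case
    unfolding poly_term.simps by (simp add: karr_ksrc karr_ktgt compose_linear(4)[OF *(1,1,2,2)] del: restrict_apply)
next
  case (keq_Tens_assoc f a b g c d h p q)
  note * = keq_Tens_assoc[THEN lin_map_poly_term]
  from keq_Tens_assoc show ?case
    unfolding poly_term.simps by (simp add: karr_ksrc karr_ktgt tens_map_assoc[OF *, unfolded tens_space_polys] del: restrict_apply)
next
  case (keq_Tens_Unit f a b)
  then show ?case
    unfolding poly_term.simps by (simp add: karr_ksrc karr_ktgt tens_map_unit[OF lin_map_poly_term])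
next
  case (keq_Unit_Tens f a b)
  then show ?case
    unfolding poly_term.simps by (simp add: karr_ksrc karr_ktgt unit_tens_map[OF lin_map_poly_term])
next
  case (keq_Tens_Id a b)
  show ?case
    unfolding poly_term.simps by (simp add: tens_map_id[OF subspace_polys] tens_space_polys)
next
  case (keq_Tens_Comp f a b f' c g p q g' r)
  note * = keq_Tens_Comp[THEN lin_map_poly_term]
  from keq_Tens_Comp show ?case
    unfolding poly_term.simps by (simp add: karr_ksrc karr_ktgt tens_space_polys tens_map_compose[OF *] del: restrict_apply)
next
  case (keq_Tens_Add_left f a b f' g c d)
  note * = keq_Tens_Add_left[THEN lin_map_poly_term]
  from keq_Tens_Add_left show ?case
    unfolding poly_term.simps by (simp add: karr_ksrc karr_ktgt tens_space_polys tens_map_add_left[OF *] del: restrict_apply)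
next
  case (keq_Tens_Add_right f a b g c d g')
  note * = keq_Tens_Add_right[THEN lin_map_poly_term]
  from keq_Tens_Add_right show ?case
    unfolding poly_term.simps by (simp add: karr_ksrc karr_ktgt tens_space_polys tens_map_add_right[OF *] del: restrict_apply)
next
  case (keq_Tens_Scale_left f a b g c d x)
  note * = keq_Tens_Scale_left[THEN lin_map_poly_term]
  from keq_Tens_Scale_left show ?case
    unfolding poly_term.simps by (simp add: karr_ksrc karr_ktgt tens_space_polys tens_map_scale_left[OF *] del: restrict_apply)
next
  case (keq_Tens_Scale_right f a b g c d x)
  note * = keq_Tens_Scale_right[THEN lin_map_poly_term]
  from keq_Tens_Scale_right show ?case
    unfolding poly_term.simps by (simp add: karr_ksrc karr_ktgt tens_space_polys tens_map_scale_right[OF *] del: restrict_apply)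
qed auto

section \<open>The relations of the oKLRW category\<close>

text \<open>\<open>\<rho>\<^sub>i\<close> on the strand with variable \<open>var a\<close>. The
  mirror meets the leftmost strand, which has the largest index, so the relations use
  \<open>a = 0\<close> on one strand and \<open>a = 1\<close> on two.\<close>

definition refl_op :: "('v \<Rightarrow>\<^sub>0 nat) \<Rightarrow> 'v \<Rightarrow> nat \<Rightarrow> ('b, 'k::field) univ \<Rightarrow> ('b, 'k) univ" where
  "refl_op \<mu> i a p = (- var a) ^ Poly_Mapping.lookup \<mu> i * neg a p"

lemma refl_op_linear:
  "refl_op \<mu> i a (p + q) = refl_op \<mu> i a p + refl_op \<mu> i a q"
  "refl_op \<mu> i a (uscale c p) = uscale c (refl_op \<mu> i a p)"
  by (simp_all add: refl_op_def distrib_left uscale_mult_right)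

lemma polys_uminus: "p \<in> polys n \<Longrightarrow> - p \<in> polys n"
  by (simp add: polys_eq polys_in_uminus)

lemma refl_op_in_polys: "p \<in> polys n \<Longrightarrow> a < n \<Longrightarrow> refl_op \<mu> i a p \<in> polys n"
  by (simp add: refl_op_def polys_mult polys_power polys_uminus neg_in_polys)

lemma shift_uminus [simp]: "shift n (- p) = - shift n p"
  by (simp add: shift_eq)

lemma refl_op_shift_mult:
  assumes "q \<in> polys n"
  shows "refl_op \<mu> i n (shift n p * q) = shift n (refl_op \<mu> i 0 p) * q"
  using assms neg_shift[of 0 n p] by (simp add: refl_op_def neg_polys_high mult.assoc)

lemma lin_map_refl_op: "lin_map (polys (Suc 0)) (polys (Suc 0)) (restrict (refl_op \<mu> i 0) (polys (Suc 0)))"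
  by (rule lin_mapI) (auto simp: subspace_polys refl_op_in_polys linear_on_def refl_op_linear)

text \<open>Targets have no counterpart here: the value of a module term refers only to sources of
  module terms and to both ends of an acting \<open>KLRW\<close> term.\<close>

primrec osrc :: "('v, 'k) oterm \<Rightarrow> 'v word" where
  "osrc (OEmb f) = ksrc f"
| "osrc (ORho i) = [Black i]"
| "osrc (f \<otimes>\<^sub>O g) = osrc f @ ksrc g"
| "osrc (g \<circ>\<^sub>O f) = osrc f"
| "osrc (OZero a b) = a"
| "osrc (f +\<^sub>O g) = osrc f"
| "osrc (OScale c f) = osrc f"

primrec opoly_term :: "('v, 'a) pre_digraph \<Rightarrow> ('v \<Rightarrow>\<^sub>0 nat) \<Rightarrow> ('v, 'k::field) oterm \<Rightarrow> ('b, 'k) univ \<Rightarrow> ('b, 'k) univ" where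
  "opoly_term Q \<mu> (OEmb f) = poly_term Q f"
| "opoly_term Q \<mu> (ORho i) = restrict (refl_op \<mu> i 0) (polys (Suc 0))"
| "opoly_term Q \<mu> (f \<otimes>\<^sub>O g) = tens_map (polys (nblack (osrc f))) (nblack (ksrc g)) (nblack (ktgt g))
                              (opoly_term Q \<mu> f) (poly_term Q g)"
| "opoly_term Q \<mu> (g \<circ>\<^sub>O f) = compose (polys (nblack (osrc f))) (opoly_term Q \<mu> g) (opoly_term Q \<mu> f)"
| "opoly_term Q \<mu> (OZero a b) = (\<lambda>p\<in>polys (nblack a). 0)"
| "opoly_term Q \<mu> (f +\<^sub>O g) = (\<lambda>p\<in>polys (nblack (osrc f)). opoly_term Q \<mu> f p + opoly_term Q \<mu> g p)"
| "opoly_term Q \<mu> (OScale c f) = (\<lambda>p\<in>polys (nblack (osrc f)). uscale c (opoly_term Q \<mu> f p))"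

lemma oarr_osrc: "oarr Q \<tau> t a b \<Longrightarrow> osrc t = a"
  by (induction rule: oarr.induct) (auto simp: karr_ksrc)

lemma lin_map_opoly_term:
  assumes "oarr Q \<tau> t a b"
  shows "lin_map (polys (nblack a)) (polys (nblack b)) (opoly_term Q \<mu> t)"
  using assms
proof (induction rule: oarr.induct)
  case (oarr_Emb f a b)
  then show ?case unfolding opoly_term.simps by (rule lin_map_poly_term)
next
  case (oarr_Rho i)
  show ?case unfolding opoly_term.simps nblack_simps by (rule lin_map_refl_op)
next
  case (oarr_Act f a b g c d)
  note g = lin_map_poly_term[OF oarr_Act.hyps(2)]
  from oarr_Act show ?case
    unfolding opoly_term.simps by (simp add: oarr_osrc karr_ksrc karr_ktgt tens_map_polys[OF _ g])
next
  case (oarr_Comp f a b g c)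
  then show ?case unfolding opoly_term.simps by (simp add: oarr_osrc lin_map_compose)
next
  case (oarr_Zero a b)
  show ?case unfolding opoly_term.simps by (intro lin_map_zero subspace_polys)
next
  case (oarr_Add f a b g)
  then show ?case unfolding opoly_term.simps oarr_osrc[OF oarr_Add.hyps(1)] by (intro lin_map_add)
next
  case (oarr_Scale f a b c)
  then show ?case unfolding opoly_term.simps oarr_osrc[OF oarr_Scale.hyps] by (intro lin_map_scale)
qed

lemma opoly_term_Rho_Id:
  "opoly_term Q \<mu> (ORho i \<otimes>\<^sub>O KId w) = restrict (refl_op \<mu> i (nblack w)) (polys (Suc (nblack w)))"
proof -
  have "tens_map (polys (Suc 0)) k k (restrict (refl_op \<mu> i 0) (polys (Suc 0))) (\<lambda>p\<in>polys k. p)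
      = restrict (refl_op \<mu> i k) (polys (Suc 0 + k))" for k
    by (rule tens_map_left) (simp_all add: refl_op_linear refl_op_shift_mult)
  then show ?thesis
    by simp
qed

lemma neg_dem_mult:
  "a \<noteq> b \<Longrightarrow> neg c (var a - var b) * neg c (dem a b p) = neg c (swap a b p) - neg c p"
  using arg_cong[OF dem_mult[of a b p], of "neg c"] by simp

text \<open>The substitution \<open>var a \<mapsto> - var b\<close>,
  \<open>var b \<mapsto> - var a\<close> fixes \<open>var a - var b\<close> and commutes with
  \<open>swap a b\<close>, hence commutes with the divided difference.\<close>

lemma dem_neg_neg:
  assumes "a \<noteq> b"
  shows "dem a b (swap a b (neg a (neg b p))) = swap a b (neg a (neg b (dem a b p)))"
proof -
  have "swap a b (neg a (neg b (var a - var b))) = var a - var b"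
    using assms by simp
  then have "(var a - var b) * swap a b (neg a (neg b (dem a b p)))
      = swap a b (neg a (neg b ((var a - var b) * dem a b p)))"
    by simp
  also have "\<dots> = neg a (neg b p) - swap a b (neg a (neg b p))"
    using assms by (simp add: dem_mult neg_swap neg_swap' neg_commute[of b a])
  finally show ?thesis
    using assms by (simp add: dem_eq_iff)
qed

context involutive_quiver
begin

lemma dominates_\<tau>0:
  assumes "i \<rightarrow>\<^bsub>Q\<^esub> j"
  shows "\<tau>0 j \<rightarrow>\<^bsub>Q\<^esub> \<tau>0 i"
proof -
  obtain h where "h \<in> arcs Q" "tail Q h = i" "head Q h = j"
    using assms by (auto simp: arcs_ends_def arc_to_ends_def)
  then show ?thesis
    using \<tau>1_arcs[of h] tail_\<tau>1[of h] head_\<tau>1[of h]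
    by (auto simp: arcs_ends_def arc_to_ends_def intro!: image_eqI[of _ _ "\<tau>1 h"])
qed

text \<open>The involution reverses arrows, so the same arrow condition stands behind both
  sides.\<close>

lemma X_\<tau>0:
  assumes "i \<in> verts Q" "j \<in> verts Q"
  shows "X Q (\<tau>0 j) (\<tau>0 i) u v = X Q i j u v" "X Q (\<tau>0 j) i u v = X Q (\<tau>0 i) j u v"
  using dominates_\<tau>0[of j i] dominates_\<tau>0[of "\<tau>0 i" "\<tau>0 j"] dominates_\<tau>0[of i "\<tau>0 j"] dominates_\<tau>0[of j "\<tau>0 i"]
  by (auto simp: X_def assms \<tau>0_involution)

text \<open>The left strand has the variable \<open>var b\<close>. In the generic case all operators
  are substitutions and multiplications, matched by \<open>X_\<tau>0\<close>. For
  \<open>i = j\<close> a divided difference is moved past a symmetric factor. For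
  \<open>\<tau>0 i = j\<close> each side contains a divided difference conjugated by reflections,
  and multiplication by \<open>var b + var a\<close> clears both denominators.\<close>

lemma reflection_identity:
  fixes p :: "('b, 'k::field) univ"
  assumes ij: "i \<in> verts Q" "j \<in> verts Q" and ab: "a \<noteq> b"
    and R: "\<tau>0 i = j \<Longrightarrow> (var b + var a) * R = f_weight \<tau>0 \<mu> i (var b) - f_weight \<tau>0 \<mu> j (var a)"
  shows "cross Q (\<tau>0 j) (\<tau>0 i) a b (refl_op \<mu> j b (cross Q (\<tau>0 i) j a b (refl_op \<mu> i b p)))
      - refl_op \<mu> i b (cross Q (\<tau>0 j) i a b (refl_op \<mu> j b (cross Q i j a b p)))
      = (if \<tau>0 i = j then R * cross Q i j a b p else 0)"
proof -
  consider (generic) "i \<noteq> j" "\<tau>0 i \<noteq> j" | (same) "i = j" | (paired) "\<tau>0 i = j"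
    by blast
  then show ?thesis
  proof cases
    case generic
    then have "\<tau>0 j \<noteq> i" "\<tau>0 j \<noteq> \<tau>0 i"
      using \<tau>0_involution ij by metis+
    moreover have "X Q (\<tau>0 i) j (var b) (- var a) = X Q (\<tau>0 i) j (var a) (- var b :: ('b, 'k) univ)"
      and "X Q i j (- var b :: ('b, 'k) univ) (- var a) = X Q i j (var a) (var b)"
      by (simp_all add: X_def)
    ultimately show ?thesis
      using generic ab
      by (simp add: cross_def refl_op_def X_\<tau>0[OF ij] neg_swap neg_swap' neg_commute[of b a] ac_simps)
  next
    case same
    \<comment> \<open>Without fixed vertices the crossing between \<open>i\<close> and
      \<open>\<tau>0 i\<close> is an exchange and not a divided difference.\<close>
    then have ne: "\<tau>0 i \<noteq> i"
      using \<tau>0_no_fixed_vertex ij by auto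
    have X: "X Q (\<tau>0 i) i (var b) (- var a) = X Q (\<tau>0 i) i (var a) (- var b :: ('b, 'k) univ)"
      by (simp add: X_def)
    let ?q = "(- var b) ^ Poly_Mapping.lookup \<mu> i * (X Q (\<tau>0 i) i (var a) (- var b) * (- var a) ^ Poly_Mapping.lookup \<mu> i) :: ('b, 'k) univ"
    have 1: "refl_op \<mu> i b (cross Q (\<tau>0 i) i a b (refl_op \<mu> i b r)) = ?q * swap a b (neg a (neg b r))" for r
      using ab ne by (simp add: cross_def refl_op_def neg_swap mult.assoc)
    \<comment> \<open>The symmetry of \<open>?q\<close> lets it pass through the divided
      difference.\<close>
    have "swap a b ?q = ?q"
      using ab by (simp add: X ac_simps)
    from dem_mult_invariant[OF ab this, of "swap a b (neg a (neg b p))"]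
    have "dem a b (?q * swap a b (neg a (neg b p))) = ?q * swap a b (neg a (neg b (dem a b p)))"
      unfolding dem_neg_neg[OF ab] .
    then show ?thesis
      unfolding same[symmetric] 1 using ne by (simp add: cross_def[of Q "\<tau>0 i" "\<tau>0 i"] cross_def[of Q i i])
  next
    case paired
    then have ji: "\<tau>0 j = i" and ne: "i \<noteq> j"
      using \<tau>0_involution[OF ij(1)] \<tau>0_no_fixed_vertex[OF ij(1)] by auto
    define m n where "m = Poly_Mapping.lookup \<mu> i" and "n = Poly_Mapping.lookup \<mu> j"
    let ?X = "X Q i j (var a) (var b) :: ('b, 'k) univ"
    have X: "X Q i j (- var b) (- var a) = ?X"
      by (simp add: X_def)
    \<comment> \<open>\<open>neg b\<close> turns the denominator \<open>var a - var b\<close> into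
      \<open>var a + var b\<close>, which the outer exchange preserves.\<close>
    have L: "(var b + var a) * (?X * swap a b (refl_op \<mu> j b (dem a b (refl_op \<mu> i b p))))
        = ?X * ((- var a) ^ n * ((- var b) ^ m * neg a (neg b p) - var a ^ m * swap a b p))"
    proof -
      have "(var b + var a) * neg b (dem a b (refl_op \<mu> i b p)) = (- var a) ^ m * swap a b (neg a (neg b p)) - var b ^ m * p"
        using ab neg_dem_mult[of a b b "refl_op \<mu> i b p"]
        by (simp add: refl_op_def m_def neg_swap add.commute)
      from arg_cong[OF this, of "swap a b"]
      have "(var b + var a) * swap a b (neg b (dem a b (refl_op \<mu> i b p))) = (- var b) ^ m * neg a (neg b p) - var a ^ m * swap a b p"
        using ab by (simp add: add.commute)
      then have "?X * ((- var a) ^ n * ((var b + var a) * swap a b (neg b (dem a b (refl_op \<mu> i b p)))))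
          = ?X * ((- var a) ^ n * ((- var b) ^ m * neg a (neg b p) - var a ^ m * swap a b p))"
        by simp
      then show ?thesis
        using ab by (simp add: refl_op_def[of _ j] n_def mult.left_commute)
    qed
    have M: "(var b + var a) * refl_op \<mu> i b (dem a b (refl_op \<mu> j b (?X * swap a b p)))
        = (- var b) ^ m * ((- var a) ^ n * (?X * neg a (neg b p)) - var b ^ n * (?X * swap a b p))"
    proof -
      have "(var b + var a) * neg b (dem a b (refl_op \<mu> j b (?X * swap a b p)))
          = (- var a) ^ n * (?X * neg a (neg b p)) - var b ^ n * (?X * swap a b p)"
        using ab neg_dem_mult[of a b b "refl_op \<mu> j b (?X * swap a b p)"]
        by (simp add: refl_op_def n_def neg_swap neg_commute[of b a] X add.commute)
      then show ?thesis
        unfolding refl_op_def[of \<mu> i] m_def by (subst mult.left_commute) simp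
    qed
    \<comment> \<open>The terms with \<open>neg a (neg b p)\<close> cancel; the remaining powers are
      the weights at \<open>var b\<close> and \<open>var a\<close>.\<close>
    have "(var b + var a) * (?X * swap a b (refl_op \<mu> j b (dem a b (refl_op \<mu> i b p)))
          - refl_op \<mu> i b (dem a b (refl_op \<mu> j b (?X * swap a b p))))
        = (var b + var a) * R * (?X * swap a b p)"
      unfolding right_diff_distrib[of "var b + var a"] L M R[OF paired] f_weight_def paired ji m_def[symmetric] n_def[symmetric]
      by (simp add: algebra_simps)
    then have "?X * swap a b (refl_op \<mu> j b (dem a b (refl_op \<mu> i b p)))
          - refl_op \<mu> i b (dem a b (refl_op \<mu> j b (?X * swap a b p))) = R * (?X * swap a b p)"
      unfolding mult.assoc using ab var_plus_cancel[of b a] by blast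
    then show ?thesis
      using paired ji ne by (simp add: cross_def)
  qed
qed

end

text \<open>With exponents \<open>m\<close> and \<open>n\<close> of \<open>\<mu>\<close> at
  \<open>i\<close> and \<open>j\<close>, the two terms are \<open>(- 1) ^ m * u ^ (m + n)\<close>
  and \<open>(- 1) ^ m * (- v) ^ (m + n)\<close>. Their signs agree, so the difference is a multiple
  of \<open>u - (- v)\<close>.\<close>

lemma f_weight_dvd:
  fixes u v :: "'r::comm_ring_1"
  assumes "\<tau> i = j" "\<tau> j = i"
  shows "u + v dvd f_weight \<tau> \<mu> i u - f_weight \<tau> \<mu> j v"
proof -
  define m n where "m = Poly_Mapping.lookup \<mu> i" and "n = Poly_Mapping.lookup \<mu> j"
  have "(- w) ^ m * w ^ n = (- 1) ^ m * w ^ (m + n)" for w :: 'r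
    by (simp add: power_minus[of w] power_add mult.assoc)
  from this[of u] this[of "- v"]
  have "(- u) ^ m * u ^ n = (- 1) ^ m * u ^ (m + n)" "(- v) ^ n * v ^ m = (- 1) ^ m * (- v) ^ (m + n)"
    by (simp_all add: mult.commute)
  then have "f_weight \<tau> \<mu> i u - f_weight \<tau> \<mu> j v = (- 1) ^ m * (u ^ (m + n) - (- v) ^ (m + n))"
    by (simp add: f_weight_def assms m_def n_def right_diff_distrib)
  also have "u ^ (m + n) - (- v) ^ (m + n) = (u + v) * (\<Sum>k<m + n. (- v) ^ (m + n - Suc k) * u ^ k)"
    using power_diff_sumr2[of u "m + n" "- v"] by simp
  finally show ?thesis
    by simp
qed

lemma dots_eval_f_weight [simp]: "dots_eval n (f_weight \<tau> \<mu> i u) = f_weight \<tau> \<mu> i (dots_eval n u)"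
  by (simp add: f_weight_def)

lemma (in involutive_quiver) orel_sound:
  fixes s t :: "('v, 'k::field) oterm"
  assumes "orel Q \<tau>0 \<mu> s t"
  shows "osrc s = osrc t \<and> (opoly_term Q \<mu> s :: ('b, 'k) univ \<Rightarrow> _) = opoly_term Q \<mu> t"
  using assms
proof (induction rule: orel.induct)
  case (orel_square i)
  \<comment> \<open>The second reflection contributes \<open>- var 0\<close> to the power of
    \<open>\<mu>\<close> at \<open>\<tau>0 i\<close>; the first contributes \<open>var 0\<close> to
    the power of \<open>\<mu>\<close> at \<open>i\<close>, its sign being undone by the second
    change of sign. This is \<open>f_weight\<close> at \<open>- var 0\<close>.\<close>
  show ?case
    by (auto simp: fun_eq_iff compose_def refl_op_in_polys poly_term_dots)
       (auto simp: refl_op_def f_weight_def)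
next
  case (orel_dot i)
  show ?case
    by (auto simp: fun_eq_iff compose_def refl_op_in_polys polys_mult) (auto simp: refl_op_def)
next
  case (orel_reflection i j)
  \<comment> \<open>On two strands \<open>y\<^sub>1\<close> is \<open>var 1\<close> and
    \<open>y\<^sub>2\<close> is \<open>var 0\<close>. Exactness of the quotient is established for
    \<open>\<tau>0 i = j\<close>, the case in which the quotient occurs in the relation.\<close>
  let ?P = "f_weight \<tau>0 \<mu> i (yvar 1) - f_weight \<tau>0 \<mu> j (yvar 2) :: (nat \<Rightarrow>\<^sub>0 nat) \<Rightarrow>\<^sub>0 'k"
  let ?R = "dots_eval 2 (exact_quotient ?P (yvar 1 + yvar 2)) :: ('b, 'k) univ"
  have "(var 1 + var 0) * ?R = f_weight \<tau>0 \<mu> i (var 1) - f_weight \<tau>0 \<mu> j (var 0)" if "\<tau>0 i = j"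
  proof -
    have "yvar 1 + yvar 2 dvd ?P"
      using that orel_reflection by (intro f_weight_dvd) (auto simp: \<tau>0_involution)
    then have "dots_eval 2 (yvar 1 + yvar 2 :: (nat \<Rightarrow>\<^sub>0 nat) \<Rightarrow>\<^sub>0 'k) * ?R = dots_eval 2 ?P"
      by (rule dots_eval_exact_quotient, erule_tac pvar_plus_cancel[THEN iffD1, rotated]) simp
    then show ?thesis
      by simp
  qed
  from reflection_identity[OF orel_reflection _ this]
  have "cross Q (\<tau>0 j) (\<tau>0 i) 0 (Suc 0) (refl_op \<mu> j (Suc 0) (cross Q (\<tau>0 i) j 0 (Suc 0) (refl_op \<mu> i (Suc 0) p)))
      - refl_op \<mu> i (Suc 0) (cross Q (\<tau>0 j) i 0 (Suc 0) (refl_op \<mu> j (Suc 0) (cross Q i j 0 (Suc 0) p)))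
      = (if \<tau>0 i = j then ?R * cross Q i j 0 (Suc 0) p else 0)" for p
    by simp
  then show ?case
    by (auto simp: fun_eq_iff compose_def ominus_def opoly_term_Rho_Id cross_in_polys refl_op_in_polys
        poly_term_dots numeral_2_eq_2 simp del: opoly_term.simps(3))
qed

lemma (in involutive_quiver) oeq_sound:
  fixes s t :: "('v, 'k::field) oterm"
  assumes "oeq Q \<tau>0 \<mu> s t"
  shows "osrc s = osrc t \<and> (opoly_term Q \<mu> s :: ('b, 'k) univ \<Rightarrow> _) = opoly_term Q \<mu> t"
  using assms
proof (induction rule: oeq.induct)
  case (oeq_rel f g)
  then show ?case by (rule orel_sound)
next
  case (oeq_Act f f' g g')
  \<comment> \<open>Here the two congruences meet: the ends of the acting term, controlled by
    \<open>keq_sound\<close>, enter the value of the action.\<close>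
  moreover from this have "ksrc g = ksrc g'" "ktgt g = ktgt g'" "(poly_term Q g :: ('b, 'k) univ \<Rightarrow> _) = poly_term Q g'"
    using keq_sound[of Q g g'] by auto
  ultimately show ?case by simp
next
  case (oeq_Emb f g)
  then show ?case using keq_sound[of Q f g] by auto
next
  case (oeq_Comp_assoc f a b g c h d)
  then show ?case
    unfolding opoly_term.simps by (simp add: oarr_osrc compose_lin_map_assoc[OF lin_map_opoly_term])
next
  case (oeq_Id_left f a b)
  then show ?case
    unfolding opoly_term.simps poly_term.simps by (simp add: oarr_osrc compose_lin_map_id[OF lin_map_opoly_term])
next
  case (oeq_Id_right f a b)
  then show ?case
    unfolding opoly_term.simps poly_term.simps by (simp add: oarr_osrc compose_lin_map_id[OF lin_map_opoly_term])
next
  case (oeq_Add_assoc f a b g h)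
  then show ?case
    unfolding opoly_term.simps by (simp add: oarr_osrc restrict_add_assoc add.assoc cong: restrict_cong)
next
  case (oeq_Add_comm f a b g)
  then show ?case
    unfolding opoly_term.simps by (simp add: oarr_osrc add.commute)
next
  case (oeq_Add_Zero f a b)
  then show ?case
    unfolding opoly_term.simps by (simp add: oarr_osrc lin_map_algebra[OF lin_map_opoly_term] del: restrict_apply)
next
  case (oeq_Add_inverse f a b)
  then show ?case
    unfolding opoly_term.simps by (simp add: oarr_osrc cong: restrict_cong)
next
  case (oeq_Scale_Add f a b g x)
  then show ?case
    unfolding opoly_term.simps by (simp add: oarr_osrc restrict_scale_add del: restrict_apply)
next
  case (oeq_Scale_add f a b x x')
  then show ?case
    unfolding opoly_term.simps by (simp add: oarr_osrc restrict_add_scale del: restrict_apply)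
next
  case (oeq_Scale_mult f a b x x')
  then show ?case
    unfolding opoly_term.simps by (simp add: oarr_osrc restrict_mult_scale del: restrict_apply univ.scale_scale)
next
  case (oeq_Scale_one f a b)
  then show ?case
    unfolding opoly_term.simps by (simp add: oarr_osrc lin_map_algebra[OF lin_map_opoly_term] del: restrict_apply univ.scale_one)
next
  case (oeq_Comp_Add_left f a b g c g')
  note * = oeq_Comp_Add_left[THEN lin_map_opoly_term]
  from oeq_Comp_Add_left show ?case
    unfolding opoly_term.simps by (simp add: oarr_osrc compose_linear(1)[OF *(1,1,2,3)] del: restrict_apply)
next
  case (oeq_Comp_Add_right f a b f' g c)
  note * = oeq_Comp_Add_right[THEN lin_map_opoly_term]
  from oeq_Comp_Add_right show ?case
    unfolding opoly_term.simps by (simp add: oarr_osrc compose_linear(2)[OF *(1,2,3,3)] del: restrict_apply)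
next
  case (oeq_Comp_Scale_left f a b g c x)
  note * = oeq_Comp_Scale_left[THEN lin_map_opoly_term]
  from oeq_Comp_Scale_left show ?case
    unfolding opoly_term.simps by (simp add: oarr_osrc compose_linear(3)[OF *(1,1,2,2)] del: restrict_apply)
next
  case (oeq_Comp_Scale_right f a b g c x)
  note * = oeq_Comp_Scale_right[THEN lin_map_opoly_term]
  from oeq_Comp_Scale_right show ?case
    unfolding opoly_term.simps by (simp add: oarr_osrc compose_linear(4)[OF *(1,1,2,2)] del: restrict_apply)
next
  case (oeq_Act_assoc f a b g c d h p q)
  note * = lin_map_opoly_term[OF oeq_Act_assoc(1)] oeq_Act_assoc(2,3)[THEN lin_map_poly_term]
  from oeq_Act_assoc show ?case
    unfolding opoly_term.simps poly_term.simps
    by (simp add: oarr_osrc karr_ksrc karr_ktgt tens_map_assoc[OF *, unfolded tens_space_polys] del: restrict_apply)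
next
  case (oeq_Act_Unit f a b)
  then show ?case
    unfolding opoly_term.simps poly_term.simps by (simp add: oarr_osrc tens_map_unit[OF lin_map_opoly_term])
next
  case (oeq_Act_Comp f a b f' c g p q g' r)
  note * = oeq_Act_Comp(1,2)[THEN lin_map_opoly_term] oeq_Act_Comp(3,4)[THEN lin_map_poly_term]
  from oeq_Act_Comp show ?case
    unfolding opoly_term.simps poly_term.simps
    by (simp add: oarr_osrc karr_ksrc karr_ktgt tens_space_polys tens_map_compose[OF *] del: restrict_apply)
next
  case (oeq_Act_Add_left f a b f' g c d)
  note * = oeq_Act_Add_left(1,2)[THEN lin_map_opoly_term] oeq_Act_Add_left(3)[THEN lin_map_poly_term]
  from oeq_Act_Add_left show ?case
    unfolding opoly_term.simps poly_term.simps
    by (simp add: oarr_osrc karr_ksrc karr_ktgt tens_space_polys tens_map_add_left[OF *] del: restrict_apply)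
next
  case (oeq_Act_Add_right f a b g c d g')
  note * = oeq_Act_Add_right(1)[THEN lin_map_opoly_term] oeq_Act_Add_right(2,3)[THEN lin_map_poly_term]
  from oeq_Act_Add_right show ?case
    unfolding opoly_term.simps poly_term.simps
    by (simp add: oarr_osrc karr_ksrc karr_ktgt tens_space_polys tens_map_add_right[OF *] del: restrict_apply)
next
  case (oeq_Act_Scale_left f a b g c d x)
  note * = oeq_Act_Scale_left(1)[THEN lin_map_opoly_term] oeq_Act_Scale_left(2)[THEN lin_map_poly_term]
  from oeq_Act_Scale_left show ?case
    unfolding opoly_term.simps poly_term.simps
    by (simp add: oarr_osrc karr_ksrc karr_ktgt tens_space_polys tens_map_scale_left[OF *] del: restrict_apply)
next
  case (oeq_Act_Scale_right f a b g c d x)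
  note * = oeq_Act_Scale_right(1)[THEN lin_map_opoly_term] oeq_Act_Scale_right(2)[THEN lin_map_poly_term]
  from oeq_Act_Scale_right show ?case
    unfolding opoly_term.simps poly_term.simps
    by (simp add: oarr_osrc karr_ksrc karr_ktgt tens_space_polys tens_map_scale_right[OF *] del: restrict_apply)
qed (auto simp: karr_ksrc karr_ktgt)

section \<open>The module category of vector spaces\<close>

text \<open>By soundness the values of a class form a singleton, so \<open>the_elem\<close> returns
  the value of any representative.\<close>

lemma poly_functor_onArr:
  fixes t :: "('v, 'k::field) kterm"
  assumes "karr Q t a b"
  shows "onArr (poly_functor Q) (a, kclass Q {t}, b) = (polys (nblack a), poly_term Q t, polys (nblack b))"
proof -
  have "(poly_term Q s :: ('b, 'k) univ \<Rightarrow> _) = poly_term Q t" if "s \<in> kclass Q {t}" for s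
    by (rule keq_sound[OF in_kclassD[OF that], THEN conjunct2, THEN conjunct2, symmetric])
  then have "poly_term Q ` kclass Q {t} = {poly_term Q t :: ('b, 'k) univ \<Rightarrow> _}"
    using self_in_kclass[OF assms] by blast
  then show ?thesis
    by (simp add: poly_functor_def)
qed

lemma Vect_simps:
  "Obj (Vect Q) = {V. univ.subspace V}"
  "Src (Vect Q) (V, f, W) = V"
  "Tgt (Vect Q) (V, f, W) = W"
  "Ide (Vect Q) V = (V, \<lambda>v\<in>V. v, V)"
  "Comp (Vect Q) (W, g, U) (V, f, W) = (V, compose V g f, U)"
  "Nul (Vect Q) V W = (V, \<lambda>v\<in>V. 0, W)"
  "Plus (Vect Q) (V, f, W) (V, h, W) = (V, \<lambda>v\<in>V. f v + h v, W)"
  "Scale (Vect Q) c (V, f, W) = (V, \<lambda>v\<in>V. uscale c (f v), W)"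
  "ActO (Vect Q) V w = tens_space V (nblack w)"
  by (simp_all add: Vect_def)

lemma Vect_ActA:
  "karr Q t a b \<Longrightarrow> ActA (Vect Q) (V, f, W) (a, kclass Q {t}, b)
    = (tens_space V (nblack a), tens_map V (nblack a) (nblack b) f (poly_term Q t), tens_space W (nblack b))"
  by (simp add: Vect_def poly_functor_onArr)

lemma Vect_homset: "F \<in> homset (Vect Q) V W \<longleftrightarrow> (\<exists>f. F = (V, f, W) \<and> lin_map V W f)"
  by (auto simp: homset_def Vect_def lin_map_def)

lemma Vect_homI: "lin_map V W f \<Longrightarrow> (V, f, W) \<in> homset (Vect Q) V W"
  and Vect_ArrI: "lin_map V W f \<Longrightarrow> (V, f, W) \<in> Arr (Vect Q)"
  by (auto simp: Vect_homset) (simp add: Vect_def lin_map_def)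

lemma Vect_homsetE:
  assumes "F \<in> homset (Vect Q) V W"
  obtains f where "F = (V, f, W)" "lin_map V W f"
  using assms by (auto simp: Vect_homset)

lemma Vect_ArrE:
  assumes "F \<in> Arr (Vect Q)"
  obtains V f W where "F = (V, f, W)" "lin_map V W f"
  using assms by (auto simp: Vect_def lin_map_def)

text \<open>Strictness on objects is \<open>tens_space_tens_space\<close> and
  \<open>tens_space_0\<close>; the axioms for arrows are the laws of \<open>lin_map\<close> and
  \<open>tens_map\<close>, applied to values of representatives.\<close>

lemma strict_right_module_Vect:
  fixes Q :: "('v, 'a) pre_digraph"
  shows "strict_right_module (KLRW Q)
    (Vect Q :: (('b, 'k::field) univ set, ('b, 'k) vmor, 'k, 'v word, ('v, 'k) kmor) module_cat)"
proof -
  interpret K: strict_monoidal_category "KLRW Q :: ('v word, ('v, 'k) kmor, 'k) monoidal_cat"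
    by (rule strict_monoidal_category_KLRW)
  show ?thesis
    by (unfold_locales; (elim KLRW_homsetE KLRW_ArrE Vect_homsetE Vect_ArrE)?;
      (simp add: KLRW_simps KLRW_Comp KLRW_Plus KLRW_Scale KLRW_TensA Vect_simps Vect_ActA
        Vect_homI Vect_ArrI karr.intros karr_ksrc karr_ktgt lin_mapD(1,2) subspace_tens_space
        lin_map_compose lin_map_id lin_map_zero lin_map_add lin_map_scale tens_map_lin_map(1) lin_map_poly_term
        tens_space_tens_space tens_space_0 del: restrict_apply)?;
      (simp add: compose_lin_map_assoc compose_lin_map_id restrict_add_assoc lin_map_algebra restrict_scale_add
        restrict_add_scale restrict_mult_scale compose_linear lin_map_poly_term tens_map_assoc
        tens_map_unit tens_map_id tens_map_compose tens_map_add_left tens_map_add_right tens_map_scale_left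
        tens_map_scale_right del: restrict_apply univ.scale_scale univ.scale_one)?;
      (simp add: lin_mapD(5) add.commute cong: restrict_cong)?)
qed

section \<open>Uniqueness and existence of the module morphism\<close>

lemma rho_eq_refl_op:
  "(\<lambda>f\<in>polys 1. (- Y 1 1) ^ Poly_Mapping.lookup \<mu> i * eval_at [- Y 1 1] f) = restrict (refl_op \<mu> i 0) (polys (Suc 0))"
  by (auto simp: Y_eq_var eval_at_neg refl_op_def intro!: restrict_ext)

lemma oeq_unit_Act:
  assumes "karr Q f a b"
  shows "oeq Q \<tau> \<mu> (OEmb (KId []) \<otimes>\<^sub>O f) (OEmb f)"
  by (rule oeq_trans[OF oeq_Emb_Act[OF karr_Id assms] oeq_Emb[OF keq_Unit_Tens[OF assms]]]) simp

text \<open>Every object is \<open>[] \<otimes> w\<close> and every \<open>OEmb f\<close> is \<open>id \<otimes> f\<close> on the empty word, so a module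
  morphism is determined by its values on the empty word and on the \<open>\<rho>\<^sub>i\<close>.\<close>

context
  fixes Q :: "('v, 'a) pre_digraph" and \<tau> :: "'v \<Rightarrow> 'v" and \<mu> :: "'v \<Rightarrow>\<^sub>0 nat"
    and H :: "('v word, ('v, 'k::field) omor, ('b, 'k) univ set, ('b, 'k) vmor) cat_map"
  assumes H: "strict_module_morphism (KLRW Q) (oKLRW Q \<tau> \<mu>) (Vect Q) H"
    and H_empty: "onObj H [] = polys 0"
    and H_rho: "\<And>i. i \<in> verts Q \<Longrightarrow>
      onArr H (rho Q \<tau> \<mu> i) = (polys (Suc 0), restrict (refl_op \<mu> i 0) (polys (Suc 0)), polys (Suc 0))"
begin

interpretation H: strict_module_morphism "KLRW Q" "oKLRW Q \<tau> \<mu>" "Vect Q" H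
  by (rule H)

lemma morphism_onObj:
  assumes "w \<in> lists (letters Q)"
  shows "onObj H w = polys (nblack w)"
  using H.onObj_ActO[of "[]" w] assms
  by (simp add: oKLRW_simps KLRW_simps Vect_simps H_empty tens_space_polys)

lemma morphism_onArr_Emb:
  assumes f: "karr Q f a b"
  shows "onArr H (a, oclass Q \<tau> \<mu> {OEmb f}, b) = (polys (nblack a), poly_term Q f, polys (nblack b))"
proof -
  have Id: "oarr Q \<tau> (OEmb (KId [])) [] []"
    by (intro oarr_Emb karr_Id) simp
  have "onArr H (ActA (oKLRW Q \<tau> \<mu>) (Ide (oKLRW Q \<tau> \<mu>) []) (a, kclass Q {f}, b))
      = ActA (Vect Q) (Ide (Vect Q) (polys 0)) (a, kclass Q {f}, b)"
    using H.onArr_ActA[of "Ide (oKLRW Q \<tau> \<mu>) []" "(a, kclass Q {f}, b)"] H.onArr_Ide[of "[]"]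
    by (simp add: oKLRW_simps oKLRW_ArrI[OF Id] KLRW_ArrI[OF f] H_empty)
  then show ?thesis
    by (simp add: oKLRW_simps oKLRW_ActA[OF Id f] oclass_eqI[OF oeq_unit_Act[OF f]] Vect_simps Vect_ActA[OF f]
        tens_space_polys unit_tens_map[OF lin_map_poly_term[OF f]] del: restrict_apply)
qed

lemma morphism_onArr:
  assumes "oarr Q \<tau> t a b"
  shows "onArr H (a, oclass Q \<tau> \<mu> {t}, b) = (polys (nblack a), opoly_term Q \<mu> t, polys (nblack b))"
  using assms
proof (induction rule: oarr.induct)
  case (oarr_Emb f a b)
  then show ?case unfolding opoly_term.simps by (rule morphism_onArr_Emb)
next
  case (oarr_Rho i)
  then show ?case unfolding opoly_term.simps using H_rho[of i] by (simp add: rho_def del: restrict_apply)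
next
  case (oarr_Act f a b g c d)
  from H.onArr_ActA[OF oKLRW_ArrI[OF oarr_Act(1)] KLRW_ArrI[OF oarr_Act(2)]]
  show ?case
    using oarr_Act
    by (simp add: oKLRW_ActA Vect_ActA oarr_osrc karr_ksrc karr_ktgt tens_space_polys)
next
  case (oarr_Comp f a b g c)
  from H.onArr_Comp[OF oKLRW_homI[OF oarr_Comp(1)] oKLRW_homI[OF oarr_Comp(2)]]
  show ?case
    using oarr_Comp by (simp add: oKLRW_Comp Vect_simps oarr_osrc)
next
  case (oarr_Zero a b)
  \<comment> \<open>Preservation of zero is not an axiom of module morphisms; the zero arrow is the
    class of an embedded zero, whose image is already known.\<close>
  then show ?case
    unfolding opoly_term.simps using morphism_onArr_Emb[OF karr_Zero[of a Q b]]
    by (simp add: oclass_eqI[OF oeq_Emb_Zero] del: restrict_apply)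
next
  case (oarr_Add f a b g)
  from H.onArr_Plus[OF oKLRW_homI[OF oarr_Add(1)] oKLRW_homI[OF oarr_Add(2)]]
  show ?case
    unfolding opoly_term.simps using oarr_Add by (simp add: oKLRW_Plus Vect_simps oarr_osrc del: restrict_apply)
next
  case (oarr_Scale f a b c)
  from H.onArr_Scale[OF oKLRW_ArrI[OF oarr_Scale(1)], of c]
  show ?case
    unfolding opoly_term.simps using oarr_Scale by (simp add: oKLRW_Scale Vect_simps oarr_osrc del: restrict_apply)
qed

end

text \<open>The value on an arrow is read off any term of its class. The restrictions to objects and
  arrows give the extensionality required of a functor.\<close>

definition polynomial_module_morphism ::
    "('v, 'a) pre_digraph \<Rightarrow> ('v \<Rightarrow> 'v) \<Rightarrow> ('v \<Rightarrow>\<^sub>0 nat)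
      \<Rightarrow> ('v word, ('v, 'k::field) omor, ('b, 'k) univ set, ('b, 'k) vmor) cat_map" where
  "polynomial_module_morphism Q \<tau> \<mu> =
   \<lparr> onObj = (\<lambda>w\<in>lists (letters Q). polys (nblack w)),
     onArr = (\<lambda>F\<in>Arr (oKLRW Q \<tau> \<mu>).
       case F of (a, S, b) \<Rightarrow> (polys (nblack a), the_elem (opoly_term Q \<mu> ` S), polys (nblack b))) \<rparr>"

context involutive_quiver
begin

lemma polynomial_module_morphism_onArr:
  fixes t :: "('v, 'k::field) oterm"
  assumes "oarr Q \<tau>0 t a b"
  shows "onArr (polynomial_module_morphism Q \<tau>0 \<mu>) (a, oclass Q \<tau>0 \<mu> {t}, b)
    = (polys (nblack a), opoly_term Q \<mu> t, polys (nblack b))"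
proof -
  have "(opoly_term Q \<mu> s :: ('b, 'k) univ \<Rightarrow> _) = opoly_term Q \<mu> t" if "s \<in> oclass Q \<tau>0 \<mu> {t}" for s
    by (rule oeq_sound[THEN conjunct2, symmetric]) (use that in \<open>simp add: oclass_singleton\<close>)
  then have "opoly_term Q \<mu> ` oclass Q \<tau>0 \<mu> {t} = {opoly_term Q \<mu> t :: ('b, 'k) univ \<Rightarrow> _}"
    using self_in_oclass[OF assms, of \<mu>] by blast
  then show ?thesis
    using oKLRW_ArrI[OF assms, of \<mu>] by (simp add: polynomial_module_morphism_def)
qed

text \<open>On representatives, preservation of each operation is the matching clause of
  \<open>opoly_term\<close>; the content lies in \<open>oeq_sound\<close>, which makes the values
  independent of the representative.\<close>

lemma strict_module_morphism_polynomial: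
  "strict_module_morphism (KLRW Q) (oKLRW Q \<tau>0 \<mu>) (Vect Q)
    (polynomial_module_morphism Q \<tau>0 \<mu> ::
      ('v word, ('v, 'k::field) omor, ('b, 'k) univ set, ('b, 'k) vmor) cat_map)"
proof -
  let ?H = "polynomial_module_morphism Q \<tau>0 \<mu> :: ('v word, ('v, 'k) omor, ('b, 'k) univ set, ('b, 'k) vmor) cat_map"
  interpret source: strict_right_module "KLRW Q" "oKLRW Q \<tau>0 \<mu> :: ('v word, ('v, 'k) omor, 'k, 'v word, ('v, 'k) kmor) module_cat"
    by (rule strict_right_module_oKLRW) (rule \<tau>0_verts)
  interpret target: strict_right_module "KLRW Q" "Vect Q :: (('b, 'k) univ set, ('b, 'k) vmor, 'k, 'v word, ('v, 'k) kmor) module_cat"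
    by (rule strict_right_module_Vect)
  have onObj: "onObj ?H w = polys (nblack w)" if "w \<in> lists (letters Q)" for w
    using that by (simp add: polynomial_module_morphism_def)
  have ext: "onObj ?H \<in> extensional (lists (letters Q))" "onArr ?H \<in> extensional (Arr (oKLRW Q \<tau>0 \<mu>))"
    by (simp_all add: polynomial_module_morphism_def)
  show ?thesis
    by (unfold_locales; (elim KLRW_homsetE KLRW_ArrE oKLRW_homsetE oKLRW_ArrE)?;
      (simp add: ext onObj polynomial_module_morphism_onArr KLRW_simps oKLRW_simps oKLRW_Comp oKLRW_Plus oKLRW_Scale oKLRW_ActA
        Vect_simps Vect_ActA Vect_homI oarr.intros karr.intros oarr_osrc karr_ksrc karr_ktgt
        oarr_lists[OF _ \<tau>0_verts] lin_map_opoly_term subspace_polys tens_space_polys)?)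
qed

end

theorem proposition2p8:
  fixes Q :: "('v, 'a) pre_digraph"
    and \<tau>0 :: "'v \<Rightarrow> 'v" and \<tau>1 :: "'a \<Rightarrow> 'a"
    and \<mu> :: "'v \<Rightarrow>\<^sub>0 nat"
  assumes "involutive_quiver Q \<tau>0 \<tau>1"
    and "dominant_weight Q \<mu>"
  shows "\<exists>!H :: ('v word, ('v, 'k::alg_closed_field) omor, ('b, 'k) univ set, ('b, 'k) vmor) cat_map.
           strict_module_morphism (KLRW Q) (oKLRW Q \<tau>0 \<mu>) (Vect Q) H \<and>
           onObj H [] = polys 0 \<and>
           (\<forall>i\<in>verts Q. onArr H (rho Q \<tau>0 \<mu> i) =
              (polys 1, \<lambda>f\<in>polys 1. (- Y 1 1) ^ Poly_Mapping.lookup \<mu> i * eval_at [- Y 1 1] f, polys 1))"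
proof -
  interpret involutive_quiver Q \<tau>0 \<tau>1
    by (rule assms)
  let ?H = "polynomial_module_morphism Q \<tau>0 \<mu> :: ('v word, ('v, 'k) omor, ('b, 'k) univ set, ('b, 'k) vmor) cat_map"
  show ?thesis
    \<comment> \<open>On a single strand \<open>Y\<^sub>1\<close> is \<open>var 0\<close>, so the
      prescribed map is \<open>refl_op\<close> with \<open>a = 0\<close>.\<close>
    unfolding rho_eq_refl_op
  proof (rule ex1I[of _ ?H], intro conjI ballI)
    show "strict_module_morphism (KLRW Q) (oKLRW Q \<tau>0 \<mu>) (Vect Q) ?H"
      by (rule strict_module_morphism_polynomial)
    show "onObj ?H [] = polys 0"
      by (simp add: polynomial_module_morphism_def)
    show "onArr ?H (rho Q \<tau>0 \<mu> i) = (polys 1, restrict (refl_op \<mu> i 0) (polys (Suc 0)), polys 1)"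
      if "i \<in> verts Q" for i
      using polynomial_module_morphism_onArr[OF oarr_Rho[OF that], of \<mu>] by (simp add: rho_def)
  next
    fix H :: "('v word, ('v, 'k) omor, ('b, 'k) univ set, ('b, 'k) vmor) cat_map"
    assume "strict_module_morphism (KLRW Q) (oKLRW Q \<tau>0 \<mu>) (Vect Q) H \<and> onObj H [] = polys 0 \<and>
      (\<forall>i\<in>verts Q. onArr H (rho Q \<tau>0 \<mu> i) = (polys 1, restrict (refl_op \<mu> i 0) (polys (Suc 0)), polys 1))"
    then have H: "strict_module_morphism (KLRW Q) (oKLRW Q \<tau>0 \<mu>) (Vect Q) H" "onObj H [] = polys 0"
      "\<And>i. i \<in> verts Q \<Longrightarrow> onArr H (rho Q \<tau>0 \<mu> i)
        = (polys (Suc 0), restrict (refl_op \<mu> i 0) (polys (Suc 0)), polys (Suc 0))"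
      by auto
    show "H = ?H"
    proof (rule cat_map.equality)
      show "onObj H = onObj ?H"
      proof (rule extensionalityI)
        show "onObj H \<in> extensional (lists (letters Q))" "onObj ?H \<in> extensional (lists (letters Q))"
          using strict_module_morphism.onObj_extensional[OF H(1)]
          by (simp_all add: oKLRW_simps polynomial_module_morphism_def)
        show "onObj H w = onObj ?H w" if "w \<in> lists (letters Q)" for w
          using morphism_onObj[OF H that] that by (simp add: polynomial_module_morphism_def)
      qed
      show "onArr H = onArr ?H"
      proof (rule extensionalityI)
        show "onArr H \<in> extensional (Arr (oKLRW Q \<tau>0 \<mu>))" "onArr ?H \<in> extensional (Arr (oKLRW Q \<tau>0 \<mu>))"
          using strict_module_morphism.onArr_extensional[OF H(1)]
          by (simp_all add: polynomial_module_morphism_def)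
        \<comment> \<open>Both functors take the class of a term \<open>t\<close> to
          \<open>opoly_term Q \<mu> t\<close>.\<close>
        show "onArr H F = onArr ?H F" if "F \<in> Arr (oKLRW Q \<tau>0 \<mu>)" for F
          using that by (elim oKLRW_ArrE) (simp add: morphism_onArr[OF H] polynomial_module_morphism_onArr)
      qed
    qed simp
  qed
qed

end
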